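(* Let $\mathcal{F}=\{f_1,\dots,f_m\}$ be a family of $m$ piecewise linear probability densities on $\mathbb{R}$, each consisting of $n$ pieces and given in the input format described in the context (with $d=1$). There is a randomized algorithm which, given $\mathcal{F}$ and parameters $\delta,\varepsilon>0$, outputs a $(\delta,\varepsilon)$-relative-error approximation of the $L_1$-distances $\|f_j-f_k\|_1$ between all pairs $j,k\in[m]$, using $O\big(m(m+n)\varepsilon^{-2}\ln(m/\delta)\big)$ arithmetic operations.
   Context: Input format for a family of $m$ piecewise degree-$d$-polynomial densities with $n$ pieces each: let $a_1<a_2<\dots<a_s$ be the sorted endpoints of all intervals occurring in the family (so $s\le 2mn$). Each $f_j$ is specified by $n$ pairs $(b_{j1},c_{j1}),\dots,(b_{jn},c_{jn})$ of indices with $1\le b_{j1}<c_{j1}<b_{j2}<c_{j2}<\dots<b_{jn}<c_{jn}\le s$, together with vectors $\alpha_{j\ell}\in\mathbb{R}^{d+1}$, such that on the interval $[a_{b_{j\ell}},a_{c_{j\ell}})$ we have $f_j(x)=(1,x,\dots,x^d)\cdot\alpha_{j\ell}$ (inner product), and $f_j=0$ outside these intervals. A $(\delta,\varepsilon)$-relative-error approximation scheme computes numbers $D_{jk}$, $j,k\in[m]$, such that with probability at least $1-\delta$, simultaneously for all $j,k\in[m]$, $(1-\varepsilon)D_{jk}\le\|f_j-f_k\|_1\le(1+\varepsilon)D_{jk}$. In the operation count, drawing a sample from a standard distribution (standard normal, $\chi^2$ with one degree of freedom, Cauchy) counts as a single operation. *)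

theory Defs
  imports "HOL-Probability.Probability"
begin

text \<open>
  Indices start at 0 here: the densities are \<open>f 0, \<dots>, f (m - 1)\<close>, the pieces of each are numbered
  \<open>0, \<dots>, n - 1\<close>, the sorted endpoints are \<open>a 0 < \<dots> < a (s - 1)\<close>.
\<close>

record input_data =
  num_dens :: nat                              (* m *)
  num_pieces :: nat                            (* n *)
  num_ends :: nat                              (* s *)
  endpt :: "nat \<Rightarrow> real"                       (* a i, for i < s *)
  left_ix :: "nat \<Rightarrow> nat \<Rightarrow> nat"                (* b j l, for j < m, l < n *)
  right_ix :: "nat \<Rightarrow> nat \<Rightarrow> nat"               (* c j l *)
  coef :: "nat \<Rightarrow> nat \<Rightarrow> nat \<Rightarrow> real"          (* alpha j l i, for i \<le> d *)

definition well_formed :: "input_data \<Rightarrow> bool" where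
  "well_formed X \<longleftrightarrow>
     strict_mono_on {..<num_ends X} (endpt X) \<and>
     {..<num_ends X} =
       (\<Union>j<num_dens X. \<Union>l<num_pieces X. {left_ix X j l, right_ix X j l}) \<and>
     (\<forall>j<num_dens X. \<forall>l<num_pieces X.
        left_ix X j l < right_ix X j l \<and> right_ix X j l < num_ends X \<and>
        (Suc l < num_pieces X \<longrightarrow> right_ix X j l < left_ix X j (Suc l)))"

definition piece :: "input_data \<Rightarrow> nat \<Rightarrow> nat \<Rightarrow> real set" where
  "piece X j l = {endpt X (left_ix X j l) ..< endpt X (right_ix X j l)}"

definition describes :: "nat \<Rightarrow> input_data \<Rightarrow> (nat \<Rightarrow> real \<Rightarrow> real) \<Rightarrow> bool" where
  "describes d X f \<longleftrightarrow> well_formed X \<and>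
     (\<forall>j<num_dens X.
        (\<forall>l<num_pieces X. \<forall>x\<in>piece X j l. f j x = (\<Sum>i\<le>d. x ^ i * coef X j l i)) \<and>
        (\<forall>x. x \<notin> (\<Union>l<num_pieces X. piece X j l) \<longrightarrow> f j x = 0))"

definition prob_density :: "(real \<Rightarrow> real) \<Rightarrow> bool" where
  "prob_density g \<longleftrightarrow> (\<forall>x. 0 \<le> g x) \<and> has_bochner_integral lborel g 1"

definition L1_dist :: "(real \<Rightarrow> real) \<Rightarrow> (real \<Rightarrow> real) \<Rightarrow> real" where
  "L1_dist g h = (\<integral>x. \<bar>g x - h x\<bar> \<partial>lborel)"

definition rel_error_approx ::
  "real \<Rightarrow> nat \<Rightarrow> (nat \<Rightarrow> real \<Rightarrow> real) \<Rightarrow> (nat \<Rightarrow> nat \<Rightarrow> real) \<Rightarrow> bool" where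
  "rel_error_approx \<epsilon> m f D \<longleftrightarrow>
     (\<forall>j<m. \<forall>k<m. (1 - \<epsilon>) * D j k \<le> L1_dist (f j) (f k) \<and>
                   L1_dist (f j) (f k) \<le> (1 + \<epsilon>) * D j k)"

datatype std_dist = Std_Normal | Chi_Square_1 | Std_Cauchy

fun law :: "std_dist \<Rightarrow> real measure" where
  "law Std_Normal = density lborel (\<lambda>x. ennreal (std_normal_density x))"
| "law Chi_Square_1 =
     distr (density lborel (\<lambda>x. ennreal (std_normal_density x))) borel (\<lambda>x. x\<^sup>2)"
| "law Std_Cauchy = density lborel (\<lambda>x. ennreal (1 / (pi * (1 + x\<^sup>2))))"

text \<open>
  A run uses a tape of independent samples: the draw with number \<open>i\<close>, if it asks for the
  distribution \<open>D\<close>, returns the entry \<open>(D, i)\<close>.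
\<close>

type_synonym tape = "std_dist \<times> nat \<Rightarrow> real"

definition tape_measure :: "tape measure" where
  "tape_measure = PiM UNIV (\<lambda>(D, i). law D)"

text \<open>
  The machine has natural-number and real registers, and natural-number and real arrays whose cells
  are addressed through natural-number registers.  A program mentions finitely many registers and
  arrays.  Naturals can be turned into reals, but reals influence the naturals only through
  comparisons; in particular there is no rounding.  Subtraction of naturals is truncated, and
  \<open>x / 0 = 0\<close> for reals.
\<close>

datatype arith = Plus | Minus | Times
datatype real_arith = RPlus | RMinus | RTimes | RDivide

datatype instr =
    NConst nat nat                 (* target register, constant *)
  | NArith arith nat nat nat       (* operation, target register, operand registers *)
  | NLoad nat nat nat              (* target register, array, index register *)
  | NStore nat nat nat             (* array, index register, source register *)
  | OfNat nat nat                  (* real target register, natural-number source register *)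
  | RArith real_arith nat nat nat
  | RLoad nat nat nat
  | RStore nat nat nat
  | Draw std_dist nat              (* distribution, real target register *)

datatype test =
    NLess nat nat
  | NLeq nat nat
  | RLess nat nat
  | RLeq nat nat

datatype prog =
    Skip
  | Instr instr
  | Seq prog prog
  | Cond test prog prog
  | Loop test prog

record state =
  nreg :: "nat \<Rightarrow> nat"
  rreg :: "nat \<Rightarrow> real"
  nmem :: "nat \<Rightarrow> nat \<Rightarrow> nat"        (* array, cell *)
  rmem :: "nat \<Rightarrow> nat \<Rightarrow> real"
  draws :: nat                       (* number of samples drawn so far *)

fun arith_op :: "arith \<Rightarrow> nat \<Rightarrow> nat \<Rightarrow> nat" where
  "arith_op Plus x y = x + y"
| "arith_op Minus x y = x - y"
| "arith_op Times x y = x * y"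

fun real_arith_op :: "real_arith \<Rightarrow> real \<Rightarrow> real \<Rightarrow> real" where
  "real_arith_op RPlus x y = x + y"
| "real_arith_op RMinus x y = x - y"
| "real_arith_op RTimes x y = x * y"
| "real_arith_op RDivide x y = x / y"

fun exec_instr :: "tape \<Rightarrow> instr \<Rightarrow> state \<Rightarrow> state" where
  "exec_instr \<omega> (NConst i c) \<sigma> = \<sigma>\<lparr>nreg := (nreg \<sigma>)(i := c)\<rparr>"
| "exec_instr \<omega> (NArith f i j k) \<sigma> =
     \<sigma>\<lparr>nreg := (nreg \<sigma>)(i := arith_op f (nreg \<sigma> j) (nreg \<sigma> k))\<rparr>"
| "exec_instr \<omega> (NLoad i A j) \<sigma> = \<sigma>\<lparr>nreg := (nreg \<sigma>)(i := nmem \<sigma> A (nreg \<sigma> j))\<rparr>"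
| "exec_instr \<omega> (NStore A i j) \<sigma> =
     \<sigma>\<lparr>nmem := (nmem \<sigma>)(A := (nmem \<sigma> A)(nreg \<sigma> i := nreg \<sigma> j))\<rparr>"
| "exec_instr \<omega> (OfNat i j) \<sigma> = \<sigma>\<lparr>rreg := (rreg \<sigma>)(i := real (nreg \<sigma> j))\<rparr>"
| "exec_instr \<omega> (RArith f i j k) \<sigma> =
     \<sigma>\<lparr>rreg := (rreg \<sigma>)(i := real_arith_op f (rreg \<sigma> j) (rreg \<sigma> k))\<rparr>"
| "exec_instr \<omega> (RLoad i A j) \<sigma> = \<sigma>\<lparr>rreg := (rreg \<sigma>)(i := rmem \<sigma> A (nreg \<sigma> j))\<rparr>"
| "exec_instr \<omega> (RStore A i j) \<sigma> =
     \<sigma>\<lparr>rmem := (rmem \<sigma>)(A := (rmem \<sigma> A)(nreg \<sigma> i := rreg \<sigma> j))\<rparr>"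
| "exec_instr \<omega> (Draw D i) \<sigma> =
     \<sigma>\<lparr>rreg := (rreg \<sigma>)(i := \<omega> (D, draws \<sigma>)), draws := Suc (draws \<sigma>)\<rparr>"

fun holds :: "test \<Rightarrow> state \<Rightarrow> bool" where
  "holds (NLess i j) \<sigma> \<longleftrightarrow> nreg \<sigma> i < nreg \<sigma> j"
| "holds (NLeq i j) \<sigma> \<longleftrightarrow> nreg \<sigma> i \<le> nreg \<sigma> j"
| "holds (RLess i j) \<sigma> \<longleftrightarrow> rreg \<sigma> i < rreg \<sigma> j"
| "holds (RLeq i j) \<sigma> \<longleftrightarrow> rreg \<sigma> i \<le> rreg \<sigma> j"

text \<open>
  \<open>exec \<omega> p \<sigma> t \<sigma>'\<close>: with tape \<open>\<omega>\<close>, program \<open>p\<close> started in \<open>\<sigma>\<close> halts in \<open>\<sigma>'\<close> after \<open>t\<close> operations.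
  Every instruction and every evaluation of a test counts as one operation, so \<open>t\<close> bounds
  the number of arithmetic operations and includes the index computations, the memory accesses and
  the draws.
\<close>

inductive exec :: "tape \<Rightarrow> prog \<Rightarrow> state \<Rightarrow> nat \<Rightarrow> state \<Rightarrow> bool" for \<omega> :: tape where
  Skip: "exec \<omega> Skip \<sigma> 0 \<sigma>"
| Instr: "exec \<omega> (Instr c) \<sigma> 1 (exec_instr \<omega> c \<sigma>)"
| Seq: "\<lbrakk>exec \<omega> p \<sigma> t \<sigma>'; exec \<omega> q \<sigma>' u \<sigma>''\<rbrakk> \<Longrightarrow> exec \<omega> (Seq p q) \<sigma> (t + u) \<sigma>''"
| CondTrue: "\<lbrakk>holds b \<sigma>; exec \<omega> p \<sigma> t \<sigma>'\<rbrakk> \<Longrightarrow> exec \<omega> (Cond b p q) \<sigma> (Suc t) \<sigma>'"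
| CondFalse: "\<lbrakk>\<not> holds b \<sigma>; exec \<omega> q \<sigma> t \<sigma>'\<rbrakk> \<Longrightarrow> exec \<omega> (Cond b p q) \<sigma> (Suc t) \<sigma>'"
| LoopFalse: "\<not> holds b \<sigma> \<Longrightarrow> exec \<omega> (Loop b p) \<sigma> 1 \<sigma>"
| LoopTrue: "\<lbrakk>holds b \<sigma>; exec \<omega> p \<sigma> t \<sigma>'; exec \<omega> (Loop b p) \<sigma>' u \<sigma>''\<rbrakk>
    \<Longrightarrow> exec \<omega> (Loop b p) \<sigma> (Suc (t + u)) \<sigma>''"

text \<open>
  Arrays are stored row by row.  All registers and cells that hold no input are 0 initially.
\<close>

definition initial_state :: "nat \<Rightarrow> input_data \<Rightarrow> real \<Rightarrow> real \<Rightarrow> state" where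
  "initial_state d X \<delta> \<epsilon> =
     (let m = num_dens X; n = num_pieces X; s = num_ends X in
      \<lparr>nreg = (\<lambda>_. 0)(0 := m, 1 := n, 2 := s),
       rreg = (\<lambda>_. 0)(0 := \<delta>, 1 := \<epsilon>),
       nmem = (\<lambda>A i. if A = 0 \<and> i < m * n then left_ix X (i div n) (i mod n)
                     else if A = 1 \<and> i < m * n then right_ix X (i div n) (i mod n)
                     else 0),
       rmem = (\<lambda>A i. if A = 0 \<and> i < s then endpt X i
                     else if A = 1 \<and> i < m * n * (d + 1)
                     then coef X (i div (d + 1) div n) (i div (d + 1) mod n) (i mod (d + 1))
                     else 0),
       draws = 0\<rparr>)"

text \<open>The output \<open>D j k\<close> is read from cell \<open>j * m + k\<close> of the real array 2.\<close>

definition result :: "nat \<Rightarrow> state \<Rightarrow> nat \<Rightarrow> nat \<Rightarrow> real" where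
  "result m \<sigma> j k = rmem \<sigma> 2 (j * m + k)"

end

theory Submission
  imports Defs "HOL-Real_Asymp.Real_Asymp"
begin

text \<open>
  Let \<open>g = f j - f k\<close>, which is linear on each elementary interval between consecutive endpoints.
  If \<open>C i\<close> are independent Cauchy variables, then \<open>\<Sum>i. w i * g (p i) * C i\<close>, with \<open>w i\<close> the length
  and \<open>p i\<close> a point of the \<open>i\<close>-th interval, is Cauchy with scale \<open>S = \<Sum>i. w i * \<bar>g (p i)\<bar>\<close>, and it is
  the difference of two numbers computable from prefix sums in \<open>O(n)\<close> operations per density.  No
  sampling from two-dimensional stable laws is needed: if \<open>p i\<close> runs through the \<open>R\<close> midpoints of an
  equidistant subdivision, the average of the \<open>R\<close> scales is \<open>(1 \<plusminus> 1 / R\<^sup>2) * \<parallel>g\<parallel>\<close>, because \<open>\<bar>g\<bar>\<close> is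
  linear on all cells but one.  So \<open>R \<approx> \<epsilon> powr (- 1 / 2)\<close> node positions suffice.

  Each scale is estimated by the geometric mean of the absolute values of \<open>Q \<approx> R ^ 3 * ln (m / \<delta>)\<close>
  samples, which costs only \<open>O(Q)\<close>: the \<open>Q\<close>-th root is found up to a factor
  \<open>1 + 1 / R\<^sup>2\<close> by a multiplicative search that starts at the first sample.  The logarithm of a
  standard Cauchy variable has mean 0 and subgaussian moments near 0.  A single geometric mean only
  has relative error about \<open>1 / R\<close>, but the linear parts of the \<open>R\<close> errors average out, and the
  quadratic parts are \<open>O(1 / R\<^sup>2) = O(\<epsilon>)\<close>.
\<close>

section \<open>Cauchy variables\<close>

text \<open>The budget dictates the design. A pair may use about \<epsilon>^-2 * ln (m / \<delta>)
  samples, which is what one scale estimate of relative accuracy \<epsilon> takes anyway; hence the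
  R * Q samples of all node positions together have to act like a single estimate. Logarithms make
  this possible: at node r the logarithm of a sample is ln S_r plus a centred variable whose law
  does not depend on r, so the linear error of the average is one weighted sum of R * Q independent
  centred terms, of size about (R * Q)^(-1/2), that is 1 / R^2 when Q is about R^3. No term
  dominates, because every S_r is at most 4 * \<parallel>g\<parallel>. The same Q exceeds R^2 by a
  factor R, so a single node deviates by more than 1 / R only with probability exp (- R * y), where
  exp (- y) is the target for the whole pair; the union over the R nodes is therefore free. What is
  left per node is the second-order term of the exponential, which is where the deviation 1 / R
  becomes 1 / R^2.\<close>

definition cauchy_density :: "real \<Rightarrow> real \<Rightarrow> real" where
  "cauchy_density \<gamma> x = \<gamma> / (pi * (\<gamma>\<^sup>2 + x\<^sup>2))"

lemma borel_measurable_cauchy_density [measurable]: "cauchy_density \<gamma> \<in> borel_measurable borel"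
  unfolding cauchy_density_def by measurable

lemma cauchy_density_nonneg: "0 \<le> \<gamma> \<Longrightarrow> 0 \<le> cauchy_density \<gamma> x"
  by (simp add: cauchy_density_def)

lemma nn_integral_FTC_real_line:
  fixes f F :: "real \<Rightarrow> real"
  assumes F: "\<And>x. DERIV F x :> f x"
  assumes cont: "\<And>x. isCont f x"
  assumes nonneg: "\<And>x. 0 \<le> f x"
  assumes A: "(F \<longlongrightarrow> A) at_bot" and B: "(F \<longlongrightarrow> B) at_top"
  shows "(\<integral>\<^sup>+x. ennreal (f x) \<partial>lborel) = ennreal (B - A)"
proof -
  have lim: "((F \<circ> real_of_ereal) \<longlongrightarrow> A) (at_right (-\<infinity>))" "((F \<circ> real_of_ereal) \<longlongrightarrow> B) (at_left \<infinity>)"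
    using A B by (simp_all add: ereal_tendsto_simps)
  have "set_integrable lborel (einterval (-\<infinity>) \<infinity>) f" "(LBINT x=-\<infinity>..\<infinity>. f x) = B - A"
    by (rule interval_integral_FTC_nonneg[OF _ F cont _ lim]; simp add: nonneg)+
  then have "integrable lborel f" "(\<integral>x. f x \<partial>lborel) = B - A"
    by (simp_all add: set_integrable_def interval_lebesgue_integral_def set_lebesgue_integral_def)
  then show ?thesis
    by (subst nn_integral_eq_integral) (auto simp: nonneg)
qed

lemma nn_integral_cauchy_density:
  assumes "0 < \<gamma>"
  shows "(\<integral>\<^sup>+x. ennreal (cauchy_density \<gamma> x) \<partial>lborel) = 1"
proof -
  have d: "DERIV (\<lambda>x. arctan (x / \<gamma>) / pi) x :> cauchy_density \<gamma> x" for x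
    unfolding cauchy_density_def using assms
    by (auto intro!: derivative_eq_intros simp: divide_simps power2_eq_square add_nonneg_eq_0_iff)
  have "(\<integral>\<^sup>+x. ennreal (cauchy_density \<gamma> x) \<partial>lborel) = ennreal (1 / 2 - (- 1 / 2))"
  proof (rule nn_integral_FTC_real_line[OF d])
    show "isCont (cauchy_density \<gamma>) x" for x
      unfolding cauchy_density_def using assms
      by (intro continuous_intros) (auto simp: sum_power2_eq_zero_iff)
    show "0 \<le> cauchy_density \<gamma> x" for x using assms by (simp add: cauchy_density_nonneg)
    show "((\<lambda>x. arctan (x / \<gamma>) / pi) \<longlongrightarrow> - 1 / 2) at_bot" using assms by real_asymp
    show "((\<lambda>x. arctan (x / \<gamma>) / pi) \<longlongrightarrow> 1 / 2) at_top" using assms by real_asymp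
  qed
  then show ?thesis by simp
qed

text \<open>
  Partial fractions; at \<open>x = 0\<close> the two quadratic denominators coincide when \<open>a = b\<close>, and this one
  point is irrelevant for the density.
\<close>

lemma conv_cauchy_density:
  fixes a b x :: real
  assumes ab: "0 < a" "0 < b" and x: "x \<noteq> 0"
  shows "(\<integral>\<^sup>+y. ennreal (cauchy_density a (x - y) * cauchy_density b y) \<partial>lborel) = ennreal (cauchy_density (a + b) x)"
proof -
  \<comment> \<open>\<open>D\<close> is the resultant, in \<open>y\<close>, of the two quadratics
    \<open>b\<^sup>2 + y\<^sup>2\<close> and \<open>a\<^sup>2 + (x - y)\<^sup>2\<close>, hence the
    denominator of all partial fraction coefficients.\<close>
  define D where "D = (x\<^sup>2 + (a + b)\<^sup>2) * (x\<^sup>2 + (a - b)\<^sup>2)"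
  have D: "D > 0" unfolding D_def using x by (intro mult_pos_pos add_pos_nonneg) auto
  define F where "F = (\<lambda>y. a * b / pi\<^sup>2 / D * (x * ln (b\<^sup>2 + y\<^sup>2) - x * ln (a\<^sup>2 + (x - y)\<^sup>2)
      + (x\<^sup>2 + a\<^sup>2 - b\<^sup>2) / b * arctan (y / b) - (x\<^sup>2 + b\<^sup>2 - a\<^sup>2) / a * arctan ((x - y) / a)))"
  define T where "T = a * b / pi\<^sup>2 / D * (pi / 2 * ((x\<^sup>2 + a\<^sup>2 - b\<^sup>2) / b + (x\<^sup>2 + b\<^sup>2 - a\<^sup>2) / a))"
  have pos: "b\<^sup>2 + y\<^sup>2 > 0" "a\<^sup>2 + (x - y)\<^sup>2 > 0" for y
    using ab by (auto intro: add_pos_nonneg)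
  have d: "DERIV F y :> cauchy_density a (x - y) * cauchy_density b y" for y
  proof -
    have at: "DERIV (\<lambda>y. arctan (y / b)) y :> b / (b\<^sup>2 + y\<^sup>2)"
      using ab pos[of y] by (auto intro!: derivative_eq_intros simp: divide_simps power2_eq_square add_nonneg_eq_0_iff)
    have at': "DERIV (\<lambda>y. arctan ((x - y) / a)) y :> - a / (a\<^sup>2 + (x - y)\<^sup>2)"
      using ab pos[of y] by (auto intro!: derivative_eq_intros simp: divide_simps power2_eq_square add_nonneg_eq_0_iff)
    have ln1: "DERIV (\<lambda>y. ln (b\<^sup>2 + y\<^sup>2)) y :> 2 * y / (b\<^sup>2 + y\<^sup>2)"
      using pos(1)[of y] by (auto intro!: derivative_eq_intros)
    have ln2: "DERIV (\<lambda>y. ln (a\<^sup>2 + (x - y)\<^sup>2)) y :> - 2 * (x - y) / (a\<^sup>2 + (x - y)\<^sup>2)"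
      using pos(2)[of y] by (auto intro!: derivative_eq_intros)
    have "DERIV F y :> a * b / pi\<^sup>2 / D * (x * (2 * y / (b\<^sup>2 + y\<^sup>2)) - x * (- 2 * (x - y) / (a\<^sup>2 + (x - y)\<^sup>2))
      + (x\<^sup>2 + a\<^sup>2 - b\<^sup>2) / b * (b / (b\<^sup>2 + y\<^sup>2)) - (x\<^sup>2 + b\<^sup>2 - a\<^sup>2) / a * (- a / (a\<^sup>2 + (x - y)\<^sup>2)))"
      unfolding F_def by (intro DERIV_cmult DERIV_add DERIV_diff at at' ln1 ln2)
    also have "x * (2 * y / (b\<^sup>2 + y\<^sup>2)) - x * (- 2 * (x - y) / (a\<^sup>2 + (x - y)\<^sup>2))
      + (x\<^sup>2 + a\<^sup>2 - b\<^sup>2) / b * (b / (b\<^sup>2 + y\<^sup>2)) - (x\<^sup>2 + b\<^sup>2 - a\<^sup>2) / a * (- a / (a\<^sup>2 + (x - y)\<^sup>2))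
      = (2 * x * y + (x\<^sup>2 + a\<^sup>2 - b\<^sup>2)) / (b\<^sup>2 + y\<^sup>2) + (2 * x * (x - y) + (x\<^sup>2 + b\<^sup>2 - a\<^sup>2)) / (a\<^sup>2 + (x - y)\<^sup>2)"
    proof -
      have "x * (2 * y / p) - x * (- 2 * (x - y) / q) + E / b * (b / p) - G / a * (- a / q)
          = (2 * x * y + E) / p + (2 * x * (x - y) + G) / q" for p q E G :: real
        using ab by (simp add: add_divide_distrib) (simp add: right_diff_distrib diff_divide_distrib mult_ac)
      then show ?thesis .
    qed
    also have "\<dots> = ((2 * x * y + (x\<^sup>2 + a\<^sup>2 - b\<^sup>2)) * (a\<^sup>2 + (x - y)\<^sup>2) + (2 * x * (x - y) + (x\<^sup>2 + b\<^sup>2 - a\<^sup>2)) * (b\<^sup>2 + y\<^sup>2))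
         / ((b\<^sup>2 + y\<^sup>2) * (a\<^sup>2 + (x - y)\<^sup>2))"
      using pos[of y] by (subst add_frac_eq) (auto simp: mult.commute)
    also have "(2 * x * y + (x\<^sup>2 + a\<^sup>2 - b\<^sup>2)) * (a\<^sup>2 + (x - y)\<^sup>2) + (2 * x * (x - y) + (x\<^sup>2 + b\<^sup>2 - a\<^sup>2)) * (b\<^sup>2 + y\<^sup>2) = D"
      unfolding D_def by algebra
    also have "a * b / pi\<^sup>2 / D * (D / ((b\<^sup>2 + y\<^sup>2) * (a\<^sup>2 + (x - y)\<^sup>2))) = cauchy_density a (x - y) * cauchy_density b y"
      using D by (simp add: cauchy_density_def power2_eq_square mult.commute mult.left_commute)
    finally show ?thesis .
  qed
  have "(\<integral>\<^sup>+y. ennreal (cauchy_density a (x - y) * cauchy_density b y) \<partial>lborel) = ennreal (T - (- T))"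
  proof (rule nn_integral_FTC_real_line[OF d])
    show "isCont (\<lambda>y. cauchy_density a (x - y) * cauchy_density b y) y" for y
      unfolding cauchy_density_def using pos[of y] by (intro continuous_intros) auto
    show "0 \<le> cauchy_density a (x - y) * cauchy_density b y" for y
      using ab by (simp add: cauchy_density_nonneg)
    have l: "((\<lambda>y. ln (b\<^sup>2 + y\<^sup>2) - ln (a\<^sup>2 + (x - y)\<^sup>2)) \<longlongrightarrow> 0) at_top"
      "((\<lambda>y. ln (b\<^sup>2 + y\<^sup>2) - ln (a\<^sup>2 + (x - y)\<^sup>2)) \<longlongrightarrow> 0) at_bot"
      using ab by real_asymp+
    have t: "((\<lambda>y. arctan (y / b)) \<longlongrightarrow> pi / 2) at_top" "((\<lambda>y. arctan (y / b)) \<longlongrightarrow> - pi / 2) at_bot"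
      "((\<lambda>y. arctan ((x - y) / a)) \<longlongrightarrow> - pi / 2) at_top" "((\<lambda>y. arctan ((x - y) / a)) \<longlongrightarrow> pi / 2) at_bot"
      using ab by real_asymp+
    \<comment> \<open>Each logarithm diverges at both ends and only their difference tends to 0, so
      they are grouped before the limit is taken.\<close>
    have F': "F = (\<lambda>y. a * b / pi\<^sup>2 / D * (x * (ln (b\<^sup>2 + y\<^sup>2) - ln (a\<^sup>2 + (x - y)\<^sup>2))
      + (x\<^sup>2 + a\<^sup>2 - b\<^sup>2) / b * arctan (y / b) - (x\<^sup>2 + b\<^sup>2 - a\<^sup>2) / a * arctan ((x - y) / a)))"
      unfolding F_def by (simp add: algebra_simps)
    have "(F \<longlongrightarrow> a * b / pi\<^sup>2 / D * (x * 0
      + (x\<^sup>2 + a\<^sup>2 - b\<^sup>2) / b * (pi / 2) - (x\<^sup>2 + b\<^sup>2 - a\<^sup>2) / a * (- pi / 2))) at_top"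
      unfolding F' by (intro tendsto_intros l t)
    moreover have "K * (x * 0 + P * (pi / 2) - G * (- pi / 2)) = K * (pi / 2 * (P + G))" for K P G :: real
      by (simp add: algebra_simps)
    ultimately show "(F \<longlongrightarrow> T) at_top" unfolding T_def by (simp only:)
    have "(F \<longlongrightarrow> a * b / pi\<^sup>2 / D * (x * 0
      + (x\<^sup>2 + a\<^sup>2 - b\<^sup>2) / b * (- pi / 2) - (x\<^sup>2 + b\<^sup>2 - a\<^sup>2) / a * (pi / 2))) at_bot"
      unfolding F' by (intro tendsto_intros l t)
    moreover have "K * (x * 0 + P * (- pi / 2) - G * (pi / 2)) = - (K * (pi / 2 * (P + G)))" for K P G :: real
      by (simp add: algebra_simps)
    ultimately show "(F \<longlongrightarrow> - T) at_bot" unfolding T_def by (simp only:)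
  qed
  also have "T - (- T) = cauchy_density (a + b) x"
  proof -
    have "(x\<^sup>2 + a\<^sup>2 - b\<^sup>2) / b + (x\<^sup>2 + b\<^sup>2 - a\<^sup>2) / a = (a + b) * (x\<^sup>2 + (a - b)\<^sup>2) / (a * b)"
      using ab by (simp add: field_simps) algebra
    then have "T - (- T) = (a + b) * (x\<^sup>2 + (a - b)\<^sup>2) / (pi * D)"
      using ab by (simp add: T_def power2_eq_square[of pi])
    also have "\<dots> = (a + b) / (pi * ((a + b)\<^sup>2 + x\<^sup>2))"
    proof -
      have "x\<^sup>2 + (a - b)\<^sup>2 > 0" using x by (simp add: add_pos_nonneg)
      then show ?thesis using ab x unfolding D_def by (simp add: add.commute)
    qed
    finally show ?thesis by (simp add: cauchy_density_def)
  qed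
  finally show ?thesis .
qed

lemma (in prob_space) add_indep_cauchy:
  assumes indep: "indep_var borel X borel Y"
  assumes pos: "0 < a" "0 < b"
  assumes X: "distributed M lborel X (cauchy_density a)"
  assumes Y: "distributed M lborel Y (cauchy_density b)"
  shows "distributed M lborel (\<lambda>\<omega>. X \<omega> + Y \<omega>) (cauchy_density (a + b))"
proof -
  have "distributed M lborel (\<lambda>\<omega>. X \<omega> + Y \<omega>)
      (\<lambda>x. \<integral>\<^sup>+y. ennreal (cauchy_density a (x - y)) * ennreal (cauchy_density b y) \<partial>lborel)"
    by (rule distributed_convolution[OF indep X Y])
  moreover have "AE x in lborel. (\<integral>\<^sup>+y. ennreal (cauchy_density a (x - y)) * ennreal (cauchy_density b y) \<partial>lborel)
      = ennreal (cauchy_density (a + b) x)"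
  proof -
    have "AE x in lborel. x \<noteq> (0::real)" by (rule AE_lborel_singleton)
    then show ?thesis
      by eventually_elim (use pos in \<open>simp add: conv_cauchy_density cauchy_density_nonneg flip: ennreal_mult\<close>)
  qed
  ultimately show ?thesis
    using density_cong[of "\<lambda>x. \<integral>\<^sup>+y. ennreal (cauchy_density a (x - y)) * ennreal (cauchy_density b y) \<partial>lborel"
        lborel "cauchy_density (a + b)"]
    unfolding distributed_def by simp
qed

lemma (in prob_space) cauchy_scale:
  assumes X: "distributed M lborel X (cauchy_density a)" and "0 < a" "c \<noteq> 0"
  shows "distributed M lborel (\<lambda>\<omega>. c * X \<omega>) (cauchy_density (\<bar>c\<bar> * a))"
proof -
  have "distributed M lborel (\<lambda>x. 0 + c * X x) (\<lambda>x. ennreal (cauchy_density a ((x - 0) / c)) / ennreal \<bar>c\<bar>)"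
    by (rule distributed_affine[OF X assms(3)])
  moreover have "ennreal (cauchy_density a ((x - 0) / c)) / ennreal \<bar>c\<bar> = ennreal (cauchy_density (\<bar>c\<bar> * a) x)" for x
  proof -
    have "a\<^sup>2 + (x / c)\<^sup>2 \<noteq> 0" "(c * a)\<^sup>2 + x\<^sup>2 \<noteq> 0"
      using assms by (auto simp: sum_power2_eq_zero_iff)
    then have "cauchy_density a (x / c) / \<bar>c\<bar> = cauchy_density (\<bar>c\<bar> * a) x"
      using assms by (simp add: cauchy_density_def power_mult_distrib divide_simps) (auto simp: abs_if power2_eq_square algebra_simps)
    then show ?thesis using assms by (simp add: divide_ennreal cauchy_density_nonneg)
  qed
  ultimately show ?thesis by simp
qed

lemma (in prob_space) sum_indep_cauchy:
  assumes "finite I" "I \<noteq> {}" "indep_vars (\<lambda>i. borel) X I"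
  assumes "\<And>i. i \<in> I \<Longrightarrow> 0 < \<gamma> i"
  assumes "\<And>i. i \<in> I \<Longrightarrow> distributed M lborel (X i) (cauchy_density (\<gamma> i))"
  shows "distributed M lborel (\<lambda>\<omega>. \<Sum>i\<in>I. X i \<omega>) (cauchy_density (\<Sum>i\<in>I. \<gamma> i))"
  using assms
proof (induct I rule: finite_ne_induct)
  case (singleton i) then show ?case by simp
next
  case (insert i I)
  have "distributed M lborel (\<lambda>\<omega>. X i \<omega> + (\<Sum>i\<in>I. X i \<omega>)) (cauchy_density (\<gamma> i + (\<Sum>i\<in>I. \<gamma> i)))"
    using insert by (intro add_indep_cauchy indep_vars_sum insert sum_pos) (auto intro: indep_vars_subset)
  then show ?case using insert by simp
qed

lemma (in prob_space) linear_comb_indep_cauchy: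
  assumes I: "finite I" "indep_vars (\<lambda>i. borel) X I"
  assumes X: "\<And>i. i \<in> I \<Longrightarrow> distributed M lborel (X i) (cauchy_density 1)"
  assumes pos: "0 < (\<Sum>i\<in>I. \<bar>c i\<bar>)"
  shows "distributed M lborel (\<lambda>\<omega>. \<Sum>i\<in>I. c i * X i \<omega>) (cauchy_density (\<Sum>i\<in>I. \<bar>c i\<bar>))"
proof -
  \<comment> \<open>A summand with coefficient 0 is constant and has no density, so scaling does not
    apply to it; it changes neither the sum nor the total scale and is dropped.\<close>
  define J where "J = {i \<in> I. c i \<noteq> 0}"
  have J: "finite J" "J \<subseteq> I" using I by (auto simp: J_def)
  have "J \<noteq> {}" 
  proof
    assume "J = {}"
    then have "(\<Sum>i\<in>I. \<bar>c i\<bar>) = 0" by (intro sum.neutral) (auto simp: J_def)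
    then show False using pos by simp
  qed
  have "distributed M lborel (\<lambda>\<omega>. \<Sum>i\<in>J. c i * X i \<omega>) (cauchy_density (\<Sum>i\<in>J. \<bar>c i\<bar>))"
  proof (rule sum_indep_cauchy[OF J(1) \<open>J \<noteq> {}\<close>])
    show "indep_vars (\<lambda>i. borel) (\<lambda>i \<omega>. c i * X i \<omega>) J"
      using indep_vars_subset[OF I(2) J(2)] by (rule indep_vars_compose2[where X=X]) auto
    show "distributed M lborel (\<lambda>\<omega>. c i * X i \<omega>) (cauchy_density \<bar>c i\<bar>)" if "i \<in> J" for i
      using cauchy_scale[OF X[of i], of "c i"] that by (auto simp: J_def)
  qed (auto simp: J_def)
  moreover have "(\<Sum>i\<in>J. c i * X i \<omega>) = (\<Sum>i\<in>I. c i * X i \<omega>)" for \<omega>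
    by (rule sum.mono_neutral_left) (auto simp: J_def I)
  moreover have "(\<Sum>i\<in>J. \<bar>c i\<bar>) = (\<Sum>i\<in>I. \<bar>c i\<bar>)"
    by (rule sum.mono_neutral_left) (auto simp: J_def I)
  ultimately show ?thesis by simp
qed

section \<open>Logarithmic moments of the Cauchy distribution\<close>

text \<open>The half-line is exhausted by the compact intervals from
  \<open>exp (- real (Suc n))\<close> to \<open>exp (real (Suc n))\<close>; substitution on each of
  them and monotone convergence on both sides give the claim. \<open>Suc n\<close> keeps the
  intervals nondegenerate.\<close>

lemma nn_integral_substitution_exp:
  fixes f :: "real \<Rightarrow> ennreal"
  assumes [measurable]: "f \<in> borel_measurable borel"
  shows "(\<integral>\<^sup>+x. f x * indicator {0<..} x \<partial>lborel) = (\<integral>\<^sup>+y. f (exp y) * exp y \<partial>lborel)"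
proof -
  have indicator_leI: "indicator A x \<le> (indicator B x :: ennreal)" if "A \<subseteq> B" for A B :: "real set" and x
    using that by (auto simp: indicator_def)
  have exp_mono: "{exp (- real (Suc i))..exp (real (Suc i))} \<subseteq> {exp (- real (Suc j))..exp (real (Suc j))}" if "i \<le> j" for i j
    using that by (intro atLeastatMost_subset_iff[THEN iffD2] disjI2) auto
  have inc: "incseq (\<lambda>n x. f x * indicator {exp (- real (Suc n))..exp (real (Suc n))} x)"
    unfolding incseq_def le_fun_def by (intro allI impI mult_left_mono indicator_leI exp_mono) auto
  have "f x * indicator {0<..} x = (SUP n::nat. f x * indicator {exp (- real (Suc n))..exp (real (Suc n))} x)" for x
  proof (cases "x > 0")
    case True
    obtain n :: nat where "\<bar>ln x\<bar> \<le> real (Suc n)"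
      using real_arch_simple[of "\<bar>ln x\<bar>"] by (metis of_nat_Suc le_add_same_cancel1 le_less_trans less_le order_trans zero_le_one add.commute)
    then have "- real (Suc n) \<le> ln x" "ln x \<le> real (Suc n)" by linarith+
    then have "x \<in> {exp (- real (Suc n))..exp (real (Suc n))}"
      using True by (simp only: atLeastAtMost_iff ln_ge_iff ln_le_cancel_iff) (metis exp_le_cancel_iff exp_ln)
    then have "f x \<le> (SUP n::nat. f x * indicator {exp (- real (Suc n))..exp (real (Suc n))} x)"
      by (intro SUP_upper2[of n]) auto
    moreover have "(SUP n::nat. f x * indicator {exp (- real (Suc n))..exp (real (Suc n))} x) \<le> f x"
      by (intro SUP_least) (auto simp: indicator_def)
    ultimately show ?thesis using True by auto
  next
    case False
    then have "x \<notin> {exp (- real (Suc n))..exp (real (Suc n))}" for n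
      by (auto dest: order_trans[rotated] intro: less_le_trans)
        (meson exp_gt_zero less_le_trans)
    then show ?thesis using False by (simp add: SUP_constant bot_ennreal)
  qed
  then have "(\<integral>\<^sup>+x. f x * indicator {0<..} x \<partial>lborel)
      = (SUP n::nat. \<integral>\<^sup>+x. f x * indicator {exp (- real (Suc n))..exp (real (Suc n))} x \<partial>lborel)"
    by (simp only:, intro nn_integral_monotone_convergence_SUP inc) auto
  also have "\<dots> = (SUP n::nat. \<integral>\<^sup>+y. f (exp y) * exp y * indicator {- real (Suc n)..real (Suc n)} y \<partial>lborel)"
    by (intro SUP_cong refl nn_integral_substitution_aux) (auto intro!: continuous_intros derivative_eq_intros)
  also have "\<dots> = (\<integral>\<^sup>+y. (SUP n::nat. f (exp y) * exp y * indicator {- real (Suc n)..real (Suc n)} y) \<partial>lborel)"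
    by (intro nn_integral_monotone_convergence_SUP[symmetric])
      (auto simp: incseq_def le_fun_def indicator_def intro: order_trans)
  also have "(\<lambda>y. SUP n::nat. f (exp y) * exp y * indicator {- real (Suc n)..real (Suc n)} y) = (\<lambda>y. f (exp y) * exp y)"
  proof
    fix y :: real
    obtain n :: nat where "\<bar>y\<bar> \<le> real (Suc n)"
      using real_arch_simple[of "\<bar>y\<bar>"] by (metis of_nat_Suc le_add_same_cancel1 le_less_trans less_le order_trans zero_le_one add.commute)
    then have "f (exp y) * exp y \<le> (SUP n::nat. f (exp y) * exp y * indicator {- real (Suc n)..real (Suc n)} y)"
      by (intro SUP_upper2[of n]) (auto simp: indicator_def abs_le_iff)
    moreover have "(SUP n::nat. f (exp y) * exp y * indicator {- real (Suc n)..real (Suc n)} y) \<le> f (exp y) * exp y"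
      by (intro SUP_least) (auto simp: indicator_def)
    ultimately show "(SUP n::nat. f (exp y) * exp y * indicator {- real (Suc n)..real (Suc n)} y) = f (exp y) * exp y"
      by (rule antisym[rotated])
  qed
  finally show ?thesis .
qed

text \<open>The moment generating function of ln \<bar>C\<bar> for a standard Cauchy variable C. Its
  closed form is 1 / cos (pi * s / 2) for \<bar>s\<bar> < 1; the bounds below avoid it. With values
  in \<open>ennreal\<close> no integrability has to be carried along.\<close>

definition cauchy_moment :: "real \<Rightarrow> ennreal" where
  "cauchy_moment s = (\<integral>\<^sup>+x. ennreal (exp (s * ln \<bar>x\<bar>) * cauchy_density 1 x) \<partial>lborel)"

lemma cauchy_moment_conv_half_line:
  "cauchy_moment s = 2 * (\<integral>\<^sup>+x. ennreal (exp (s * ln \<bar>x\<bar>) * cauchy_density 1 x) * indicator {0<..} x \<partial>lborel)"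
    (is "_ = 2 * (\<integral>\<^sup>+x. ?h x * _ \<partial>_)")
proof -
  have "cauchy_moment s = (\<integral>\<^sup>+x. ?h x * indicator {0<..} x + ?h x * indicator {..<0} x \<partial>lborel)"
    unfolding cauchy_moment_def
  proof (rule nn_integral_cong_AE)
    have "AE x in lborel. x \<noteq> (0::real)" by (rule AE_lborel_singleton)
    then show "AE x in lborel. ?h x = ?h x * indicator {0<..} x + ?h x * indicator {..<0} x"
      by eventually_elim (auto simp: indicator_def)
  qed
  also have "\<dots> = (\<integral>\<^sup>+x. ?h x * indicator {0<..} x \<partial>lborel) + (\<integral>\<^sup>+x. ?h x * indicator {..<0} x \<partial>lborel)"
    by (rule nn_integral_add) auto
  also have "(\<integral>\<^sup>+x. ?h x * indicator {..<0} x \<partial>lborel) = (\<integral>\<^sup>+x. ?h x * indicator {0<..} x \<partial>lborel)"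
    by (subst nn_integral_real_affine[where c = "-1" and t = 0])
      (auto simp: cauchy_density_def indicator_def intro!: nn_integral_cong)
  finally show ?thesis by (simp add: mult_2)
qed

text \<open>The standard Cauchy law is invariant under inversion. In the coordinate y = ln x this is
  the reflection y \<mapsto> - y, under which the density 1 / (2 * pi * cosh y) on the half-line is
  even. It is the reason why the logarithm is centred.\<close>

lemma cauchy_moment_minus: "cauchy_moment (- s) = cauchy_moment s"
proof -
  let ?h = "\<lambda>s y. ennreal (exp (s * ln \<bar>exp y\<bar>) * cauchy_density 1 (exp y)) * ennreal (exp y)"
  have "(\<integral>\<^sup>+y. ?h (- s) y \<partial>lborel) = ennreal \<bar>- 1\<bar> * (\<integral>\<^sup>+y. ?h (- s) (0 + - 1 * y) \<partial>lborel)"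
    by (rule nn_integral_real_affine) auto
  also have "\<dots> = (\<integral>\<^sup>+y. ?h s y \<partial>lborel)"
  proof -
    have "exp (s * y) * cauchy_density 1 (exp (- y)) * exp (- y) = exp (s * y) * cauchy_density 1 (exp y) * exp y" for y
      by (simp add: cauchy_density_def exp_minus field_simps power2_eq_square)
    then have "?h (- s) (- y) = ?h s y" for y
      by (simp add: cauchy_density_nonneg flip: ennreal_mult)
    then show ?thesis by simp
  qed
  finally show ?thesis
    unfolding cauchy_moment_conv_half_line by (subst (1 2) nn_integral_substitution_exp) auto
qed

text \<open>Below 1 the integrand is at most the density itself, from 1 on at most
  \<open>x powr (- 3 / 2)\<close>; both have finite mass. The exponent 1 / 2 chosen here is the
  range in which all later Chernoff parameters must stay.\<close>

lemma cauchy_moment_half_finite: "cauchy_moment (1 / 2) < \<infinity>"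
proof -
  have "(\<integral>\<^sup>+x. ennreal (exp (1 / 2 * ln \<bar>x\<bar>) * cauchy_density 1 x) * indicator {0<..} x \<partial>lborel)
      \<le> (\<integral>\<^sup>+x. ennreal (cauchy_density 1 x) + ennreal (x powr (- 3 / 2)) * indicator {1..} x \<partial>lborel)"
  proof (rule nn_integral_mono)
    fix x :: real
    show "ennreal (exp (1 / 2 * ln \<bar>x\<bar>) * cauchy_density 1 x) * indicator {0<..} x
      \<le> ennreal (cauchy_density 1 x) + ennreal (x powr (- 3 / 2)) * indicator {1..} x"
    proof (cases "x > 0")
      case x: True
      show ?thesis
      proof (cases "x < 1")
        case True
        then have "exp (1 / 2 * ln \<bar>x\<bar>) * cauchy_density 1 x \<le> 1 * cauchy_density 1 x"
          using x by (intro mult_right_mono) (auto simp: cauchy_density_nonneg)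
        then show ?thesis using True x by (simp add: ennreal_leI)
      next
        case False
        have "1 \<le> pi" using pi_gt3 by linarith
        have "exp (1 / 2 * ln \<bar>x\<bar>) * cauchy_density 1 x = x powr (1 / 2) * (1 / (pi * (1 + x\<^sup>2)))"
          using x by (simp add: powr_def cauchy_density_def)
        also have "\<dots> \<le> x powr (1 / 2) * (1 / (1 * x\<^sup>2))"
          using x \<open>1 \<le> pi\<close> by (intro mult_left_mono divide_left_mono mult_mono) (auto simp: add_pos_pos)
        also have "\<dots> = x powr (- 3 / 2)"
          using x powr_diff[of x "1/2" 2] by (simp add: powr_numeral)
        finally show ?thesis
          using x False by (simp add: ennreal_leI add_increasing)
      qed
    qed auto
  qed
  also have "\<dots> = 1 + (\<integral>\<^sup>+x. ennreal (x powr (- 3 / 2)) * indicator {1..} x \<partial>lborel)"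
    by (subst nn_integral_add) (auto simp: nn_integral_cauchy_density)
  also have "(\<integral>\<^sup>+x. ennreal (x powr (- 3 / 2)) * indicator {1..} x \<partial>lborel) = ennreal (0 - (- 2 * 1 powr (- 1 / 2)))"
  proof (rule nn_integral_FTC_atLeast[where F = "\<lambda>x. - 2 * x powr (- 1 / 2)"])
    show "((\<lambda>x::real. - 2 * x powr (- 1 / 2)) \<longlongrightarrow> 0) at_top" by real_asymp
  qed (auto intro!: derivative_eq_intros)
  also have "1 + ennreal (0 - (- 2 * 1 powr (- 1 / 2))) < \<infinity>" by simp
  finally show ?thesis
    unfolding cauchy_moment_conv_half_line by (simp add: ennreal_mult_less_top)
qed

text \<open>Convexity of sinh on the nonnegative half-line together with sinh 0 = 0, obtained by
  comparing derivatives in z.\<close>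

lemma sinh_mult_le:
  fixes t z :: real
  assumes "0 \<le> t" "t \<le> 1" "0 \<le> z"
  shows "sinh (t * z) \<le> t * sinh z"
proof -
  define g where "g = (\<lambda>z. t * sinh z - sinh (t * z))"
  have "g 0 \<le> g z"
  proof (rule DERIV_nonneg_imp_nondecreasing[OF assms(3)])
    fix x :: real assume "0 \<le> x" "x \<le> z"
    have "(g has_real_derivative t * cosh x - cosh (t * x) * t) (at x)"
      unfolding g_def by (auto intro!: derivative_eq_intros)
    moreover have "cosh (t * x) \<le> cosh x"
      using assms \<open>0 \<le> x\<close> by (intro cosh_real_nonneg_le_iff[THEN iffD2]) (auto intro: mult_left_le_one_le)
    then have "0 \<le> t * cosh x - cosh (t * x) * t"
      using assms mult_left_mono[of "cosh (t * x)" "cosh x" t] by (simp add: mult.commute)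
    ultimately show "\<exists>y. (g has_real_derivative y) (at x) \<and> 0 \<le> y" by blast
  qed
  then show ?thesis by (simp add: g_def)
qed

text \<open>Since cosh x - 1 is twice the square of sinh (x / 2), it suffices to pull the factor 2 *
  \<bar>s\<bar> out of sinh (2 * \<bar>s\<bar> * \<bar>y\<bar> / 4); squaring it yields the
  quadratic dependence on s, and what remains is controlled at s = 1 / 2.\<close>

lemma cosh_le_quadratic:
  fixes s y :: real
  assumes "\<bar>s\<bar> \<le> 1 / 2"
  shows "cosh (s * y) \<le> 1 + 4 * s\<^sup>2 * cosh (y / 2)"
proof -
  have c: "cosh x = 1 + 2 * (sinh (\<bar>x\<bar> / 2))\<^sup>2" for x :: real
    using cosh_double[of "\<bar>x\<bar> / 2"] cosh_square_eq[of "\<bar>x\<bar> / 2"] by simp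
  have "sinh ((2 * \<bar>s\<bar>) * (\<bar>y\<bar> / 4)) \<le> (2 * \<bar>s\<bar>) * sinh (\<bar>y\<bar> / 4)"
    using assms by (intro sinh_mult_le) auto
  then have "(sinh (\<bar>s * y\<bar> / 2))\<^sup>2 \<le> ((2 * \<bar>s\<bar>) * sinh (\<bar>y\<bar> / 4))\<^sup>2"
    by (intro power_mono) (auto simp: abs_mult)
  also have "\<dots> = 4 * s\<^sup>2 * (sinh (\<bar>y\<bar> / 4))\<^sup>2" by (simp add: power_mult_distrib)
  finally have "cosh (s * y) \<le> 1 + 4 * s\<^sup>2 * (2 * (sinh (\<bar>y\<bar> / 4))\<^sup>2)"
    unfolding c[of "s * y"] by simp
  also have "2 * (sinh (\<bar>y\<bar> / 4))\<^sup>2 \<le> cosh (y / 2)"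
    unfolding c[of "y / 2"] by simp
  finally show ?thesis by (simp add: mult_left_mono)
qed

text \<open>
  By the symmetry \<open>s \<mapsto> - s\<close> the moment is the mean of \<open>cosh (s * ln \<bar>x\<bar>)\<close>, which is convex in
  \<open>s\<^sup>2\<close>; so the finite moment at \<open>s = 1 / 2\<close> already yields a subgaussian bound.
\<close>

lemma cauchy_moment_bound:
  obtains c :: real where "0 \<le> c" "\<And>s. \<bar>s\<bar> \<le> 1 / 2 \<Longrightarrow> cauchy_moment s \<le> ennreal (exp (c * s\<^sup>2))"
proof
  define M where "M = enn2real (cauchy_moment (1 / 2))"
  show "0 \<le> 4 * M" by (simp add: M_def)
  have M: "cauchy_moment (1 / 2) = ennreal M"
    using cauchy_moment_half_finite by (simp add: M_def)
  have cosh: "2 * cauchy_moment s = 2 * (\<integral>\<^sup>+x. ennreal (cosh (s * ln \<bar>x\<bar>) * cauchy_density 1 x) \<partial>lborel)" for s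
  proof -
    have "2 * cauchy_moment s = cauchy_moment s + cauchy_moment (- s)"
      by (simp add: cauchy_moment_minus mult_2)
    also have "\<dots> = (\<integral>\<^sup>+x. ennreal (exp (s * ln \<bar>x\<bar>) * cauchy_density 1 x)
        + ennreal (exp (- s * ln \<bar>x\<bar>) * cauchy_density 1 x) \<partial>lborel)"
      unfolding cauchy_moment_def by (rule nn_integral_add[symmetric]) auto
    also have "\<dots> = (\<integral>\<^sup>+x. 2 * ennreal (cosh (s * ln \<bar>x\<bar>) * cauchy_density 1 x) \<partial>lborel)"
    proof (rule nn_integral_cong)
      fix x :: real
      have "exp (s * ln \<bar>x\<bar>) * cauchy_density 1 x + exp (- s * ln \<bar>x\<bar>) * cauchy_density 1 x
          = 2 * (cosh (s * ln \<bar>x\<bar>) * cauchy_density 1 x)"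
        by (simp add: cosh_def algebra_simps)
      then show "ennreal (exp (s * ln \<bar>x\<bar>) * cauchy_density 1 x) + ennreal (exp (- s * ln \<bar>x\<bar>) * cauchy_density 1 x)
          = 2 * ennreal (cosh (s * ln \<bar>x\<bar>) * cauchy_density 1 x)"
        by (metis (no_types, lifting) cauchy_density_nonneg cosh_real_nonneg ennreal_mult ennreal_numeral ennreal_plus exp_ge_zero mult_nonneg_nonneg zero_le_numeral zero_le_one)
    qed
    also have "\<dots> = 2 * (\<integral>\<^sup>+x. ennreal (cosh (s * ln \<bar>x\<bar>) * cauchy_density 1 x) \<partial>lborel)"
      by (rule nn_integral_cmult) (auto simp: cosh_def)
    finally show ?thesis .
  qed
  fix s :: real assume s: "\<bar>s\<bar> \<le> 1 / 2"
  have "2 * cauchy_moment s \<le> 2 * (\<integral>\<^sup>+x. ennreal (cauchy_density 1 x)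
      + ennreal (4 * s\<^sup>2) * ennreal (cosh (1 / 2 * ln \<bar>x\<bar>) * cauchy_density 1 x) \<partial>lborel)"
    unfolding cosh[of s]
  proof (intro mult_left_mono nn_integral_mono)
    fix x :: real
    have "cosh (s * ln \<bar>x\<bar>) * cauchy_density 1 x \<le> (1 + 4 * s\<^sup>2 * cosh (ln \<bar>x\<bar> / 2)) * cauchy_density 1 x"
      using cosh_le_quadratic[OF s] by (intro mult_right_mono) (auto simp: cauchy_density_nonneg)
    then have "ennreal (cosh (s * ln \<bar>x\<bar>) * cauchy_density 1 x)
        \<le> ennreal (cauchy_density 1 x + (4 * s\<^sup>2) * (cosh (1 / 2 * ln \<bar>x\<bar>) * cauchy_density 1 x))"
      by (intro ennreal_leI) (simp add: algebra_simps)
    also have "\<dots> = ennreal (cauchy_density 1 x) + ennreal (4 * s\<^sup>2) * ennreal (cosh (1 / 2 * ln \<bar>x\<bar>) * cauchy_density 1 x)"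
      by (subst ennreal_plus) (auto simp: cauchy_density_nonneg ennreal_mult)
    finally show "ennreal (cosh (s * ln \<bar>x\<bar>) * cauchy_density 1 x)
        \<le> ennreal (cauchy_density 1 x) + ennreal (4 * s\<^sup>2) * ennreal (cosh (1 / 2 * ln \<bar>x\<bar>) * cauchy_density 1 x)" .
  qed auto
  also have "\<dots> = 2 * (1 + ennreal (4 * s\<^sup>2) * (\<integral>\<^sup>+x. ennreal (cosh (1 / 2 * ln \<bar>x\<bar>) * cauchy_density 1 x) \<partial>lborel))"
    by (subst nn_integral_add) (auto simp: nn_integral_cauchy_density nn_integral_cmult cosh_def)
  also have "\<dots> = 2 + ennreal (4 * s\<^sup>2) * (2 * cauchy_moment (1 / 2))"
    unfolding cosh by (simp add: distrib_left mult_ac)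
  also have "\<dots> = 2 * ennreal (1 + 4 * s\<^sup>2 * M)"
  proof -
    have "0 \<le> M" by (simp add: M_def)
    then show ?thesis
      unfolding M by (simp add: distrib_left mult_ac flip: ennreal_mult ennreal_plus ennreal_numeral)
  qed
  finally have "cauchy_moment s \<le> ennreal (1 + 4 * s\<^sup>2 * M)"
    by (subst (asm) ennreal_mult_le_mult_iff) auto
  also have "\<dots> \<le> ennreal (exp (4 * M * s\<^sup>2))"
    using exp_ge_add_one_self[of "4 * M * s\<^sup>2"] by (intro ennreal_leI) (simp add: mult_ac)
  finally show "cauchy_moment s \<le> ennreal (exp (4 * M * s\<^sup>2))" .
qed

text \<open>Exponential Markov inequality; independence splits the expectation into the moments at
  \<open>t * w i\<close>, and the condition on \<open>t * w i\<close> keeps these in the range of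
  the subgaussian bound. The parameter \<open>t\<close> stays free because each application has its
  own optimum.\<close>

lemma (in prob_space) cauchy_log_chernoff:
  assumes c: "0 \<le> c" "\<And>s. \<bar>s\<bar> \<le> 1 / 2 \<Longrightarrow> cauchy_moment s \<le> ennreal (exp (c * s\<^sup>2))"
  assumes I: "finite I" "indep_vars (\<lambda>_. borel) X I"
  assumes X: "\<And>i. i \<in> I \<Longrightarrow> distributed M lborel (X i) (cauchy_density 1)"
  assumes t: "0 < t" "\<And>i. i \<in> I \<Longrightarrow> \<bar>t * w i\<bar> \<le> 1 / 2"
  shows "prob {\<omega>\<in>space M. b \<le> (\<Sum>i\<in>I. w i * ln \<bar>X i \<omega>\<bar>)} \<le> exp (c * t\<^sup>2 * (\<Sum>i\<in>I. (w i)\<^sup>2) - t * b)"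
proof -
  have meas [measurable]: "random_variable borel (X i)" if "i \<in> I" for i
    using distributed_measurable[OF X[OF that]] by simp
  have "ennreal (prob {\<omega>\<in>space M. b \<le> (\<Sum>i\<in>I. w i * ln \<bar>X i \<omega>\<bar>)})
      = emeasure M {\<omega>\<in>space M. b \<le> (\<Sum>i\<in>I. w i * ln \<bar>X i \<omega>\<bar>)}"
    by (simp add: emeasure_eq_measure)
  also have "\<dots> \<le> ennreal (exp (- t * b)) * (\<integral>\<^sup>+\<omega>\<in>space M. exp (t * (\<Sum>i\<in>I. w i * ln \<bar>X i \<omega>\<bar>)) \<partial>M)"
    by (intro Chernoff_ineq_nn_integral_ge t) auto
  also have "(\<integral>\<^sup>+\<omega>\<in>space M. exp (t * (\<Sum>i\<in>I. w i * ln \<bar>X i \<omega>\<bar>)) \<partial>M)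
      = (\<integral>\<^sup>+\<omega>. (\<Prod>i\<in>I. ennreal (exp (t * w i * ln \<bar>X i \<omega>\<bar>))) \<partial>M)"
    by (intro nn_integral_cong) (simp add: sum_distrib_left exp_sum I prod_ennreal mult.assoc)
  also have "\<dots> = (\<Prod>i\<in>I. \<integral>\<^sup>+\<omega>. ennreal (exp (t * w i * ln \<bar>X i \<omega>\<bar>)) \<partial>M)"
    by (intro indep_vars_nn_integral I indep_vars_compose2[OF I(2)]) auto
  also have "ennreal (exp (- t * b)) * \<dots> \<le> ennreal (exp (- t * b)) * (\<Prod>i\<in>I. ennreal (exp (c * (t * w i)\<^sup>2)))"
  proof (intro mult_left_mono prod_mono_ennreal)
    fix i assume i: "i \<in> I"
    have "(\<integral>\<^sup>+\<omega>. ennreal (exp (t * w i * ln \<bar>X i \<omega>\<bar>)) \<partial>M)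
        = (\<integral>\<^sup>+x. ennreal (cauchy_density 1 x) * ennreal (exp (t * w i * ln \<bar>x\<bar>)) \<partial>lborel)"
      by (rule distributed_nn_integral[OF X[OF i], symmetric]) auto
    also have "\<dots> = cauchy_moment (t * w i)"
      unfolding cauchy_moment_def by (simp add: ennreal_mult cauchy_density_nonneg mult.commute)
    finally show "(\<integral>\<^sup>+\<omega>. ennreal (exp (t * w i * ln \<bar>X i \<omega>\<bar>)) \<partial>M) \<le> ennreal (exp (c * (t * w i)\<^sup>2))"
      using c(2)[OF t(2)[OF i]] by simp
  qed auto
  also have "\<dots> = ennreal (exp (- t * b) * (\<Prod>i\<in>I. exp (c * (t * w i)\<^sup>2)))"
    by (simp add: prod_ennreal prod_nonneg flip: ennreal_mult)
  also have "exp (- t * b) * (\<Prod>i\<in>I. exp (c * (t * w i)\<^sup>2)) = exp (c * t\<^sup>2 * (\<Sum>i\<in>I. (w i)\<^sup>2) - t * b)"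
    by (simp add: exp_sum[OF I(1), symmetric] exp_add[symmetric] power_mult_distrib sum_distrib_left mult.assoc)
  finally show ?thesis by (simp add: ennreal_le_iff)
qed

section \<open>The midpoint rule for absolute values of linear functions\<close>

text \<open>An antiderivative that is differentiable at the kink as well, so that the fundamental
  theorem applies to an interval at once, wherever the zero lies.\<close>

lemma DERIV_half_signed_square:
  fixes z x :: real
  shows "((\<lambda>x. (x - z) * \<bar>x - z\<bar> / 2) has_real_derivative \<bar>x - z\<bar>) (at x)"
proof -
  consider "x < z" | "x = z" | "x > z" by linarith
  then show ?thesis
  proof cases
    case 1
    have "((\<lambda>x. - ((x - z) * (x - z)) / 2) has_real_derivative \<bar>x - z\<bar>) (at x)"
      using 1 by (auto intro!: derivative_eq_intros simp: field_simps)
    then show ?thesis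
      by (rule has_field_derivative_transform_within_open[where S = "{..<z}"]) (use 1 in \<open>auto simp: algebra_simps\<close>)
  next
    case 2
    have "(\<lambda>h::real. (h * \<bar>h\<bar> / 2) / h) \<midarrow>0\<rightarrow> 0"
    proof (rule Lim_transform_eventually)
      have "(\<lambda>h::real. \<bar>h\<bar> / 2) \<midarrow>0\<rightarrow> \<bar>0\<bar> / 2" by (intro tendsto_intros) auto
      then show "(\<lambda>h::real. \<bar>h\<bar> / 2) \<midarrow>0\<rightarrow> 0" by simp
      show "\<forall>\<^sub>F h in at (0::real). \<bar>h\<bar> / 2 = h * \<bar>h\<bar> / 2 / h"
        by (auto simp: eventually_at_filter)
    qed
    then show ?thesis using 2 by (simp add: DERIV_def)
  next
    case 3
    have "((\<lambda>x. ((x - z) * (x - z)) / 2) has_real_derivative \<bar>x - z\<bar>) (at x)"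
      using 3 by (auto intro!: derivative_eq_intros)
    then show ?thesis
      by (rule has_field_derivative_transform_within_open[where S = "{z<..}"]) (use 3 in auto)
  qed
qed

text \<open>The left side is the integral of \<bar>x\<bar> over the cell with centre
  \<open>u\<close> and radius \<open>h\<close>, and \<open>2 * h * \<bar>u\<bar>\<close> is its
  midpoint rule. The square is thus the exact error: it is nonnegative and vanishes unless 0 lies
  inside the cell.\<close>

lemma half_signed_square_diff:
  fixes u h :: real
  assumes "0 \<le> h"
  shows "(u + h) * \<bar>u + h\<bar> / 2 - (u - h) * \<bar>u - h\<bar> / 2 = 2 * h * \<bar>u\<bar> + (max 0 (h - \<bar>u\<bar>))\<^sup>2"
proof -
  consider "h \<le> u" | "u \<le> - h" | "- h < u" "u < h" by linarith
  then show ?thesis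
  proof cases
    case 1
    then have "\<bar>u + h\<bar> = u + h" "\<bar>u - h\<bar> = u - h" "\<bar>u\<bar> = u" "max 0 (h - u) = 0" using assms by auto
    then show ?thesis by (simp add: field_simps)
  next
    case 2
    then have "\<bar>u + h\<bar> = - u - h" "\<bar>u - h\<bar> = h - u" "\<bar>u\<bar> = - u" "max 0 (h + u) = 0" using assms by auto
    then show ?thesis by (simp add: field_simps)
  next
    case 3
    then have "\<bar>u + h\<bar> = u + h" "\<bar>u - h\<bar> = h - u" "max 0 (h - \<bar>u\<bar>) = h - \<bar>u\<bar>" "\<bar>u\<bar> * \<bar>u\<bar> = u * u" by auto
    then show ?thesis by (simp add: field_simps power2_eq_square)
  qed
qed

lemma has_bochner_integral_abs_linear:
  fixes a b :: real
  assumes "a < b"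
  shows "has_bochner_integral lborel (\<lambda>x. \<bar>x - z\<bar> * indicator {a..<b} x)
    ((b - z) * \<bar>b - z\<bar> / 2 - (a - z) * \<bar>a - z\<bar> / 2)"
proof -
  have "has_bochner_integral lborel (\<lambda>x. \<bar>x - z\<bar> * indicator {a..b} x)
    ((b - z) * \<bar>b - z\<bar> / 2 - (a - z) * \<bar>a - z\<bar> / 2)"
    using assms by (intro has_bochner_integral_FTC_Icc_nonneg DERIV_half_signed_square[THEN DERIV_subset])
      (auto intro!: continuous_intros)
  moreover have "AE x in lborel. \<bar>x - z\<bar> * indicator {a..b} x = \<bar>x - z\<bar> * indicator {a..<b} x"
    using AE_lborel_singleton[of b] by eventually_elim (auto simp: indicator_def)
  ultimately show ?thesis
    by (subst has_bochner_integral_cong_AE[symmetric]) auto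
qed

text \<open>At most one of the cells of radius \<open>h\<close> contains the zero \<open>z\<close>; all others contribute nothing.\<close>

lemma midpoint_excess:
  fixes z a h :: real
  assumes "0 \<le> h"
  shows "(\<Sum>r<R. (max 0 (h - \<bar>a + (2 * real r + 1) * h - z\<bar>))\<^sup>2) \<le> h\<^sup>2"
proof -
  define e where "e r = (max 0 (h - \<bar>a + (2 * real r + 1) * h - z\<bar>))\<^sup>2" for r :: nat
  show ?thesis
  proof (cases "\<exists>r0<R. e r0 \<noteq> 0")
    case False
    then show ?thesis by (simp add: e_def flip: e_def)
  next
    case True
    then obtain r0 where r0: "r0 < R" "e r0 \<noteq> 0" by blast
    have "e r = 0" if "r \<noteq> r0" for r
    proof (rule ccontr)
      assume "e r \<noteq> 0"
      then have "\<bar>a + (2 * real r + 1) * h - z\<bar> < h" "\<bar>a + (2 * real r0 + 1) * h - z\<bar> < h"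
        using r0 by (auto simp: e_def max_def split: if_splits)
      then have "\<bar>(a + (2 * real r + 1) * h - z) - (a + (2 * real r0 + 1) * h - z)\<bar> < 2 * h" by linarith
      also have "(a + (2 * real r + 1) * h - z) - (a + (2 * real r0 + 1) * h - z) = 2 * h * (real r - real r0)"
        by (simp add: algebra_simps)
      finally have "2 * h * \<bar>real r - real r0\<bar> < 2 * h * 1" using assms by (simp add: abs_mult)
      then have "\<bar>real r - real r0\<bar> < 1"
        using assms by (subst (asm) mult_less_cancel_left) auto
      then show False using that by linarith
    qed
    then have "(\<Sum>r<R. e r) = e r0"
      using r0 by (intro sum.mono_neutral_right[of _ "{r0}" e, simplified]) auto
    also have "e r0 \<le> h\<^sup>2" unfolding e_def using assms by (intro power_mono) auto
    finally show ?thesis by (simp add: e_def)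
  qed
qed

text \<open>In units of \<bar>B\<bar> the midpoint error is at most the square of the cell radius w
  / (2 * R), whereas the integral is at least w^2 / 4, its value when the zero is at the centre. The
  quotient of the two is the relative error 1 / R^2. The last claim bounds a single node by the
  mean; it later keeps the weights of the concentration argument small.\<close>

lemma abs_linear_integral:
  fixes a b A B :: real and R :: nat
  assumes "a < b" "1 \<le> R"
  defines "w \<equiv> b - a"
  obtains I where "has_bochner_integral lborel (\<lambda>x. \<bar>A + B * x\<bar> * indicator {a..<b} x) I"
    "\<bar>(\<Sum>r<R. w * \<bar>A + B * (a + (2 * real r + 1) / (2 * real R) * w)\<bar>) / real R - I\<bar> \<le> I / (real R)\<^sup>2"
    "\<And>x. a \<le> x \<Longrightarrow> x \<le> b \<Longrightarrow> w * \<bar>A + B * x\<bar> \<le> 4 * I"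
proof (cases "B = 0")
  case True
  have "has_bochner_integral lborel (\<lambda>x. \<bar>A\<bar> * indicator {a..<b} x) (\<bar>A\<bar> * w)"
    using has_bochner_integral_real_indicator[of "{a..<b}" lborel] assms
    by (intro has_bochner_integral_mult_right) (auto simp: w_def)
  then show ?thesis
    using assms True by (intro that[of "\<bar>A\<bar> * w"]) (auto simp: mult.commute)
next
  case B: False
  define z where "z = - A / B"
  have g: "\<bar>A + B * x\<bar> = \<bar>B\<bar> * \<bar>x - z\<bar>" for x
    using B by (simp add: z_def field_simps flip: abs_mult)
  define F where "F x = (x - z) * \<bar>x - z\<bar> / 2" for x
  have w: "w > 0" using assms by (simp add: w_def)
  have hbi: "has_bochner_integral lborel (\<lambda>x. \<bar>A + B * x\<bar> * indicator {a..<b} x) (\<bar>B\<bar> * (F b - F a))"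
    unfolding g F_def mult.assoc by (intro has_bochner_integral_mult_right has_bochner_integral_abs_linear assms)
  have cell: "F (c + h) - F (c - h) = 2 * h * \<bar>c - z\<bar> + (max 0 (h - \<bar>c - z\<bar>))\<^sup>2" if "0 \<le> h" for c h
    using half_signed_square_diff[OF that, of "c - z"] by (simp add: F_def algebra_simps)
  define h where "h = w / (2 * real R)"
  have h: "h > 0" using w assms by (simp add: h_def)
  \<comment> \<open>The interval is taken as one cell of radius \<open>w / 2\<close>, which
    expresses the integral through the distance of the zero from the centre alone.\<close>
  have whole: "F b - F a = w * \<bar>(a + b) / 2 - z\<bar> + (max 0 (w / 2 - \<bar>(a + b) / 2 - z\<bar>))\<^sup>2"
    using cell[of "w / 2" "(a + b) / 2"] w by (simp add: w_def field_simps)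
  define y where "y = \<bar>(a + b) / 2 - z\<bar>"
  have y: "y \<ge> 0" by (simp add: y_def)
  have ge: "w\<^sup>2 / 4 \<le> F b - F a" "w * y + w\<^sup>2 / 2 \<le> 4 * (F b - F a)"
  proof -
    have *: "w\<^sup>2 / 4 \<le> w * y + (max 0 (w / 2 - y))\<^sup>2 \<and> w * y + w\<^sup>2 / 2 \<le> 4 * (w * y + (max 0 (w / 2 - y))\<^sup>2)"
    proof (cases "w / 2 \<le> y")
      case True
      then have "w * (w / 2) \<le> w * y" using w by (intro mult_left_mono) auto
      moreover have "max 0 (w / 2 - y) = 0" using True by simp
      ultimately show ?thesis using y w by (simp add: power2_eq_square)
    next
      case False
      \<comment> \<open>In this case the integral is w^2 / 4 + y^2, and the two inequalities are
        exactly the nonnegativity of these expressions.\<close>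
      have "0 \<le> y\<^sup>2" "0 \<le> (w / 2 - y)\<^sup>2 + 3 * y\<^sup>2 + (w / 2)\<^sup>2" by simp_all
      then show ?thesis using False by (auto simp: max_def power2_eq_square algebra_simps)
    qed
    then show "w\<^sup>2 / 4 \<le> F b - F a" "w * y + w\<^sup>2 / 2 \<le> 4 * (F b - F a)" unfolding whole y_def by auto
  qed
  have tele: "F b - F a = (\<Sum>r<R. F (a + (2 * real r + 1) * h + h) - F (a + (2 * real r + 1) * h - h))"
  proof -
    have "(\<Sum>r<R. F (a + 2 * real (Suc r) * h) - F (a + 2 * real r * h)) = F (a + 2 * real R * h) - F (a + 2 * real 0 * h)"
      by (rule sum_lessThan_telescope)
    moreover have "a + 2 * real R * h = b" using assms by (simp add: h_def w_def)
    ultimately show ?thesis by (simp add: algebra_simps)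
  qed
  define e where "e = (\<Sum>r<R. (max 0 (h - \<bar>a + (2 * real r + 1) * h - z\<bar>))\<^sup>2)"
  have e: "0 \<le> e" "e \<le> h\<^sup>2" unfolding e_def using h by (auto intro!: sum_nonneg midpoint_excess)
  have "(\<Sum>r<R. w * \<bar>A + B * (a + (2 * real r + 1) / (2 * real R) * w)\<bar>) / real R
      = \<bar>B\<bar> * (\<Sum>r<R. 2 * h * \<bar>a + (2 * real r + 1) * h - z\<bar>)"
    unfolding g sum_distrib_left sum_divide_distrib using assms by (intro sum.cong) (simp_all add: h_def field_simps)
  also have "\<dots> = \<bar>B\<bar> * (F b - F a) - \<bar>B\<bar> * e"
    unfolding tele e_def using h by (simp add: cell sum.distrib right_diff_distrib distrib_left)
  finally have mid: "(\<Sum>r<R. w * \<bar>A + B * (a + (2 * real r + 1) / (2 * real R) * w)\<bar>) / real R = \<dots>" .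
  have "\<bar>B\<bar> * e \<le> \<bar>B\<bar> * (F b - F a) / (real R)\<^sup>2"
  proof -
    have "e \<le> (w\<^sup>2 / 4) / (real R)\<^sup>2" using e by (simp add: h_def power_divide power_mult_distrib)
    also have "\<dots> \<le> (F b - F a) / (real R)\<^sup>2" using ge by (intro divide_right_mono) auto
    finally show ?thesis by (simp add: mult_left_mono flip: times_divide_eq_right)
  qed
  moreover have "w * \<bar>A + B * x\<bar> \<le> 4 * (\<bar>B\<bar> * (F b - F a))" if "a \<le> x" "x \<le> b" for x
  proof -
    have "\<bar>x - z\<bar> \<le> y + w / 2" unfolding y_def w_def using that by (simp add: abs_if field_simps)
    then have "w * \<bar>x - z\<bar> \<le> w * (y + w / 2)" using w by (intro mult_left_mono) auto
    also have "\<dots> \<le> 4 * (F b - F a)" using ge(2) by (simp add: power2_eq_square algebra_simps)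
    finally have "\<bar>B\<bar> * (w * \<bar>x - z\<bar>) \<le> \<bar>B\<bar> * (4 * (F b - F a))" by (rule mult_left_mono) simp
    then show ?thesis by (simp add: g mult_ac)
  qed
  ultimately show ?thesis
    using e mid by (intro that[OF hbi]) (simp_all only: mid, auto simp: abs_mult)
qed

section \<open>Reduction to the common grid of elementary intervals\<close>

text \<open>Coefficients of \<open>f j\<close> on the elementary interval \<open>[a i, a (i + 1))\<close>; at most one summand is not 0.\<close>

definition elem_coef :: "input_data \<Rightarrow> nat \<Rightarrow> nat \<Rightarrow> nat \<Rightarrow> real" where
  "elem_coef X j e i = (\<Sum>l<num_pieces X. if left_ix X j l \<le> i \<and> i < right_ix X j l then coef X j l e else 0)"

abbreviation width :: "input_data \<Rightarrow> nat \<Rightarrow> real" where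
  "width X i \<equiv> endpt X (Suc i) - endpt X i"

definition node :: "input_data \<Rightarrow> nat \<Rightarrow> nat \<Rightarrow> nat \<Rightarrow> real" where
  "node X R r i = endpt X i + (2 * real r + 1) / (2 * real R) * width X i"

text \<open>
  The Riemann sum of \<open>\<bar>f j - f k\<bar>\<close> with one node per elementary interval, at relative position
  \<open>(2 r + 1) / (2 R)\<close>.  Its average over \<open>r < R\<close> is a midpoint rule, hence accurate up to a factor
  \<open>1 \<plusminus> 1 / R\<^sup>2\<close>.
\<close>

definition sketch_scale :: "input_data \<Rightarrow> nat \<Rightarrow> nat \<Rightarrow> nat \<Rightarrow> nat \<Rightarrow> real" where
  "sketch_scale X R j k r = (\<Sum>i<num_ends X - 1. width X i *
     \<bar>(elem_coef X j 0 i - elem_coef X k 0 i) + (elem_coef X j 1 i - elem_coef X k 1 i) * node X R r i\<bar>)"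

lemma well_formed_endpt_less:
  assumes "well_formed X" "i < num_ends X" "i' < num_ends X"
  shows "endpt X i < endpt X i' \<longleftrightarrow> i < i'" "endpt X i \<le> endpt X i' \<longleftrightarrow> i \<le> i'"
proof -
  have "strict_mono_on {..<num_ends X} (endpt X)" using assms(1) unfolding well_formed_def by blast
  then have *: "endpt X i < endpt X i' \<longleftrightarrow> i < i'" if "i < num_ends X" "i' < num_ends X" for i i'
    using that strict_mono_on_less[of "{..<num_ends X}" "endpt X" i i'] by blast
  show "endpt X i < endpt X i' \<longleftrightarrow> i < i'" using * assms by blast
  show "endpt X i \<le> endpt X i' \<longleftrightarrow> i \<le> i'" using *[of i' i] assms by (simp flip: not_less)
qed

lemma well_formed_pieces_ordered:
  assumes "well_formed X" "j < num_dens X" "l < l'" "l' < num_pieces X"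
  shows "right_ix X j l < left_ix X j l'"
  using assms(3,4)
proof (induction l' rule: less_induct)
  case (less l')
  obtain l'' where l'': "l' = Suc l''" using less.prems by (cases l') auto
  have *: "right_ix X j l'' < left_ix X j l'" "left_ix X j l'' < right_ix X j l''"
    using assms less.prems unfolding l'' well_formed_def by auto
  show ?case
  proof (cases "l = l''")
    case False
    then have "right_ix X j l < left_ix X j l''" using less l'' by auto
    then show ?thesis using * by simp
  qed (use * in simp)
qed

text \<open>All densities are rewritten on one grid, so that the difference of any two is again
  linear on every elementary interval, although their pieces need not match.\<close>

lemma describes_elem_coef:
  assumes d: "describes 1 X f" and j: "j < num_dens X"
  shows "f j x = (\<Sum>i<num_ends X - 1. (elem_coef X j 0 i + elem_coef X j 1 i * x) * indicator {endpt X i..<endpt X (Suc i)} x)"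
proof -
  have wf: "well_formed X" using d by (simp add: describes_def)
  note less = well_formed_endpt_less[OF wf]
  have piece: "left_ix X j l < right_ix X j l" "right_ix X j l < num_ends X" if "l < num_pieces X" for l
    using wf j that unfolding well_formed_def by auto
  have fp: "f j x = coef X j l 0 + coef X j l 1 * x" if "l < num_pieces X" "x \<in> piece X j l" for l x
    using d j that by (simp add: describes_def mult.commute)
  have f0: "f j x = 0" if "x \<notin> (\<Union>l<num_pieces X. piece X j l)" for x
    using d j that by (simp add: describes_def)
  show ?thesis
  proof (cases "\<exists>i<num_ends X - 1. x \<in> {endpt X i..<endpt X (Suc i)}")
    case True
    then obtain i where i: "i < num_ends X - 1" "endpt X i \<le> x" "x < endpt X (Suc i)" by auto
    have uniq: "x \<notin> {endpt X i'..<endpt X (Suc i')}" if "i' < num_ends X - 1" "i' \<noteq> i" for i'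
    proof
      assume "x \<in> {endpt X i'..<endpt X (Suc i')}"
      then have "endpt X i < endpt X (Suc i')" "endpt X i' < endpt X (Suc i)" using i by auto
      then have "i < Suc i'" "i' < Suc i" using less i that by auto
      then show False using that by auto
    qed
    have "(\<Sum>i<num_ends X - 1. (elem_coef X j 0 i + elem_coef X j 1 i * x) * indicator {endpt X i..<endpt X (Suc i)} x)
        = (\<Sum>i'\<in>{i}. (elem_coef X j 0 i' + elem_coef X j 1 i' * x) * indicator {endpt X i'..<endpt X (Suc i')} x)"
      using i uniq by (intro sum.mono_neutral_right) (auto simp: indicator_def)
    also have "\<dots> = elem_coef X j 0 i + elem_coef X j 1 i * x" using i by simp
    also have "\<dots> = f j x"
    proof -
      \<comment> \<open>No endpoint lies strictly between two consecutive ones, so membership of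
        \<open>x\<close> in a piece depends only on the index \<open>i\<close> of its elementary
        interval.\<close>
      have mem: "x \<in> piece X j l \<longleftrightarrow> left_ix X j l \<le> i \<and> i < right_ix X j l" if "l < num_pieces X" for l
      proof
        assume "x \<in> piece X j l"
        then have "endpt X (left_ix X j l) < endpt X (Suc i)" "endpt X i < endpt X (right_ix X j l)"
          using i by (auto simp: piece_def)
        then show "left_ix X j l \<le> i \<and> i < right_ix X j l"
          using less(1) piece[OF that] i(1) by auto
      next
        assume *: "left_ix X j l \<le> i \<and> i < right_ix X j l"
        then have "endpt X (left_ix X j l) \<le> endpt X i" "endpt X (Suc i) \<le> endpt X (right_ix X j l)"
          using less(2) piece[OF that] i(1) by auto
        then show "x \<in> piece X j l" using i by (auto simp: piece_def)
      qed
      show ?thesis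
      proof (cases "\<exists>l<num_pieces X. left_ix X j l \<le> i \<and> i < right_ix X j l")
        case True
        then obtain l where l: "l < num_pieces X" "left_ix X j l \<le> i" "i < right_ix X j l" by blast
        have "\<not> (left_ix X j l' \<le> i \<and> i < right_ix X j l')" if "l' < num_pieces X" "l' \<noteq> l" for l'
          using well_formed_pieces_ordered[OF wf j, of l l'] well_formed_pieces_ordered[OF wf j, of l' l] l that
          by (cases "l < l'") auto
        then have "elem_coef X j e i = (\<Sum>l\<in>{l}. coef X j l e)" for e
          unfolding elem_coef_def using l by (intro sum.mono_neutral_cong_right) auto
        then show ?thesis using fp[of l x] mem[of l] l by simp
      next
        case False
        then have "elem_coef X j e i = 0" for e
          unfolding elem_coef_def by (intro sum.neutral) auto
        moreover have "x \<notin> (\<Union>l<num_pieces X. piece X j l)" using False mem by auto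
        ultimately show ?thesis using f0 by simp
      qed
    qed
    finally show ?thesis by simp
  next
    case False
    have "x \<notin> (\<Union>l<num_pieces X. piece X j l)"
    proof
      assume "x \<in> (\<Union>l<num_pieces X. piece X j l)"
      then obtain l where l: "l < num_pieces X" "endpt X (left_ix X j l) \<le> x" "x < endpt X (right_ix X j l)"
        by (auto simp: piece_def)
      \<comment> \<open>A discrete intermediate value argument: while \<open>c\<close> climbs from
        the left to the right index of the piece, some step takes the endpoint past
        \<open>x\<close>.\<close>
      have "x < endpt X c \<longrightarrow> (\<exists>i<c. endpt X i \<le> x \<and> x < endpt X (Suc i))" if "left_ix X j l \<le> c" for c
        using that
      proof (induction c rule: dec_induct)
        case base
        then show ?case using l by simp
      next
        case (step c)
        then show ?case by (cases "x < endpt X c") (auto simp: less_Suc_eq)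
      qed
      then obtain i where "i < right_ix X j l" "endpt X i \<le> x" "x < endpt X (Suc i)"
        using l piece[OF l(1)] by (meson less_imp_le)
      then have "i < num_ends X - 1" "x \<in> {endpt X i..<endpt X (Suc i)}" using piece[OF l(1)] by auto
      then show False using False by blast
    qed
    moreover have "(\<Sum>i<num_ends X - 1. (elem_coef X j 0 i + elem_coef X j 1 i * x) * indicator {endpt X i..<endpt X (Suc i)} x) = 0"
      using False by (intro sum.neutral) (auto simp: indicator_def)
    ultimately show ?thesis using f0 by simp
  qed
qed

text \<open>The relative error of the midpoint rule is the same on all elementary intervals, so it
  survives summation. The bound by \<open>4 * D\<close> holds for each node position separately; it
  says that no position can dominate the average.\<close>

lemma sketch_scale_approximates_L1:
  assumes d: "describes 1 X f" and j: "j < num_dens X" "k < num_dens X" and R: "1 \<le> R"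
  defines "D \<equiv> L1_dist (f j) (f k)"
  shows "\<bar>(\<Sum>r<R. sketch_scale X R j k r) / real R - D\<bar> \<le> D / (real R)\<^sup>2"
    "\<And>r. r < R \<Longrightarrow> 0 \<le> sketch_scale X R j k r"
    "\<And>r. r < R \<Longrightarrow> sketch_scale X R j k r \<le> 4 * D"
proof -
  have wf: "well_formed X" using d by (simp add: describes_def)
  define s where "s = num_ends X - 1"
  define A where "A i = elem_coef X j 0 i - elem_coef X k 0 i" for i
  define B where "B i = elem_coef X j 1 i - elem_coef X k 1 i" for i
  have lt: "endpt X i < endpt X (Suc i)" if "i < s" for i
    using well_formed_endpt_less(1)[OF wf, of i "Suc i"] that by (simp add: s_def)
  have "\<exists>I. has_bochner_integral lborel (\<lambda>x. \<bar>A i + B i * x\<bar> * indicator {endpt X i..<endpt X (Suc i)} x) I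
    \<and> \<bar>(\<Sum>r<R. width X i * \<bar>A i + B i * node X R r i\<bar>) / real R - I\<bar> \<le> I / (real R)\<^sup>2
    \<and> (\<forall>x. endpt X i \<le> x \<longrightarrow> x \<le> endpt X (Suc i) \<longrightarrow> width X i * \<bar>A i + B i * x\<bar> \<le> 4 * I)"
    (is "\<exists>I. ?Q i I") if "i < s" for i
    unfolding node_def by (rule abs_linear_integral[OF lt[OF that] R, of "A i" "B i"]) blast
  then have "\<exists>I. \<forall>i\<in>{..<s}. ?Q i (I i)" by (intro bchoice) simp
  then obtain I where I': "\<And>i. i < s \<Longrightarrow> ?Q i (I i)" by auto
  note I = I'[THEN conjunct1] I'[THEN conjunct2, THEN conjunct1]
    I'[THEN conjunct2, THEN conjunct2, THEN spec, THEN mp, THEN mp]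
  \<comment> \<open>The absolute value may be moved inside the sum because at most one indicator is
    nonzero at \<open>x\<close>.\<close>
  have disj: "\<bar>f j x - f k x\<bar> = (\<Sum>i<s. \<bar>A i + B i * x\<bar> * indicator {endpt X i..<endpt X (Suc i)} x)" for x
  proof -
    have eq: "f j x - f k x = (\<Sum>i<s. (A i + B i * x) * indicator {endpt X i..<endpt X (Suc i)} x)"
      unfolding describes_elem_coef[OF d j(1)] describes_elem_coef[OF d j(2)] sum_subtractf[symmetric] s_def A_def B_def
      by (intro sum.cong refl) (simp add: algebra_simps)
    show ?thesis
    proof (cases "\<exists>i<s. x \<in> {endpt X i..<endpt X (Suc i)}")
      case True
      then obtain i where i: "i < s" "x \<in> {endpt X i..<endpt X (Suc i)}" by blast
      have uniq: "x \<notin> {endpt X i'..<endpt X (Suc i')}" if "i' < s" "i' \<noteq> i" for i'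
      proof
        assume "x \<in> {endpt X i'..<endpt X (Suc i')}"
        then have "endpt X i < endpt X (Suc i')" "endpt X i' < endpt X (Suc i)" using i by auto
        then have "i < Suc i'" "i' < Suc i"
          using well_formed_endpt_less(1)[OF wf] i that by (auto simp: s_def)
        then show False using that by auto
      qed
      have *: "(\<Sum>i<s. g i * indicator {endpt X i..<endpt X (Suc i)} x) = g i" for g :: "nat \<Rightarrow> real"
        using i uniq by (subst sum.mono_neutral_right[where S = "{i}"]) (auto simp: indicator_def)
      show ?thesis unfolding eq * ..
    next
      case False
      then have "(\<Sum>i<s. g i * indicator {endpt X i..<endpt X (Suc i)} x) = 0" for g :: "nat \<Rightarrow> real"
        by (intro sum.neutral) (auto simp: indicator_def)
      then show ?thesis unfolding eq by simp
    qed
  qed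
  have D: "D = (\<Sum>i<s. I i)"
    unfolding D_def L1_dist_def disj
    by (intro has_bochner_integral_integral_eq has_bochner_integral_sum I) simp
  have S: "sketch_scale X R j k r = (\<Sum>i<s. width X i * \<bar>A i + B i * node X R r i\<bar>)" for r
    by (simp add: sketch_scale_def A_def B_def s_def)
  have "(\<Sum>r<R. sketch_scale X R j k r) / real R - D
      = (\<Sum>i<s. (\<Sum>r<R. width X i * \<bar>A i + B i * node X R r i\<bar>) / real R - I i)"
    unfolding S D sum_subtractf sum_divide_distrib[symmetric] by (subst sum.swap) simp
  also have "\<bar>\<dots>\<bar> \<le> (\<Sum>i<s. I i / (real R)\<^sup>2)"
    by (intro sum_abs[THEN order_trans] sum_mono I) simp
  finally show "\<bar>(\<Sum>r<R. sketch_scale X R j k r) / real R - D\<bar> \<le> D / (real R)\<^sup>2"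
    by (simp add: D sum_divide_distrib)
  fix r assume r: "r < R"
  show "0 \<le> sketch_scale X R j k r"
    unfolding S using lt by (intro sum_nonneg mult_nonneg_nonneg) (auto intro: less_imp_le)
  show "sketch_scale X R j k r \<le> 4 * D"
    unfolding S D sum_distrib_left
  proof (intro sum_mono I(3))
    fix i assume "i \<in> {..<s}"
    then have lt: "width X i > 0" using lt by auto
    have "0 \<le> (2 * real r + 1) / (2 * real R)" "(2 * real r + 1) / (2 * real R) \<le> 1" using r by (auto simp: field_simps)
    then have "0 \<le> (2 * real r + 1) / (2 * real R) * width X i" "(2 * real r + 1) / (2 * real R) * width X i \<le> 1 * width X i"
      using lt by (auto intro!: mult_right_mono simp del: mult_1 times_divide_eq_left)
    then show "endpt X i \<le> node X R r i" "node X R r i \<le> endpt X (Suc i)" by (auto simp: node_def)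
  qed auto
qed

section \<open>Program logic with operation counts\<close>

text \<open>Total correctness with a budget. \<open>exec\<close> counts exactly, but
  \<open>T\<close> is only an upper bound, so that budgets can be rounded up when programs are
  composed.\<close>

definition runs :: "tape \<Rightarrow> prog \<Rightarrow> state \<Rightarrow> nat \<Rightarrow> (state \<Rightarrow> bool) \<Rightarrow> bool" where
  "runs \<omega> p \<sigma> T Q \<longleftrightarrow> (\<exists>t \<sigma>'. exec \<omega> p \<sigma> t \<sigma>' \<and> t \<le> T \<and> Q \<sigma>')"

lemma runs_weaken:
  assumes "runs \<omega> p \<sigma> T Q" "\<And>\<tau>. Q \<tau> \<Longrightarrow> Q' \<tau>" "T \<le> T'"
  shows "runs \<omega> p \<sigma> T' Q'"
  using assms unfolding runs_def by (meson order_trans)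

lemma runs_Seq: "runs \<omega> p \<sigma> T (\<lambda>\<tau>. runs \<omega> q \<tau> U Q) \<Longrightarrow> runs \<omega> (Seq p q) \<sigma> (T + U) Q"
  unfolding runs_def by (blast intro: exec.Seq add_mono)

lemma runs_Skip: "Q \<sigma> \<Longrightarrow> runs \<omega> Skip \<sigma> T Q"
  unfolding runs_def by (blast intro: exec.Skip)

lemma runs_Instr: "1 \<le> T \<Longrightarrow> Q (exec_instr \<omega> c \<sigma>) \<Longrightarrow> runs \<omega> (Instr c) \<sigma> T Q"
  unfolding runs_def by (blast intro: exec.Instr)

lemma runs_Cond:
  assumes "holds b \<sigma> \<Longrightarrow> runs \<omega> p \<sigma> T Q" "\<not> holds b \<sigma> \<Longrightarrow> runs \<omega> q \<sigma> T Q"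
  shows "runs \<omega> (Cond b p q) \<sigma> (Suc T) Q"
  using assms unfolding runs_def by (cases "holds b \<sigma>") (meson exec.CondTrue exec.CondFalse Suc_le_mono)+

text \<open>\<open>x\<close> counts the completed passes and \<open>n\<close> is their final number,
  known in advance; the invariant decides the test by comparing the two. Each pass pays its test,
  and the extra 1 is the last, failing test.\<close>

lemma runs_Loop:
  assumes "I x \<sigma>" "x \<le> n"
    and "\<And>x \<tau>. I x \<tau> \<Longrightarrow> x \<le> n \<Longrightarrow> holds b \<tau> \<longleftrightarrow> x < n"
    and "\<And>x \<tau>. I x \<tau> \<Longrightarrow> x < n \<Longrightarrow> runs \<omega> p \<tau> B (I (Suc x))"
  shows "runs \<omega> (Loop b p) \<sigma> (1 + (n - x) * (B + 1)) (I n)"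
  using assms(1,2)
proof (induction "n - x" arbitrary: x \<sigma>)
  case 0
  then have "x = n" by simp
  then show ?case
    using 0 assms(3)[of n \<sigma>] exec.LoopFalse[of b \<sigma> \<omega> p] unfolding runs_def by force
next
  case (Suc d)
  then have "x < n" by simp
  then obtain t \<tau> where t: "exec \<omega> p \<sigma> t \<tau>" "t \<le> B" "I (Suc x) \<tau>"
    using assms(4)[OF Suc.prems(1)] unfolding runs_def by blast
  have "runs \<omega> (Loop b p) \<tau> (1 + (n - Suc x) * (B + 1)) (I n)"
    using Suc.hyps(1)[of "Suc x" \<tau>] Suc.hyps(2) t \<open>x < n\<close> by simp
  then obtain u \<tau>' where u: "exec \<omega> (Loop b p) \<tau> u \<tau>'" "u \<le> 1 + (n - Suc x) * (B + 1)" "I n \<tau>'"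
    unfolding runs_def by blast
  have "exec \<omega> (Loop b p) \<sigma> (Suc (t + u)) \<tau>'"
    using assms(3)[OF Suc.prems] \<open>x < n\<close> by (intro exec.LoopTrue[OF _ t(1) u(1)]) simp
  moreover have "n - x = Suc (n - Suc x)" using \<open>x < n\<close> by simp
  then have "Suc (t + u) \<le> 1 + (n - x) * (B + 1)" using t u by simp
  ultimately show ?case using u unfolding runs_def by blast
qed

inductive_cases exec_SkipE: "exec \<omega> Skip \<sigma> t \<sigma>'"
inductive_cases exec_InstrE: "exec \<omega> (Instr c) \<sigma> t \<sigma>'"
inductive_cases exec_SeqE: "exec \<omega> (Seq p q) \<sigma> t \<sigma>'"
inductive_cases exec_CondE: "exec \<omega> (Cond b p q) \<sigma> t \<sigma>'"
inductive_cases exec_LoopE: "exec \<omega> (Loop b p) \<sigma> t \<sigma>'"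

text \<open>Success on a tape is expressed by the existence of a run; uniqueness of the final state
  is what identifies this event with one about a function of the tape.\<close>

lemma exec_deterministic:
  assumes "exec \<omega> p \<sigma> t \<tau>" "exec \<omega> p \<sigma> t' \<tau>'"
  shows "\<tau> = \<tau>'"
  using assms
proof (induction arbitrary: t' \<tau>' rule: exec.induct)
  case (Skip \<sigma>)
  then show ?case by (auto elim: exec_SkipE)
next
  case (Instr c \<sigma>)
  then show ?case by (auto elim: exec_InstrE)
next
  case (Seq p \<sigma> t \<sigma>' q u \<sigma>'')
  from Seq.prems show ?case by (rule exec_SeqE) (use Seq.IH in blast)
next
  case (CondTrue b \<sigma> p t \<sigma>' q)
  from CondTrue.prems show ?case by (rule exec_CondE) (use CondTrue in blast)+
next
  case (CondFalse b \<sigma> q t \<sigma>' p)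
  from CondFalse.prems show ?case by (rule exec_CondE) (use CondFalse in blast)+
next
  case (LoopFalse b \<sigma> p)
  from LoopFalse.prems show ?case by (rule exec_LoopE) (use LoopFalse in blast)+
next
  case (LoopTrue b \<sigma> p t \<sigma>' u \<sigma>'')
  from LoopTrue.prems show ?case by (rule exec_LoopE) (use LoopTrue in blast)+
qed

section \<open>Write sets and the frame property\<close>

fun instr_nregs :: "instr \<Rightarrow> nat set" where
  "instr_nregs (NConst i c) = {i}"
| "instr_nregs (NArith f i j k) = {i}"
| "instr_nregs (NLoad i A j) = {i}"
| "instr_nregs _ = {}"

fun instr_rregs :: "instr \<Rightarrow> nat set" where
  "instr_rregs (OfNat i j) = {i}"
| "instr_rregs (RArith f i j k) = {i}"
| "instr_rregs (RLoad i A j) = {i}"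
| "instr_rregs (Draw D i) = {i}"
| "instr_rregs _ = {}"

fun instr_narrs :: "instr \<Rightarrow> nat set" where
  "instr_narrs (NStore A i j) = {A}"
| "instr_narrs _ = {}"

fun instr_rarrs :: "instr \<Rightarrow> nat set" where
  "instr_rarrs (RStore A i j) = {A}"
| "instr_rarrs _ = {}"

fun instr_draws :: "instr \<Rightarrow> bool" where
  "instr_draws (Draw D i) = True"
| "instr_draws _ = False"

fun instrs :: "prog \<Rightarrow> instr set" where
  "instrs Skip = {}"
| "instrs (Instr c) = {c}"
| "instrs (Seq p q) = instrs p \<union> instrs q"
| "instrs (Cond b p q) = instrs p \<union> instrs q"
| "instrs (Loop b p) = instrs p"

text \<open>Whatever no instruction of the text writes is unchanged. This is decided syntactically,
  with arrays treated as a whole, so that loop invariants only have to mention what a loop really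
  changes.\<close>

definition frame :: "instr set \<Rightarrow> state \<Rightarrow> state \<Rightarrow> bool" where
  "frame S \<sigma> \<tau> \<longleftrightarrow>
     (\<forall>i. (\<forall>c\<in>S. i \<notin> instr_nregs c) \<longrightarrow> nreg \<tau> i = nreg \<sigma> i) \<and>
     (\<forall>i. (\<forall>c\<in>S. i \<notin> instr_rregs c) \<longrightarrow> rreg \<tau> i = rreg \<sigma> i) \<and>
     (\<forall>A. (\<forall>c\<in>S. A \<notin> instr_narrs c) \<longrightarrow> nmem \<tau> A = nmem \<sigma> A) \<and>
     (\<forall>A. (\<forall>c\<in>S. A \<notin> instr_rarrs c) \<longrightarrow> rmem \<tau> A = rmem \<sigma> A) \<and>
     ((\<forall>c\<in>S. \<not> instr_draws c) \<longrightarrow> draws \<tau> = draws \<sigma>)"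

lemma frame_refl: "frame S \<sigma> \<sigma>"
  by (simp add: frame_def)

lemma frame_trans: "frame S \<sigma> \<tau> \<Longrightarrow> frame S' \<tau> \<upsilon> \<Longrightarrow> frame (S \<union> S') \<sigma> \<upsilon>"
  unfolding frame_def by (intro conjI allI impI) (simp_all add: ball_Un)

lemma frame_mono: "frame S \<sigma> \<tau> \<Longrightarrow> S \<subseteq> S' \<Longrightarrow> frame S' \<sigma> \<tau>"
  unfolding frame_def by (meson subsetD)

lemma frame_exec_instr: "frame {c} \<sigma> (exec_instr \<omega> c \<sigma>)"
  by (cases c) (auto simp: frame_def)

lemma exec_frame: "exec \<omega> p \<sigma> t \<tau> \<Longrightarrow> frame (instrs p) \<sigma> \<tau>"
proof (induction rule: exec.induct)
  case (Seq p \<sigma> t \<sigma>' q u \<sigma>'')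
  then show ?case by (auto intro: frame_trans)
next
  case (LoopTrue b \<sigma> p t \<sigma>' u \<sigma>'')
  then show ?case using frame_trans by fastforce
qed (auto intro: frame_refl frame_exec_instr frame_mono)

lemma runs_frame: "runs \<omega> p \<sigma> T Q \<Longrightarrow> runs \<omega> p \<sigma> T (\<lambda>\<tau>. Q \<tau> \<and> frame (instrs p) \<sigma> \<tau>)"
  unfolding runs_def using exec_frame by blast

section \<open>Rules for straight-line code and counting loops\<close>

fun block :: "instr list \<Rightarrow> prog" where
  "block [] = Skip"
| "block (c # cs) = Seq (Instr c) (block cs)"

lemma runs_block:
  assumes "length cs \<le> T" "Q (fold (exec_instr \<omega>) cs \<sigma>)"
  shows "runs \<omega> (block cs) \<sigma> T Q"
proof -
  have "runs \<omega> (block cs) \<sigma> (length cs) Q" using assms(2)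
  proof (induction cs arbitrary: \<sigma>)
    case (Cons c cs)
    have "runs \<omega> (Seq (Instr c) (block cs)) \<sigma> (1 + length cs) Q"
      using Cons by (intro runs_Seq runs_Instr) auto
    then show ?case by simp
  qed (simp add: runs_Skip)
  then show ?thesis by (rule runs_weaken) (use assms in auto)
qed

lemma instrs_block [simp]: "instrs (block cs) = set cs"
  by (induction cs) auto

text \<open>Natural-number register 4 holds the constant 1.\<close>

definition for_loop :: "nat \<Rightarrow> nat \<Rightarrow> prog \<Rightarrow> prog" where
  "for_loop i N p = Seq (Instr (NConst i 0)) (Loop (NLess i N) (Seq p (Instr (NArith Plus i i 4))))"

lemma instrs_for_loop [simp]: "instrs (for_loop i N p) = {NConst i 0, NArith Plus i i 4} \<union> instrs p"
  by (auto simp: for_loop_def)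

text \<open>The step premise states the invariant with the counter already set to
  \<open>Suc x\<close>, which hides the increment from its proof, and it may use the frame relative
  to the state before the whole loop. Each pass pays the test and the increment besides
  \<open>B\<close>; the 2 are the initialisation and the failing test.\<close>

lemma runs_for_loop:
  assumes one: "nreg \<sigma> 4 = 1" and n: "nreg \<sigma> N = n" and i: "i \<noteq> N" "i \<noteq> 4"
    and p: "\<forall>c\<in>instrs p. i \<notin> instr_nregs c \<and> N \<notin> instr_nregs c \<and> 4 \<notin> instr_nregs c"
    and init: "I 0 (\<sigma>\<lparr>nreg := (nreg \<sigma>)(i := 0)\<rparr>)"
    and step: "\<And>x \<tau>. x < n \<Longrightarrow> I x \<tau> \<Longrightarrow> nreg \<tau> i = x \<Longrightarrow> frame (instrs (for_loop i N p)) \<sigma> \<tau> \<Longrightarrow>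
      runs \<omega> p \<tau> B (\<lambda>\<tau>'. I (Suc x) (\<tau>'\<lparr>nreg := (nreg \<tau>')(i := Suc x)\<rparr>))"
    and T: "2 + n * (B + 2) \<le> T"
    and post: "\<And>\<tau>. I n \<tau> \<Longrightarrow> frame (instrs (for_loop i N p)) \<sigma> \<tau> \<Longrightarrow> Q \<tau>"
  shows "runs \<omega> (for_loop i N p) \<sigma> T Q"
proof -
  let ?F = "frame (instrs (for_loop i N p)) \<sigma>"
  define J where "J x \<tau> \<longleftrightarrow> I x \<tau> \<and> nreg \<tau> i = x \<and> ?F \<tau>" for x \<tau>
  have regs: "nreg \<tau> 4 = 1" "nreg \<tau> N = n" if "?F \<tau>" for \<tau>
    using that one n i p unfolding frame_def by auto
  have "runs \<omega> (for_loop i N p) \<sigma> (1 + (1 + (n - 0) * (B + 1 + 1))) (J n)"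
    unfolding for_loop_def
  proof (intro runs_Seq runs_Instr runs_Loop)
    have "?F (\<sigma>\<lparr>nreg := (nreg \<sigma>)(i := 0)\<rparr>)" by (auto simp: frame_def)
    then show "J 0 (exec_instr \<omega> (NConst i 0) \<sigma>)" using init by (simp add: J_def)
    show "holds (NLess i N) \<tau> \<longleftrightarrow> x < n" if "J x \<tau>" for x \<tau>
      using that regs by (simp add: J_def)
    fix x \<tau> assume J: "J x \<tau>" "x < n"
    have "runs \<omega> p \<tau> B (\<lambda>\<tau>'. I (Suc x) (\<tau>'\<lparr>nreg := (nreg \<tau>')(i := Suc x)\<rparr>) \<and> frame (instrs p) \<tau> \<tau>')"
      using J by (intro runs_frame step) (auto simp: J_def)
    then show "runs \<omega> p \<tau> B (\<lambda>\<tau>'. runs \<omega> (Instr (NArith Plus i i 4)) \<tau>' 1 (J (Suc x)))"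
    proof (rule runs_weaken)
      fix \<tau>' assume *: "I (Suc x) (\<tau>'\<lparr>nreg := (nreg \<tau>')(i := Suc x)\<rparr>) \<and> frame (instrs p) \<tau> \<tau>'"
      let ?\<tau>'' = "exec_instr \<omega> (NArith Plus i i 4) \<tau>'"
      have F: "frame (instrs p) \<tau> \<tau>'" "?F \<tau>" using * J by (auto simp: J_def)
      then have "nreg \<tau>' i = nreg \<tau> i" "nreg \<tau>' 4 = nreg \<tau> 4" using p unfolding frame_def by blast+
      then have \<tau>': "nreg \<tau>' i = x" "nreg \<tau>' 4 = 1" using J regs(1)[of \<tau>] by (auto simp: J_def)
      have "?F ?\<tau>''"
        using frame_trans[OF F(2) frame_trans[OF F(1) frame_exec_instr[of "NArith Plus i i 4" \<tau>' \<omega>]]]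
        by (rule frame_mono) auto
      then show "runs \<omega> (Instr (NArith Plus i i 4)) \<tau>' 1 (J (Suc x))"
        using * \<tau>' by (intro runs_Instr) (auto simp: J_def)
    qed simp
  qed auto
  then show ?thesis
    by (rule runs_weaken) (use T post in \<open>auto simp: J_def\<close>)
qed

section \<open>The program\<close>

text \<open>
  The loop over the endpoints also reads the cell behind the last one, which holds 0.  The resulting
  junk increment only enters the last prefix sum, which is never used.
\<close>

definition endpt0 :: "input_data \<Rightarrow> nat \<Rightarrow> real" where
  "endpt0 X i = (if i < num_ends X then endpt X i else 0)"

definition node0 :: "input_data \<Rightarrow> nat \<Rightarrow> nat \<Rightarrow> nat \<Rightarrow> real" where
  "node0 X R r i = endpt0 X i + real (r + r + 1) / real (R + R) * (endpt0 X (Suc i) - endpt0 X i)"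

text \<open>
  The sketches are numbered by \<open>\<kappa> = r * Q + q\<close>: the \<open>q\<close>-th sample at node position \<open>r = \<kappa> div Q\<close>.
\<close>

definition cauchy_incr :: "input_data \<Rightarrow> tape \<Rightarrow> nat \<Rightarrow> nat \<Rightarrow> real" where
  "cauchy_incr X \<omega> \<kappa> i = (endpt0 X (Suc i) - endpt0 X i) * \<omega> (Std_Cauchy, \<kappa> * num_ends X + i)"

definition prefix0 :: "input_data \<Rightarrow> tape \<Rightarrow> nat \<Rightarrow> nat \<Rightarrow> real" where
  "prefix0 X \<omega> \<kappa> i = (\<Sum>i'<i. cauchy_incr X \<omega> \<kappa> i')"

definition prefix1 :: "input_data \<Rightarrow> nat \<Rightarrow> nat \<Rightarrow> tape \<Rightarrow> nat \<Rightarrow> nat \<Rightarrow> real" where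
  "prefix1 X R Q \<omega> \<kappa> i = (\<Sum>i'<i. cauchy_incr X \<omega> \<kappa> i' * node0 X R (\<kappa> div Q) i')"

text \<open>A linear function sampled at the nodes is a combination of the constant and the node
  itself, so the two families of prefix sums, shared by all densities, reduce a piece to O(1)
  operations however many elementary intervals it covers.\<close>

definition piece_sketch :: "input_data \<Rightarrow> nat \<Rightarrow> nat \<Rightarrow> tape \<Rightarrow> nat \<Rightarrow> nat \<Rightarrow> nat \<Rightarrow> real" where
  "piece_sketch X R Q \<omega> j \<kappa> l =
     coef X j l 0 * (prefix0 X \<omega> \<kappa> (right_ix X j l) - prefix0 X \<omega> \<kappa> (left_ix X j l)) +
     coef X j l 1 * (prefix1 X R Q \<omega> \<kappa> (right_ix X j l) - prefix1 X R Q \<omega> \<kappa> (left_ix X j l))"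

definition sketch :: "input_data \<Rightarrow> nat \<Rightarrow> nat \<Rightarrow> tape \<Rightarrow> nat \<Rightarrow> nat \<Rightarrow> real" where
  "sketch X R Q \<omega> j \<kappa> = (\<Sum>l<num_pieces X. piece_sketch X R Q \<omega> j \<kappa> l)"

text \<open>
  The pair \<open>(V, T)\<close> keeps \<open>V = T ^ Q / P\<close>, where \<open>P\<close> is the product of the \<open>Q\<close> absolute values, so
  that stopping as soon as \<open>V \<ge> 1\<close> leaves \<open>T\<close> within a factor \<open>F\<close> of the geometric mean.
\<close>

definition root_step :: "nat \<Rightarrow> real \<Rightarrow> real \<times> real \<Rightarrow> real \<times> real" where
  "root_step Q F = (\<lambda>(V, T). if V < 1 then (V * F ^ Q, T * F) else (V, T))"

text \<open>The search window is symmetric around the first sample: it starts at \<bar>x 0\<bar> /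
  F^Q, and \<open>2 * Q\<close> factors \<open>F\<close> reach up to \<bar>x 0\<bar> * F^Q. The
  geometric mean lies in it unless the first sample is atypical.\<close>

definition geo_mean :: "nat \<Rightarrow> real \<Rightarrow> (nat \<Rightarrow> real) \<Rightarrow> real" where
  "geo_mean Q F x = (let T = \<bar>x 0\<bar> * (1 / F ^ Q) in
     snd ((root_step Q F ^^ (2 * Q)) (\<Prod>q<Q. T / \<bar>x q\<bar>, T)))"

definition estimate :: "input_data \<Rightarrow> nat \<Rightarrow> nat \<Rightarrow> real \<Rightarrow> tape \<Rightarrow> nat \<Rightarrow> nat \<Rightarrow> real" where
  "estimate X R Q F \<omega> j k =
     (\<Sum>r<R. geo_mean Q F (\<lambda>q. sketch X R Q \<omega> j (r * Q + q) - sketch X R Q \<omega> k (r * Q + q))) / real R"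

text \<open>
  Natural registers: 5, 7, 8, 22 hold \<open>R\<close>, \<open>Q\<close>, \<open>R * Q\<close>, \<open>2 * Q\<close>; 9 to 14 are the loop counters
  \<open>r\<close>, \<open>q\<close>, \<open>i\<close>, \<open>j\<close>, \<open>l\<close>, \<open>k\<close>.  Real arrays: 3 and 4 hold the prefix sums of the increments and of the
  increments times nodes, cell \<open>j * (R * Q) + \<kappa>\<close> of 5 holds sketch \<open>\<kappa>\<close> of \<open>f j\<close>.
\<close>

definition env :: "input_data \<Rightarrow> nat \<Rightarrow> nat \<Rightarrow> real \<Rightarrow> state \<Rightarrow> bool" where
  "env X R Q F \<sigma> \<longleftrightarrow>
     nreg \<sigma> 0 = num_dens X \<and> nreg \<sigma> 1 = num_pieces X \<and> nreg \<sigma> 2 = num_ends X \<and>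
     nreg \<sigma> 3 = 0 \<and> nreg \<sigma> 4 = 1 \<and> nreg \<sigma> 5 = R \<and> nreg \<sigma> 7 = Q \<and> nreg \<sigma> 8 = R * Q \<and> nreg \<sigma> 22 = 2 * Q \<and>
     rreg \<sigma> 2 = 1 \<and> rreg \<sigma> 3 = F \<and> rreg \<sigma> 4 = F ^ Q \<and> rreg \<sigma> 5 = 1 / F ^ Q \<and> rreg \<sigma> 23 = 0 \<and>
     (\<forall>j<num_dens X. \<forall>l<num_pieces X.
        nmem \<sigma> 0 (j * num_pieces X + l) = left_ix X j l \<and> nmem \<sigma> 1 (j * num_pieces X + l) = right_ix X j l \<and>
        rmem \<sigma> 1 ((j * num_pieces X + l) + (j * num_pieces X + l)) = coef X j l 0 \<and>
        rmem \<sigma> 1 ((j * num_pieces X + l) + (j * num_pieces X + l) + 1) = coef X j l 1) \<and>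
     (\<forall>i. rmem \<sigma> 0 i = endpt0 X i)"

definition env_safe :: "instr set \<Rightarrow> bool" where
  "env_safe S \<longleftrightarrow>
     (\<forall>i\<in>{0, 1, 2, 3, 4, 5, 7, 8, 22}. \<forall>c\<in>S. i \<notin> instr_nregs c) \<and>
     (\<forall>i\<in>{2, 3, 4, 5, 23}. \<forall>c\<in>S. i \<notin> instr_rregs c) \<and>
     (\<forall>A\<in>{0, 1}. \<forall>c\<in>S. A \<notin> instr_narrs c) \<and> (\<forall>A\<in>{0, 1}. \<forall>c\<in>S. A \<notin> instr_rarrs c)"

lemma frameD:
  assumes "frame S \<sigma> \<tau>"
  shows "\<forall>c\<in>S. i \<notin> instr_nregs c \<Longrightarrow> nreg \<tau> i = nreg \<sigma> i"
    "\<forall>c\<in>S. i \<notin> instr_rregs c \<Longrightarrow> rreg \<tau> i = rreg \<sigma> i"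
    "\<forall>c\<in>S. i \<notin> instr_narrs c \<Longrightarrow> nmem \<tau> i = nmem \<sigma> i"
    "\<forall>c\<in>S. i \<notin> instr_rarrs c \<Longrightarrow> rmem \<tau> i = rmem \<sigma> i"
    "\<forall>c\<in>S. \<not> instr_draws c \<Longrightarrow> draws \<tau> = draws \<sigma>"
  using assms by (simp_all only: frame_def)

lemma env_frame:
  assumes "env X R Q F \<sigma>" "frame S \<sigma> \<tau>" "env_safe S"
  shows "env X R Q F \<tau>"
proof -
  note safe = assms(3)[unfolded env_safe_def]
  have "nreg \<tau> i = nreg \<sigma> i" if "i \<in> {0, 1, 2, 3, 4, 5, 7, 8, 22}" for i
    by (rule frameD(1)[OF assms(2) safe[THEN conjunct1, THEN bspec, OF that]])
  moreover have "rreg \<tau> i = rreg \<sigma> i" if "i \<in> {2, 3, 4, 5, 23}" for i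
    by (rule frameD(2)[OF assms(2) safe[THEN conjunct2, THEN conjunct1, THEN bspec, OF that]])
  moreover have "nmem \<tau> A = nmem \<sigma> A" if "A \<in> {0, 1}" for A
    by (rule frameD(3)[OF assms(2) safe[THEN conjunct2, THEN conjunct2, THEN conjunct1, THEN bspec, OF that]])
  moreover have "rmem \<tau> A = rmem \<sigma> A" if "A \<in> {0, 1}" for A
    by (rule frameD(4)[OF assms(2) safe[THEN conjunct2, THEN conjunct2, THEN conjunct2, THEN bspec, OF that]])
  ultimately show ?thesis using assms(1) unfolding env_def by simp
qed

lemma envD:
  assumes "env X R Q F \<sigma>"
  shows "nreg \<sigma> 0 = num_dens X" "nreg \<sigma> 1 = num_pieces X" "nreg \<sigma> (Suc 0) = num_pieces X" "nreg \<sigma> 2 = num_ends X"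
    "nreg \<sigma> 3 = 0" "nreg \<sigma> 4 = 1" "nreg \<sigma> 5 = R" "nreg \<sigma> 7 = Q" "nreg \<sigma> 8 = R * Q" "nreg \<sigma> 22 = 2 * Q"
    "rreg \<sigma> 2 = 1" "rreg \<sigma> 3 = F" "rreg \<sigma> 4 = F ^ Q" "rreg \<sigma> 5 = 1 / F ^ Q" "rreg \<sigma> 23 = 0"
    "rmem \<sigma> 0 i = endpt0 X i"
  using assms by (simp_all add: env_def)

lemma envD_pieces:
  assumes "env X R Q F \<sigma>" "j < num_dens X" "l < num_pieces X"
  shows "nmem \<sigma> 0 (j * num_pieces X + l) = left_ix X j l" "nmem \<sigma> 1 (j * num_pieces X + l) = right_ix X j l"
    "rmem \<sigma> 1 ((j * num_pieces X + l) + (j * num_pieces X + l)) = coef X j l 0"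
    "rmem \<sigma> 1 ((j * num_pieces X + l) + (j * num_pieces X + l) + 1) = coef X j l 1"
  using assms by (simp_all add: env_def)

text \<open>There is no instruction that loads a real constant. Register 23 holds 0, so
  \<open>RArith RMinus i 23 23\<close> clears a register and, in later programs,
  \<open>RArith RMinus i j 23\<close> copies one. Cell 0 of both arrays is written before the loop;
  pass i writes cell i + 1.\<close>

definition prefix_prog :: prog where
  "prefix_prog = Seq
     (block [RArith RMinus 11 23 23, RArith RMinus 12 23 23, RStore 3 3 11, RStore 4 3 12])
     (for_loop 11 2 (block [Draw Std_Cauchy 8, RLoad 13 0 11, NArith Plus 16 11 4, RLoad 14 0 16,
        RArith RMinus 14 14 13, RArith RTimes 15 10 14, RArith RPlus 15 13 15, RArith RTimes 8 14 8,
        RArith RPlus 11 11 8, RArith RTimes 8 8 15, RArith RPlus 12 12 8, RStore 3 16 11, RStore 4 16 12]))"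

lemma runs_prefix_prog:
  assumes env: "env X R Q F \<sigma>" and \<kappa>: "draws \<sigma> = \<kappa> * num_ends X"
    and u: "rreg \<sigma> 10 = real (\<kappa> div Q + \<kappa> div Q + 1) / real (R + R)"
  shows "runs \<omega> prefix_prog \<sigma> (6 + num_ends X * 15) (\<lambda>\<tau>. draws \<tau> = Suc \<kappa> * num_ends X \<and>
     (\<forall>i\<le>num_ends X. rmem \<tau> 3 i = prefix0 X \<omega> \<kappa> i \<and> rmem \<tau> 4 i = prefix1 X R Q \<omega> \<kappa> i))"
proof -
  define I where "I x \<tau> \<longleftrightarrow> draws \<tau> = \<kappa> * num_ends X + x \<and> rreg \<tau> 11 = prefix0 X \<omega> \<kappa> x \<and> rreg \<tau> 12 = prefix1 X R Q \<omega> \<kappa> x \<and>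
      (\<forall>i\<le>x. rmem \<tau> 3 i = prefix0 X \<omega> \<kappa> i \<and> rmem \<tau> 4 i = prefix1 X R Q \<omega> \<kappa> i)" for x and \<tau> :: state
  have "runs \<omega> prefix_prog \<sigma> (4 + (2 + num_ends X * 15)) (I (num_ends X))"
    unfolding prefix_prog_def
  proof (rule runs_Seq, rule runs_block, simp, rule runs_for_loop[where B = 13 and I = I])
    let ?\<sigma> = "fold (exec_instr \<omega>) [RArith RMinus 11 23 23, RArith RMinus 12 23 23, RStore 3 3 11, RStore 4 3 12] \<sigma>"
    show "nreg ?\<sigma> 4 = 1" "nreg ?\<sigma> 2 = num_ends X" by (simp_all add: envD[OF env])
    show "I 0 (?\<sigma>\<lparr>nreg := (nreg ?\<sigma>)(11 := 0)\<rparr>)"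
      by (simp add: I_def \<kappa> prefix0_def prefix1_def envD[OF env])
    fix x \<tau> assume x: "x < num_ends X" "I x \<tau>" "nreg \<tau> 11 = x"
    let ?body = "block [Draw Std_Cauchy 8, RLoad 13 0 11, NArith Plus 16 11 4, RLoad 14 0 16,
        RArith RMinus 14 14 13, RArith RTimes 15 10 14, RArith RPlus 15 13 15, RArith RTimes 8 14 8,
        RArith RPlus 11 11 8, RArith RTimes 8 8 15, RArith RPlus 12 12 8, RStore 3 16 11, RStore 4 16 12]"
    assume "frame (instrs (for_loop 11 2 ?body)) ?\<sigma> \<tau>"
    note f = frameD[OF this]
    have \<tau>: "nreg \<tau> 4 = 1" "rmem \<tau> 0 i = endpt0 X i" "rreg \<tau> 10 = real (\<kappa> div Q + \<kappa> div Q + 1) / real (R + R)" for i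
      by (simp_all add: f envD[OF env] u)
    show "runs \<omega> ?body \<tau> 13 (\<lambda>\<tau>'. I (Suc x) (\<tau>'\<lparr>nreg := (nreg \<tau>')(11 := Suc x)\<rparr>))"
      using x(2) by (intro runs_block) (auto simp: I_def x(3) \<tau> prefix0_def prefix1_def cauchy_incr_def node0_def le_Suc_eq)
  qed auto
  then show ?thesis by (rule runs_weaken) (auto simp: I_def)
qed

text \<open>With d = 1 a piece owns two consecutive coefficient cells, hence the doubling of its
  address and the later increment by 1.\<close>

definition piece_prog :: prog where
  "piece_prog = Seq (block [RArith RMinus 11 23 23])
     (for_loop 13 1 (block [NArith Times 16 12 1, NArith Plus 16 16 13, NLoad 17 0 16, NLoad 18 1 16, NArith Plus 16 16 16,
        RLoad 8 1 16, NArith Plus 16 16 4, RLoad 9 1 16,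
        RLoad 12 3 18, RLoad 13 3 17, RArith RMinus 12 12 13, RArith RTimes 8 8 12, RArith RPlus 11 11 8,
        RLoad 12 4 18, RLoad 13 4 17, RArith RMinus 12 12 13, RArith RTimes 9 9 12, RArith RPlus 11 11 9]))"

lemma runs_piece_prog:
  assumes env: "env X R Q F \<sigma>" and j: "nreg \<sigma> 12 = j" "j < num_dens X"
    and pre: "\<forall>i\<le>num_ends X. rmem \<sigma> 3 i = prefix0 X \<omega> \<kappa> i \<and> rmem \<sigma> 4 i = prefix1 X R Q \<omega> \<kappa> i"
    and wf: "well_formed X"
  shows "runs \<omega> piece_prog \<sigma> (3 + num_pieces X * 20) (\<lambda>\<tau>. rreg \<tau> 11 = sketch X R Q \<omega> j \<kappa>)"
proof -
  define I where "I x \<tau> \<longleftrightarrow> rreg \<tau> 11 = (\<Sum>l<x. piece_sketch X R Q \<omega> j \<kappa> l)" for x and \<tau> :: state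
  have "runs \<omega> piece_prog \<sigma> (1 + (2 + num_pieces X * 20)) (I (num_pieces X))"
    unfolding piece_prog_def
  proof (rule runs_Seq, rule runs_block, simp, rule runs_for_loop[where B = 18 and I = I])
    let ?\<sigma> = "fold (exec_instr \<omega>) [RArith RMinus 11 23 23] \<sigma>"
    show "nreg ?\<sigma> 4 = 1" "nreg ?\<sigma> 1 = num_pieces X" by (simp_all add: envD[OF env])
    show "I 0 (?\<sigma>\<lparr>nreg := (nreg ?\<sigma>)(13 := 0)\<rparr>)"
      by (simp add: I_def envD[OF env])
    let ?body = "block [NArith Times 16 12 1, NArith Plus 16 16 13, NLoad 17 0 16, NLoad 18 1 16, NArith Plus 16 16 16,
        RLoad 8 1 16, NArith Plus 16 16 4, RLoad 9 1 16,
        RLoad 12 3 18, RLoad 13 3 17, RArith RMinus 12 12 13, RArith RTimes 8 8 12, RArith RPlus 11 11 8,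
        RLoad 12 4 18, RLoad 13 4 17, RArith RMinus 12 12 13, RArith RTimes 9 9 12, RArith RPlus 11 11 9]"
    fix l \<tau> assume l: "l < num_pieces X" "I l \<tau>" "nreg \<tau> 13 = l"
    assume "frame (instrs (for_loop 13 1 ?body)) ?\<sigma> \<tau>"
    note f = frameD[OF this]
    have \<tau>: "nreg \<tau> 4 = 1" "nreg \<tau> (Suc 0) = num_pieces X" "nreg \<tau> 12 = j" "nmem \<tau> 0 = nmem \<sigma> 0" "nmem \<tau> (Suc 0) = nmem \<sigma> (Suc 0)"
      "rmem \<tau> (Suc 0) = rmem \<sigma> (Suc 0)" "rmem \<tau> 3 = rmem \<sigma> 3" "rmem \<tau> 4 = rmem \<sigma> 4"
      by (simp_all add: f envD[OF env] j)
    have "left_ix X j l \<le> num_ends X" "right_ix X j l \<le> num_ends X"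
    proof -
      have "left_ix X j l < right_ix X j l" "right_ix X j l < num_ends X"
        using wf j l(1) unfolding well_formed_def by blast+
      then show "left_ix X j l \<le> num_ends X" "right_ix X j l \<le> num_ends X" by simp_all
    qed
    then have "rmem \<sigma> 3 (left_ix X j l) = prefix0 X \<omega> \<kappa> (left_ix X j l)" "rmem \<sigma> 4 (left_ix X j l) = prefix1 X R Q \<omega> \<kappa> (left_ix X j l)"
      "rmem \<sigma> 3 (right_ix X j l) = prefix0 X \<omega> \<kappa> (right_ix X j l)" "rmem \<sigma> 4 (right_ix X j l) = prefix1 X R Q \<omega> \<kappa> (right_ix X j l)"
      using pre by auto
    note m = this envD_pieces[OF env j(2) l(1), simplified]
    show "runs \<omega> ?body \<tau> 18 (\<lambda>\<tau>'. I (Suc l) (\<tau>'\<lparr>nreg := (nreg \<tau>')(13 := Suc l)\<rparr>))"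
      using l(2) by (intro runs_block) (simp_all add: I_def l(3) \<tau> m piece_sketch_def)
  qed auto
  then show ?thesis by (rule runs_weaken) (auto simp: I_def sketch_def)
qed

text \<open>In contrast to the plain rule, the second program receives the frame of the first, so
  postconditions need not list what is preserved.\<close>

lemma runs_SeqI:
  assumes "runs \<omega> p \<sigma> T P" "\<And>\<tau>. P \<tau> \<Longrightarrow> frame (instrs p) \<sigma> \<tau> \<Longrightarrow> runs \<omega> q \<tau> U Q" "T + U \<le> V"
  shows "runs \<omega> (Seq p q) \<sigma> V Q"
proof -
  have "runs \<omega> p \<sigma> T (\<lambda>\<tau>. runs \<omega> q \<tau> U Q)"
    using runs_frame[OF assms(1)] by (rule runs_weaken) (use assms in auto)
  then show ?thesis by (rule runs_Seq[THEN runs_weaken]) (use assms in auto)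
qed

lemma cell_eq_iff:
  fixes N :: nat
  assumes "x < N" "y < N"
  shows "i * N + x = j * N + y \<longleftrightarrow> i = j \<and> x = y"
proof
  assume "i * N + x = j * N + y"
  then have "(i * N + x) div N = (j * N + y) div N" "(i * N + x) mod N = (j * N + y) mod N" by simp_all
  then show "i = j \<and> x = y" using assms by simp
qed simp

lemma cell_bound:
  fixes r :: nat
  assumes "r < R" "q < Q"
  shows "r * Q + q < R * Q"
proof -
  have "r * Q + q < Suc r * Q" using assms by simp
  also have "\<dots> \<le> R * Q" using assms by (intro mult_le_mono1) simp
  finally show ?thesis .
qed

text \<open>The same draws serve all densities. A sketch is linear in the density, so the difference
  of two stored sketches is a sketch of the difference, and one row per density is enough for all
  pairs.\<close>

definition store_prog :: prog where
  "store_prog = for_loop 12 0 (Seq piece_prog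
     (block [NArith Times 16 12 8, NArith Times 17 9 7, NArith Plus 16 16 17, NArith Plus 16 16 10, RStore 5 16 11]))"

lemma runs_store_prog:
  assumes env: "env X R Q F \<sigma>" and \<kappa>: "nreg \<sigma> 9 * Q + nreg \<sigma> 10 = \<kappa>" "\<kappa> < R * Q"
    and pre: "\<forall>i\<le>num_ends X. rmem \<sigma> 3 i = prefix0 X \<omega> \<kappa> i \<and> rmem \<sigma> 4 i = prefix1 X R Q \<omega> \<kappa> i"
    and wf: "well_formed X"
  shows "runs \<omega> store_prog \<sigma> (2 + num_dens X * (10 + num_pieces X * 20)) (\<lambda>\<tau>.
     \<forall>j<num_dens X. \<forall>\<kappa>'<R * Q. rmem \<tau> 5 (j * (R * Q) + \<kappa>') =
        (if \<kappa>' = \<kappa> then sketch X R Q \<omega> j \<kappa> else rmem \<sigma> 5 (j * (R * Q) + \<kappa>')))"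
proof -
  define I where "I x \<tau> \<longleftrightarrow> (\<forall>j<num_dens X. \<forall>\<kappa>'<R * Q. rmem \<tau> 5 (j * (R * Q) + \<kappa>') =
        (if \<kappa>' = \<kappa> \<and> j < x then sketch X R Q \<omega> j \<kappa> else rmem \<sigma> 5 (j * (R * Q) + \<kappa>')))" for x and \<tau> :: state
  show ?thesis
    unfolding store_prog_def
  proof (rule runs_for_loop[where B = "8 + num_pieces X * 20" and I = I])
    show "nreg \<sigma> 4 = 1" "nreg \<sigma> 0 = num_dens X" by (simp_all add: envD[OF env])
    show "I 0 (\<sigma>\<lparr>nreg := (nreg \<sigma>)(12 := 0)\<rparr>)" by (simp add: I_def)
    let ?store = "block [NArith Times 16 12 8, NArith Times 17 9 7, NArith Plus 16 16 17, NArith Plus 16 16 10, RStore 5 16 11]"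
    fix x \<tau> assume x: "x < num_dens X" "I x \<tau>" "nreg \<tau> 12 = x"
      and frame: "frame (instrs (for_loop 12 0 (Seq piece_prog ?store))) \<sigma> \<tau>"
    note f = frameD[OF frame]
    have env': "env X R Q F \<tau>"
      by (rule env_frame[OF env frame]) (simp add: env_safe_def piece_prog_def)
    show "runs \<omega> (Seq piece_prog ?store) \<tau> (8 + num_pieces X * 20) (\<lambda>\<tau>'. I (Suc x) (\<tau>'\<lparr>nreg := (nreg \<tau>')(12 := Suc x)\<rparr>))"
    proof (rule runs_SeqI[where U = 5])
      show "runs \<omega> piece_prog \<tau> (3 + num_pieces X * 20) (\<lambda>\<tau>'. rreg \<tau>' 11 = sketch X R Q \<omega> x \<kappa>)"
        by (rule runs_piece_prog[OF env' x(3,1) _ wf]) (simp add: pre f piece_prog_def)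
      fix \<upsilon> assume \<upsilon>: "rreg \<upsilon> 11 = sketch X R Q \<omega> x \<kappa>" "frame (instrs piece_prog) \<tau> \<upsilon>"
      note g = frameD[OF \<upsilon>(2)]
      have regs: "nreg \<upsilon> 12 = x" "nreg \<upsilon> 8 = R * Q" "nreg \<upsilon> 7 = Q" "nreg \<upsilon> 9 = nreg \<sigma> 9" "nreg \<upsilon> 10 = nreg \<sigma> 10" "rmem \<upsilon> 5 = rmem \<tau> 5"
        by (simp_all add: f g piece_prog_def envD[OF env] x)
      have addr: "x * (R * Q) + nreg \<sigma> 9 * Q + nreg \<sigma> 10 = x * (R * Q) + \<kappa>" using \<kappa> by simp
      show "runs \<omega> ?store \<upsilon> 5 (\<lambda>\<tau>'. I (Suc x) (\<tau>'\<lparr>nreg := (nreg \<tau>')(12 := Suc x)\<rparr>))"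
        by (rule runs_block)
          (use x(2) \<kappa>(2) in \<open>auto simp: I_def regs \<upsilon>(1) addr cell_eq_iff less_Suc_eq\<close>)
    qed simp
  qed (auto simp: I_def piece_prog_def)
qed

definition sketch_loop :: prog where
  "sketch_loop = for_loop 10 7 (Seq prefix_prog store_prog)"

lemma runs_sketch_loop:
  assumes env: "env X R Q F \<sigma>" and r: "nreg \<sigma> 9 = r" "r < R"
    and u: "rreg \<sigma> 10 = real (r + r + 1) / real (R + R)" and d: "draws \<sigma> = r * Q * num_ends X"
    and prev: "\<forall>j<num_dens X. \<forall>\<kappa><r * Q. rmem \<sigma> 5 (j * (R * Q) + \<kappa>) = sketch X R Q \<omega> j \<kappa>"
    and wf: "well_formed X"
  shows "runs \<omega> sketch_loop \<sigma> (2 + Q * (10 + num_ends X * 15 + num_dens X * (10 + num_pieces X * 20))) (\<lambda>\<tau>.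
     draws \<tau> = Suc r * Q * num_ends X \<and>
     (\<forall>j<num_dens X. \<forall>\<kappa><Suc r * Q. rmem \<tau> 5 (j * (R * Q) + \<kappa>) = sketch X R Q \<omega> j \<kappa>))"
proof -
  define I where "I x \<tau> \<longleftrightarrow> draws \<tau> = (r * Q + x) * num_ends X \<and>
     (\<forall>j<num_dens X. \<forall>\<kappa><r * Q + x. rmem \<tau> 5 (j * (R * Q) + \<kappa>) = sketch X R Q \<omega> j \<kappa>)" for x and \<tau> :: state
  show ?thesis
    unfolding sketch_loop_def
  proof (rule runs_for_loop[where B = "8 + num_ends X * 15 + num_dens X * (10 + num_pieces X * 20)" and I = I])
    show "nreg \<sigma> 4 = 1" "nreg \<sigma> 7 = Q" by (simp_all add: envD[OF env])
    show "I 0 (\<sigma>\<lparr>nreg := (nreg \<sigma>)(10 := 0)\<rparr>)" using d prev by (simp add: I_def)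
    fix q \<tau> assume q: "q < Q" "I q \<tau>" "nreg \<tau> 10 = q"
      and frame: "frame (instrs (for_loop 10 7 (Seq prefix_prog store_prog))) \<sigma> \<tau>"
    note f = frameD[OF frame]
    have env': "env X R Q F \<tau>"
      by (rule env_frame[OF env frame]) (simp add: env_safe_def piece_prog_def prefix_prog_def store_prog_def)
    define \<kappa> where "\<kappa> = r * Q + q"
    have \<kappa>: "\<kappa> div Q = r" "\<kappa> < R * Q" using q r cell_bound[of r R q Q] by (simp_all add: \<kappa>_def)
    show "runs \<omega> (Seq prefix_prog store_prog) \<tau> (8 + num_ends X * 15 + num_dens X * (10 + num_pieces X * 20))
      (\<lambda>\<tau>'. I (Suc q) (\<tau>'\<lparr>nreg := (nreg \<tau>')(10 := Suc q)\<rparr>))"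
    proof (rule runs_SeqI)
      have "rreg \<tau> 10 = rreg \<sigma> 10" by (simp add: f piece_prog_def prefix_prog_def store_prog_def)
      then show "runs \<omega> prefix_prog \<tau> (6 + num_ends X * 15) (\<lambda>\<tau>. draws \<tau> = Suc \<kappa> * num_ends X \<and>
          (\<forall>i\<le>num_ends X. rmem \<tau> 3 i = prefix0 X \<omega> \<kappa> i \<and> rmem \<tau> 4 i = prefix1 X R Q \<omega> \<kappa> i))"
        using q(2) u by (intro runs_prefix_prog[OF env']) (simp_all add: I_def \<kappa> flip: \<kappa>_def)
      fix \<upsilon> assume \<upsilon>: "draws \<upsilon> = Suc \<kappa> * num_ends X \<and>
          (\<forall>i\<le>num_ends X. rmem \<upsilon> 3 i = prefix0 X \<omega> \<kappa> i \<and> rmem \<upsilon> 4 i = prefix1 X R Q \<omega> \<kappa> i)"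
        and frame': "frame (instrs prefix_prog) \<tau> \<upsilon>"
      note g = frameD[OF frame']
      have regs: "nreg \<upsilon> 9 = r" "nreg \<upsilon> 10 = q" "rmem \<upsilon> 5 = rmem \<tau> 5"
        by (simp_all add: f g piece_prog_def prefix_prog_def store_prog_def q r)
      have env'': "env X R Q F \<upsilon>"
        by (rule env_frame[OF env' frame']) (simp add: env_safe_def prefix_prog_def)
      have "runs \<omega> store_prog \<upsilon> (2 + num_dens X * (10 + num_pieces X * 20)) (\<lambda>\<tau>.
        \<forall>j<num_dens X. \<forall>\<kappa>'<R * Q. rmem \<tau> 5 (j * (R * Q) + \<kappa>') =
        (if \<kappa>' = \<kappa> then sketch X R Q \<omega> j \<kappa> else rmem \<upsilon> 5 (j * (R * Q) + \<kappa>')))"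
        using \<upsilon> by (intro runs_store_prog[OF env'' _ \<kappa>(2) _ wf]) (simp_all add: regs \<kappa>_def)
      from runs_frame[OF this] show "runs \<omega> store_prog \<upsilon> (2 + num_dens X * (10 + num_pieces X * 20))
        (\<lambda>\<tau>'. I (Suc q) (\<tau>'\<lparr>nreg := (nreg \<tau>')(10 := Suc q)\<rparr>))"
      proof (rule runs_weaken)
        fix \<tau>' assume *: "(\<forall>j<num_dens X. \<forall>\<kappa>'<R * Q. rmem \<tau>' 5 (j * (R * Q) + \<kappa>') =
          (if \<kappa>' = \<kappa> then sketch X R Q \<omega> j \<kappa> else rmem \<upsilon> 5 (j * (R * Q) + \<kappa>'))) \<and> frame (instrs store_prog) \<upsilon> \<tau>'"
        have "draws \<tau>' = draws \<upsilon>"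
          by (rule frameD(5)[OF *[THEN conjunct2]]) (simp add: store_prog_def piece_prog_def)
        moreover have "rmem \<tau>' 5 (j * (R * Q) + \<kappa>') = sketch X R Q \<omega> j \<kappa>'" if "j < num_dens X" "\<kappa>' < Suc \<kappa>" for j \<kappa>'
          using *[THEN conjunct1, rule_format, of j \<kappa>'] that \<kappa>(2) q(2) by (auto simp: I_def regs simp flip: \<kappa>_def)
        ultimately show "I (Suc q) (\<tau>'\<lparr>nreg := (nreg \<tau>')(10 := Suc q)\<rparr>)"
          using \<upsilon> by (simp add: I_def \<kappa>_def)
      qed simp
    qed simp
  qed (auto simp: I_def prefix_prog_def store_prog_def piece_prog_def algebra_simps)
qed

definition sketch_prog :: prog where
  "sketch_prog = for_loop 9 5 (Seq
     (block [NArith Plus 16 9 9, NArith Plus 16 16 4, OfNat 8 16, NArith Plus 16 5 5, OfNat 9 16, RArith RDivide 10 8 9])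
     sketch_loop)"

lemma runs_sketch_prog:
  assumes env: "env X R Q F \<sigma>" and d: "draws \<sigma> = 0" and wf: "well_formed X"
  shows "runs \<omega> sketch_prog \<sigma> (2 + R * (10 + Q * (10 + num_ends X * 15 + num_dens X * (10 + num_pieces X * 20)))) (\<lambda>\<tau>.
     \<forall>j<num_dens X. \<forall>\<kappa><R * Q. rmem \<tau> 5 (j * (R * Q) + \<kappa>) = sketch X R Q \<omega> j \<kappa>)"
proof -
  define I where "I x \<tau> \<longleftrightarrow> draws \<tau> = x * Q * num_ends X \<and>
     (\<forall>j<num_dens X. \<forall>\<kappa><x * Q. rmem \<tau> 5 (j * (R * Q) + \<kappa>) = sketch X R Q \<omega> j \<kappa>)" for x and \<tau> :: state
  let ?T = "2 + Q * (10 + num_ends X * 15 + num_dens X * (10 + num_pieces X * 20))"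
  let ?pre = "[NArith Plus 16 9 9, NArith Plus 16 16 4, OfNat 8 16, NArith Plus 16 5 5, OfNat 9 16, RArith RDivide 10 8 9]"
  show ?thesis
    unfolding sketch_prog_def
  proof (rule runs_for_loop[where B = "6 + ?T" and I = I])
    show "nreg \<sigma> 4 = 1" "nreg \<sigma> 5 = R" by (simp_all add: envD[OF env])
    show "I 0 (\<sigma>\<lparr>nreg := (nreg \<sigma>)(9 := 0)\<rparr>)" using d by (simp add: I_def)
    fix r \<tau> assume r: "r < R" "I r \<tau>" "nreg \<tau> 9 = r"
      and frame: "frame (instrs (for_loop 9 5 (Seq (block ?pre) sketch_loop))) \<sigma> \<tau>"
    have env': "env X R Q F \<tau>"
      by (rule env_frame[OF env frame]) (simp add: env_safe_def sketch_loop_def piece_prog_def prefix_prog_def store_prog_def)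
    let ?\<tau> = "fold (exec_instr \<omega>) ?pre \<tau>"
    have "frame (set ?pre) \<tau> ?\<tau>" by (simp add: frame_def)
    then have env'': "env X R Q F ?\<tau>" by (rule env_frame[OF env']) (simp add: env_safe_def)
    have "runs \<omega> sketch_loop ?\<tau> ?T (\<lambda>\<tau>.
     draws \<tau> = Suc r * Q * num_ends X \<and>
     (\<forall>j<num_dens X. \<forall>\<kappa><Suc r * Q. rmem \<tau> 5 (j * (R * Q) + \<kappa>) = sketch X R Q \<omega> j \<kappa>))"
      using r(2) by (intro runs_sketch_loop[OF env'' _ r(1) _ _ _ wf])
        (simp_all add: I_def r(3) envD[OF env'])
    then show "runs \<omega> (Seq (block ?pre) sketch_loop) \<tau> (6 + ?T) (\<lambda>\<tau>'. I (Suc r) (\<tau>'\<lparr>nreg := (nreg \<tau>')(9 := Suc r)\<rparr>))"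
      by (intro runs_Seq runs_block) (auto simp: I_def elim!: runs_weaken)
  qed (auto simp: I_def sketch_loop_def piece_prog_def prefix_prog_def store_prog_def)
qed

lemma runs_block_SeqI:
  assumes "\<And>\<tau>. \<tau> = fold (exec_instr \<omega>) cs \<sigma> \<Longrightarrow> frame (set cs) \<sigma> \<tau> \<Longrightarrow> runs \<omega> q \<tau> U Q" "length cs + U \<le> T"
  shows "runs \<omega> (Seq (block cs) q) \<sigma> T Q"
  by (rule runs_SeqI[where P = "\<lambda>\<tau>. \<tau> = fold (exec_instr \<omega>) cs \<sigma>" and T = "length cs" and U = U])
    (use assms in \<open>auto intro: runs_block\<close>)

section \<open>Estimating one pair from its stored sketches\<close>

definition abs_diff_prog :: "nat \<Rightarrow> nat \<Rightarrow> prog" where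
  "abs_diff_prog a b = Seq (block [RLoad 8 5 a, RLoad 9 5 b, RArith RMinus 8 8 9])
     (Cond (RLess 8 23) (block [RArith RMinus 8 23 8]) Skip)"

lemma runs_abs_diff_prog:
  assumes "rreg \<sigma> 23 = 0"
  shows "runs \<omega> (abs_diff_prog a b) \<sigma> 5 (\<lambda>\<tau>. rreg \<tau> 8 = \<bar>rmem \<sigma> 5 (nreg \<sigma> a) - rmem \<sigma> 5 (nreg \<sigma> b)\<bar>)"
proof -
  have "runs \<omega> (abs_diff_prog a b) \<sigma> (3 + Suc 1) (\<lambda>\<tau>. rreg \<tau> 8 = \<bar>rmem \<sigma> 5 (nreg \<sigma> a) - rmem \<sigma> 5 (nreg \<sigma> b)\<bar>)"
    unfolding abs_diff_prog_def
    by (intro runs_Seq runs_block runs_Cond runs_Skip) (simp_all add: assms)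
  then show ?thesis by simp
qed

definition ratio_prog :: prog where
  "ratio_prog = for_loop 10 7 (Seq (block [NArith Plus 18 16 10, NArith Plus 19 17 10])
     (Seq (abs_diff_prog 18 19) (block [RArith RDivide 8 20 8, RArith RTimes 21 21 8])))"

lemma runs_ratio_prog:
  assumes env: "env X R Q F \<sigma>" and V: "rreg \<sigma> 21 = 1"
  shows "runs \<omega> ratio_prog \<sigma> (2 + Q * 11)
    (\<lambda>\<tau>. rreg \<tau> 21 = (\<Prod>q<Q. rreg \<sigma> 20 / \<bar>rmem \<sigma> 5 (nreg \<sigma> 16 + q) - rmem \<sigma> 5 (nreg \<sigma> 17 + q)\<bar>))"
proof -
  define I where "I x \<tau> \<longleftrightarrow> rreg \<tau> 21 = (\<Prod>q<x. rreg \<sigma> 20 / \<bar>rmem \<sigma> 5 (nreg \<sigma> 16 + q) - rmem \<sigma> 5 (nreg \<sigma> 17 + q)\<bar>)"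
    for x and \<tau> :: state
  let ?body = "Seq (block [NArith Plus 18 16 10, NArith Plus 19 17 10])
     (Seq (abs_diff_prog 18 19) (block [RArith RDivide 8 20 8, RArith RTimes 21 21 8]))"
  show ?thesis
    unfolding ratio_prog_def
  proof (rule runs_for_loop[where B = 9 and I = I])
    show "nreg \<sigma> 4 = 1" "nreg \<sigma> 7 = Q" by (simp_all add: envD[OF env])
    show "I 0 (\<sigma>\<lparr>nreg := (nreg \<sigma>)(10 := 0)\<rparr>)" by (simp add: I_def V)
    fix q \<tau> assume q: "q < Q" "I q \<tau>" "nreg \<tau> 10 = q" and frame: "frame (instrs (for_loop 10 7 ?body)) \<sigma> \<tau>"
    note f = frameD[OF frame]
    have \<tau>: "rmem \<tau> 5 = rmem \<sigma> 5" "nreg \<tau> 16 = nreg \<sigma> 16" "nreg \<tau> 17 = nreg \<sigma> 17" "rreg \<tau> 20 = rreg \<sigma> 20" "rreg \<tau> 23 = 0"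
      by (simp_all add: f abs_diff_prog_def envD[OF env])
    show "runs \<omega> ?body \<tau> 9 (\<lambda>\<tau>'. I (Suc q) (\<tau>'\<lparr>nreg := (nreg \<tau>')(10 := Suc q)\<rparr>))"
    proof (rule runs_block_SeqI[where U = 7])
      let ?\<tau> = "fold (exec_instr \<omega>) [NArith Plus 18 16 10, NArith Plus 19 17 10] \<tau>"
      fix \<upsilon> assume \<upsilon>: "\<upsilon> = ?\<tau>"
      show "runs \<omega> (Seq (abs_diff_prog 18 19) (block [RArith RDivide 8 20 8, RArith RTimes 21 21 8])) \<upsilon> 7
          (\<lambda>\<tau>'. I (Suc q) (\<tau>'\<lparr>nreg := (nreg \<tau>')(10 := Suc q)\<rparr>))"
      proof (rule runs_SeqI[OF runs_abs_diff_prog])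
        show "rreg \<upsilon> 23 = 0" by (simp add: \<upsilon> \<tau>)
        fix \<phi> assume \<phi>: "rreg \<phi> 8 = \<bar>rmem \<upsilon> 5 (nreg \<upsilon> 18) - rmem \<upsilon> 5 (nreg \<upsilon> 19)\<bar>" "frame (instrs (abs_diff_prog 18 19)) \<upsilon> \<phi>"
        have g: "rreg \<phi> 20 = rreg \<sigma> 20" "rreg \<phi> 21 = rreg \<tau> 21"
          by (simp_all add: frameD[OF \<phi>(2)] abs_diff_prog_def \<upsilon> \<tau>)
        show "runs \<omega> (block [RArith RDivide 8 20 8, RArith RTimes 21 21 8]) \<phi> 2 (\<lambda>\<tau>'. I (Suc q) (\<tau>'\<lparr>nreg := (nreg \<tau>')(10 := Suc q)\<rparr>))"
          using q(2) by (intro runs_block) (simp_all add: I_def g \<phi>(1) \<upsilon> \<tau> q(3))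
      qed simp
    qed auto
  qed (auto simp: I_def abs_diff_prog_def)
qed

text \<open>The search does not leave the loop when it succeeds: the remaining rounds only perform
  the test. This fixes the number of rounds, and with it the operation count, independently of the
  tape.\<close>

definition search_prog :: prog where
  "search_prog = for_loop 11 22 (Cond (RLess 21 2) (block [RArith RTimes 21 21 4, RArith RTimes 20 20 3]) Skip)"

lemma runs_search_prog:
  assumes env: "env X R Q F \<sigma>"
  shows "runs \<omega> search_prog \<sigma> (2 + 2 * Q * 5) (\<lambda>\<tau>. rreg \<tau> 20 = snd ((root_step Q F ^^ (2 * Q)) (rreg \<sigma> 21, rreg \<sigma> 20)))"
proof -
  define I where "I x \<tau> \<longleftrightarrow> (rreg \<tau> 21, rreg \<tau> 20) = (root_step Q F ^^ x) (rreg \<sigma> 21, rreg \<sigma> 20)" for x and \<tau> :: state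
  let ?body = "Cond (RLess 21 2) (block [RArith RTimes 21 21 4, RArith RTimes 20 20 3]) Skip"
  show ?thesis
    unfolding search_prog_def
  proof (rule runs_for_loop[where B = "Suc 2" and I = I])
    show "nreg \<sigma> 4 = 1" "nreg \<sigma> 22 = 2 * Q" by (simp_all add: envD[OF env])
    show "I 0 (\<sigma>\<lparr>nreg := (nreg \<sigma>)(11 := 0)\<rparr>)" by (simp add: I_def)
    fix x \<tau> assume x: "I x \<tau>" and frame: "frame (instrs (for_loop 11 22 ?body)) \<sigma> \<tau>"
    note f = frameD[OF frame]
    have \<tau>: "rreg \<tau> 2 = 1" "rreg \<tau> 3 = F" "rreg \<tau> 4 = F ^ Q"
      by (simp_all add: f envD[OF env])
    show "runs \<omega> ?body \<tau> (Suc 2) (\<lambda>\<tau>'. I (Suc x) (\<tau>'\<lparr>nreg := (nreg \<tau>')(11 := Suc x)\<rparr>))"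
      by (intro runs_Cond runs_block runs_Skip)
        (use x in \<open>auto simp: I_def \<tau> root_step_def simp flip: prod.collapse split: prod.splits\<close>)
  next
    fix \<tau> assume "I (2 * Q) \<tau>"
    then show "rreg \<tau> 20 = snd ((root_step Q F ^^ (2 * Q)) (rreg \<sigma> 21, rreg \<sigma> 20))"
      unfolding I_def by (metis snd_conv)
  qed auto
qed

definition geo_mean_prog :: prog where
  "geo_mean_prog = Seq (block [NArith Times 16 12 8, NArith Times 17 9 7, NArith Plus 16 16 17,
      NArith Times 18 14 8, NArith Plus 17 18 17])
    (Seq (abs_diff_prog 16 17) (Seq (block [RArith RTimes 20 8 5, RArith RMinus 21 2 23]) (Seq ratio_prog search_prog)))"

lemma runs_geo_mean_prog:
  assumes env: "env X R Q F \<sigma>" and Q: "1 \<le> Q"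
    and regs: "nreg \<sigma> 12 = j" "nreg \<sigma> 14 = k" "nreg \<sigma> 9 = r" and jkr: "j < num_dens X" "k < num_dens X" "r < R"
    and mem: "\<forall>j<num_dens X. \<forall>\<kappa><R * Q. rmem \<sigma> 5 (j * (R * Q) + \<kappa>) = sketch X R Q \<omega> j \<kappa>"
  shows "runs \<omega> geo_mean_prog \<sigma> (16 + Q * 21)
    (\<lambda>\<tau>. rreg \<tau> 20 = geo_mean Q F (\<lambda>q. sketch X R Q \<omega> j (r * Q + q) - sketch X R Q \<omega> k (r * Q + q)))"
proof -
  let ?x = "\<lambda>q. sketch X R Q \<omega> j (r * Q + q) - sketch X R Q \<omega> k (r * Q + q)"
  let ?pre = "[NArith Times 16 12 8, NArith Times 17 9 7, NArith Plus 16 16 17, NArith Times 18 14 8, NArith Plus 17 18 17]"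
  let ?p3 = "Seq ratio_prog search_prog"
  let ?p2 = "Seq (block [RArith RTimes 20 8 5, RArith RMinus 21 2 23]) ?p3"
  have x: "rmem \<sigma> 5 (j * (R * Q) + r * Q + q) - rmem \<sigma> 5 (k * (R * Q) + r * Q + q) = ?x q" if "q < Q" for q
    using mem jkr cell_bound[OF jkr(3) that] by (simp add: add.assoc)
  show ?thesis
    unfolding geo_mean_prog_def
  proof (rule runs_block_SeqI[where U = "11 + Q * 21"])
    let ?\<tau> = "fold (exec_instr \<omega>) ?pre \<sigma>"
    fix \<tau> assume \<tau>: "\<tau> = ?\<tau>" and "frame (set ?pre) \<sigma> \<tau>"
    then have env\<tau>: "env X R Q F \<tau>" by (intro env_frame[OF env]) (auto simp: env_safe_def)
    have t: "nreg \<tau> 16 = j * (R * Q) + r * Q" "nreg \<tau> 17 = k * (R * Q) + r * Q" "rmem \<tau> 5 = rmem \<sigma> 5"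
      by (simp_all add: \<tau> regs envD[OF env])
    show "runs \<omega> (Seq (abs_diff_prog 16 17) ?p2) \<tau> (11 + Q * 21) (\<lambda>\<tau>. rreg \<tau> 20 = geo_mean Q F ?x)"
    proof (rule runs_SeqI[OF runs_abs_diff_prog])
      show "rreg \<tau> 23 = 0" by (simp add: envD[OF env\<tau>])
      fix \<upsilon> assume \<upsilon>: "rreg \<upsilon> 8 = \<bar>rmem \<tau> 5 (nreg \<tau> 16) - rmem \<tau> 5 (nreg \<tau> 17)\<bar>"
        and frame: "frame (instrs (abs_diff_prog 16 17)) \<tau> \<upsilon>"
      have env\<upsilon>: "env X R Q F \<upsilon>" by (rule env_frame[OF env\<tau> frame]) (simp add: env_safe_def abs_diff_prog_def)
      have u: "rreg \<upsilon> 8 = \<bar>?x 0\<bar>" using x[of 0] Q by (simp add: \<upsilon> t)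
      have u': "nreg \<upsilon> 16 = j * (R * Q) + r * Q" "nreg \<upsilon> 17 = k * (R * Q) + r * Q" "rmem \<upsilon> 5 = rmem \<sigma> 5"
        by (simp_all add: frameD[OF frame] abs_diff_prog_def t)
      show "runs \<omega> ?p2 \<upsilon> (6 + Q * 21) (\<lambda>\<tau>. rreg \<tau> 20 = geo_mean Q F ?x)"
      proof (rule runs_block_SeqI[where U = "4 + Q * 21"])
        let ?\<phi> = "fold (exec_instr \<omega>) [RArith RTimes 20 8 5, RArith RMinus 21 2 23] \<upsilon>"
        fix \<phi> assume \<phi>: "\<phi> = ?\<phi>" and "frame (set [RArith RTimes 20 8 5, RArith RMinus 21 2 23]) \<upsilon> \<phi>"
        then have env\<phi>: "env X R Q F \<phi>" by (intro env_frame[OF env\<upsilon>]) (auto simp: env_safe_def)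
        let ?T = "\<bar>?x 0\<bar> * (1 / F ^ Q)"
        have p: "rreg \<phi> 20 = ?T" "rreg \<phi> 21 = 1" "nreg \<phi> 16 = j * (R * Q) + r * Q" "nreg \<phi> 17 = k * (R * Q) + r * Q"
          "rmem \<phi> 5 = rmem \<sigma> 5"
          by (simp_all add: \<phi> u u' envD[OF env\<upsilon>])
        show "runs \<omega> ?p3 \<phi> (4 + Q * 21) (\<lambda>\<tau>. rreg \<tau> 20 = geo_mean Q F ?x)"
        proof (rule runs_SeqI[OF runs_ratio_prog[OF env\<phi> p(2)]])
          fix \<psi> assume \<psi>: "rreg \<psi> 21 = (\<Prod>q<Q. rreg \<phi> 20 / \<bar>rmem \<phi> 5 (nreg \<phi> 16 + q) - rmem \<phi> 5 (nreg \<phi> 17 + q)\<bar>)"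
            and frame': "frame (instrs ratio_prog) \<phi> \<psi>"
          have env\<psi>: "env X R Q F \<psi>"
            by (rule env_frame[OF env\<phi> frame']) (simp add: env_safe_def abs_diff_prog_def ratio_prog_def)
          have "rreg \<psi> 20 = ?T" by (simp add: frameD[OF frame'] p abs_diff_prog_def ratio_prog_def)
          moreover have "rreg \<psi> 21 = (\<Prod>q<Q. ?T / \<bar>?x q\<bar>)"
            unfolding \<psi> p by (intro prod.cong refl) (simp add: x)
          ultimately show "runs \<omega> search_prog \<psi> (2 + 2 * Q * 5) (\<lambda>\<tau>. rreg \<tau> 20 = geo_mean Q F ?x)"
            using runs_search_prog[OF env\<psi>, of \<omega>] by (simp add: geo_mean_def Let_def)
        qed simp
      qed auto
    qed simp
  qed auto
qed

definition pair_prog :: prog where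
  "pair_prog = Seq (block [RArith RMinus 22 23 23])
    (Seq (for_loop 9 5 (Seq geo_mean_prog (block [RArith RPlus 22 22 20])))
      (block [OfNat 8 5, RArith RDivide 22 22 8, NArith Times 16 12 0, NArith Plus 16 16 14, RStore 2 16 22]))"

lemmas estimator_defs = geo_mean_prog_def abs_diff_prog_def ratio_prog_def search_prog_def

lemma runs_pair_prog:
  assumes env: "env X R Q F \<sigma>" and Q: "1 \<le> Q"
    and regs: "nreg \<sigma> 12 = j" "nreg \<sigma> 14 = k" and jk: "j < num_dens X" "k < num_dens X"
    and mem: "\<forall>j<num_dens X. \<forall>\<kappa><R * Q. rmem \<sigma> 5 (j * (R * Q) + \<kappa>) = sketch X R Q \<omega> j \<kappa>"
  shows "runs \<omega> pair_prog \<sigma> (8 + R * (19 + Q * 21))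
    (\<lambda>\<tau>. rmem \<tau> 2 = (rmem \<sigma> 2)(j * num_dens X + k := estimate X R Q F \<omega> j k))"
proof -
  let ?g = "\<lambda>r. geo_mean Q F (\<lambda>q. sketch X R Q \<omega> j (r * Q + q) - sketch X R Q \<omega> k (r * Q + q))"
  let ?post = "\<lambda>\<tau>. rmem \<tau> 2 = (rmem \<sigma> 2)(j * num_dens X + k := estimate X R Q F \<omega> j k)"
  define I where "I x \<tau> \<longleftrightarrow> rreg \<tau> 22 = (\<Sum>r<x. ?g r)" for x and \<tau> :: state
  let ?last = "[OfNat 8 5, RArith RDivide 22 22 8, NArith Times 16 12 0, NArith Plus 16 16 14, RStore 2 16 22]"
  let ?body = "Seq geo_mean_prog (block [RArith RPlus 22 22 20])"
  show ?thesis
    unfolding pair_prog_def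
  proof (rule runs_block_SeqI[where U = "7 + R * (19 + Q * 21)"])
    let ?\<tau> = "fold (exec_instr \<omega>) [RArith RMinus 22 23 23] \<sigma>"
    fix \<tau> assume \<tau>: "\<tau> = ?\<tau>" and "frame (set [RArith RMinus 22 23 23]) \<sigma> \<tau>"
    then have env\<tau>: "env X R Q F \<tau>" by (intro env_frame[OF env]) (auto simp: env_safe_def)
    have t: "rmem \<tau> 5 = rmem \<sigma> 5" "rmem \<tau> 2 = rmem \<sigma> 2" "nreg \<tau> 12 = j" "nreg \<tau> 14 = k" "rreg \<tau> 22 = 0"
      by (simp_all add: \<tau> regs)
    show "runs \<omega> (Seq (for_loop 9 5 ?body) (block ?last)) \<tau> (7 + R * (19 + Q * 21)) ?post"
    proof (rule runs_SeqI[where P = "I R" and T = "2 + R * (19 + Q * 21)" and U = 5])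
      show "runs \<omega> (for_loop 9 5 ?body) \<tau> (2 + R * (19 + Q * 21)) (I R)"
      proof (rule runs_for_loop[where B = "17 + Q * 21" and I = I])
        show "nreg \<tau> 4 = 1" "nreg \<tau> 5 = R" by (simp_all add: envD[OF env\<tau>])
        show "I 0 (\<tau>\<lparr>nreg := (nreg \<tau>)(9 := 0)\<rparr>)" by (simp add: I_def t)
        fix r \<upsilon> assume r: "r < R" "I r \<upsilon>" "nreg \<upsilon> 9 = r" and frame: "frame (instrs (for_loop 9 5 ?body)) \<tau> \<upsilon>"
        have env\<upsilon>: "env X R Q F \<upsilon>" by (rule env_frame[OF env\<tau> frame]) (simp add: env_safe_def estimator_defs)
        have u: "rmem \<upsilon> 5 = rmem \<sigma> 5" "nreg \<upsilon> 12 = j" "nreg \<upsilon> 14 = k"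
          by (simp_all add: frameD[OF frame] estimator_defs t)
        show "runs \<omega> ?body \<upsilon> (17 + Q * 21) (\<lambda>\<tau>'. I (Suc r) (\<tau>'\<lparr>nreg := (nreg \<tau>')(9 := Suc r)\<rparr>))"
        proof (rule runs_SeqI[OF runs_geo_mean_prog[OF env\<upsilon> Q u(2,3) r(3) jk r(1)]])
          show "\<forall>j<num_dens X. \<forall>\<kappa><R * Q. rmem \<upsilon> 5 (j * (R * Q) + \<kappa>) = sketch X R Q \<omega> j \<kappa>"
            using mem by (simp add: u)
          fix \<phi> assume \<phi>: "rreg \<phi> 20 = ?g r" and frame': "frame (instrs geo_mean_prog) \<upsilon> \<phi>"
          have "rreg \<phi> 22 = rreg \<upsilon> 22" by (simp add: frameD[OF frame'] estimator_defs)
          then show "runs \<omega> (block [RArith RPlus 22 22 20]) \<phi> 1 (\<lambda>\<tau>'. I (Suc r) (\<tau>'\<lparr>nreg := (nreg \<tau>')(9 := Suc r)\<rparr>))"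
            using r(2) by (intro runs_block) (simp_all add: I_def \<phi>)
        qed simp
      qed (auto simp: estimator_defs I_def)
      fix \<upsilon> assume \<upsilon>: "I R \<upsilon>" and frame: "frame (instrs (for_loop 9 5 ?body)) \<tau> \<upsilon>"
      have env\<upsilon>: "env X R Q F \<upsilon>" by (rule env_frame[OF env\<tau> frame]) (simp add: env_safe_def estimator_defs)
      have "rmem \<upsilon> 2 = rmem \<sigma> 2" "nreg \<upsilon> 12 = j" "nreg \<upsilon> 14 = k"
        by (simp_all add: frameD[OF frame] estimator_defs t)
      then show "runs \<omega> (block ?last) \<upsilon> 5 ?post"
        using \<upsilon> by (intro runs_block) (simp_all add: I_def estimate_def envD[OF env\<upsilon>])
    qed simp
  qed auto
qed

definition pairs_prog :: prog where
  "pairs_prog = for_loop 12 0 (for_loop 14 0 pair_prog)"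

lemma runs_pairs_prog:
  assumes env: "env X R Q F \<sigma>" and Q: "1 \<le> Q"
    and mem: "\<forall>j<num_dens X. \<forall>\<kappa><R * Q. rmem \<sigma> 5 (j * (R * Q) + \<kappa>) = sketch X R Q \<omega> j \<kappa>"
  defines "m \<equiv> num_dens X"
  shows "runs \<omega> pairs_prog \<sigma> (2 + m * (4 + m * (10 + R * (19 + Q * 21))))
    (\<lambda>\<tau>. \<forall>j<m. \<forall>k<m. result m \<tau> j k = estimate X R Q F \<omega> j k)"
proof -
  define I where "I x \<tau> \<longleftrightarrow> (\<forall>j<x. \<forall>k<m. rmem \<tau> 2 (j * m + k) = estimate X R Q F \<omega> j k)" for x and \<tau> :: state
  define J where "J j x \<tau> \<longleftrightarrow> I j \<tau> \<and> (\<forall>k<x. rmem \<tau> 2 (j * m + k) = estimate X R Q F \<omega> j k)" for j x and \<tau> :: state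
  note instrs = pair_prog_def estimator_defs
  show ?thesis
    unfolding pairs_prog_def
  proof (rule runs_for_loop[where B = "2 + m * (10 + R * (19 + Q * 21))" and I = I])
    show "nreg \<sigma> 4 = 1" "nreg \<sigma> 0 = m" by (simp_all add: envD[OF env] m_def)
    show "I 0 (\<sigma>\<lparr>nreg := (nreg \<sigma>)(12 := 0)\<rparr>)" by (simp add: I_def)
    fix j \<tau> assume j: "j < m" "I j \<tau>" "nreg \<tau> 12 = j" and frame: "frame (instrs (for_loop 12 0 (for_loop 14 0 pair_prog))) \<sigma> \<tau>"
    have env\<tau>: "env X R Q F \<tau>" by (rule env_frame[OF env frame]) (simp add: env_safe_def instrs)
    have mem\<tau>: "rmem \<tau> 5 = rmem \<sigma> 5" by (simp add: frameD[OF frame] instrs)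
    show "runs \<omega> (for_loop 14 0 pair_prog) \<tau> (2 + m * (10 + R * (19 + Q * 21))) (\<lambda>\<tau>'. I (Suc j) (\<tau>'\<lparr>nreg := (nreg \<tau>')(12 := Suc j)\<rparr>))"
    proof (rule runs_for_loop[where B = "8 + R * (19 + Q * 21)" and I = "J j"])
      show "nreg \<tau> 4 = 1" "nreg \<tau> 0 = m" by (simp_all add: envD[OF env\<tau>] m_def)
      show "J j 0 (\<tau>\<lparr>nreg := (nreg \<tau>)(14 := 0)\<rparr>)" using j(2) by (simp add: J_def I_def)
      fix k \<upsilon> assume k: "k < m" "J j k \<upsilon>" "nreg \<upsilon> 14 = k" and frame': "frame (instrs (for_loop 14 0 pair_prog)) \<tau> \<upsilon>"
      have env\<upsilon>: "env X R Q F \<upsilon>" by (rule env_frame[OF env\<tau> frame']) (simp add: env_safe_def instrs)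
      have u: "rmem \<upsilon> 5 = rmem \<sigma> 5" "nreg \<upsilon> 12 = j" by (simp_all add: frameD[OF frame'] instrs mem\<tau> j)
      show "runs \<omega> pair_prog \<upsilon> (8 + R * (19 + Q * 21)) (\<lambda>\<tau>'. J j (Suc k) (\<tau>'\<lparr>nreg := (nreg \<tau>')(14 := Suc k)\<rparr>))"
      proof (rule runs_weaken[OF runs_pair_prog[OF env\<upsilon> Q u(2) k(3)]])
        show "j < num_dens X" "k < num_dens X" using j k by (simp_all add: m_def)
        show "\<forall>j<num_dens X. \<forall>\<kappa><R * Q. rmem \<upsilon> 5 (j * (R * Q) + \<kappa>) = sketch X R Q \<omega> j \<kappa>" using mem by (simp add: u)
        fix \<phi> :: state assume "rmem \<phi> 2 = (rmem \<upsilon> 2)(j * num_dens X + k := estimate X R Q F \<omega> j k)"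
        then show "J j (Suc k) (\<phi>\<lparr>nreg := (nreg \<phi>)(14 := Suc k)\<rparr>)"
          using k by (auto simp: J_def I_def less_Suc_eq cell_eq_iff simp flip: m_def)
      qed simp
    next
      fix \<upsilon> assume "J j m \<upsilon>"
      then show "I (Suc j) (\<upsilon>\<lparr>nreg := (nreg \<upsilon>)(12 := Suc j)\<rparr>)" by (auto simp: J_def I_def less_Suc_eq)
    qed (auto simp: instrs)
  next
    fix \<tau> assume "I m \<tau>"
    then show "\<forall>j<m. \<forall>k<m. result m \<tau> j k = estimate X R Q F \<omega> j k" by (simp add: I_def result_def)
  qed (auto simp: instrs algebra_simps)
qed

section \<open>Grid size and confidence level, computed without roots or rounding\<close>

text \<open>The total relative error will be \<open>12 / R\<^sup>2\<close>, which 24 makes at most \<open>min \<epsilon> 1 / 2\<close>.\<close>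

definition grid_size :: "real \<Rightarrow> nat" where
  "grid_size \<epsilon> = (LEAST R. 24 \<le> real (R * R) * min \<epsilon> 1)"

text \<open>A binary logarithm of m / \<delta>, rounded up. If a pair fails with probability at most
  (1/4)^L, then all m^2 pairs together fail with probability at most (m / 2^L)^2 \<le> \<delta>^2,
  which is below \<delta> in the relevant case \<delta> < 1.\<close>

definition conf_bits :: "nat \<Rightarrow> real \<Rightarrow> nat" where
  "conf_bits m \<delta> = (LEAST L. 1 \<le> L \<and> real m \<le> 2 ^ L * \<delta>)"

text \<open>The upper bound comes from minimality: \<open>r = R - 1\<close> still misses 24, and
  passing from \<open>r\<close> to \<open>Suc r\<close> at most quadruples the square, hence 96 = 4
  * 24.\<close>

lemma grid_size:
  assumes "0 < \<epsilon>"
  shows "24 \<le> real (grid_size \<epsilon> * grid_size \<epsilon>) * min \<epsilon> 1" "1 \<le> grid_size \<epsilon>"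
    "real (grid_size \<epsilon> * grid_size \<epsilon>) * min \<epsilon> 1 \<le> 96"
proof -
  let ?e = "min \<epsilon> 1"
  have e: "0 < ?e" "?e \<le> 1" using assms by auto
  obtain R :: nat where R: "24 / ?e \<le> real R" using real_arch_simple by blast
  have "0 < 24 / ?e" using e by simp
  then have "1 \<le> R" using R by (cases R) auto
  then have "real R * 1 \<le> real R * real R" by (intro mult_left_mono) auto
  then have "24 / ?e \<le> real (R * R)" using R by simp
  then have ex: "24 \<le> real (R * R) * ?e" using e by (simp add: pos_divide_le_eq)
  show *: "24 \<le> real (grid_size \<epsilon> * grid_size \<epsilon>) * ?e"
    unfolding grid_size_def by (rule LeastI) (rule ex)
  show "1 \<le> grid_size \<epsilon>"
    using * by (cases "grid_size \<epsilon>") auto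
  show "real (grid_size \<epsilon> * grid_size \<epsilon>) * ?e \<le> 96"
  proof (cases "grid_size \<epsilon> \<le> 1")
    case True
    then have "grid_size \<epsilon> = 1" using \<open>1 \<le> grid_size \<epsilon>\<close> by simp
    then show ?thesis using e by simp
  next
    case False
    then obtain r where r: "grid_size \<epsilon> = Suc r" "1 \<le> r" by (cases "grid_size \<epsilon>") auto
    have "\<not> 24 \<le> real (r * r) * ?e"
      using not_less_Least[of r "\<lambda>R. 24 \<le> real (R * R) * ?e"] r unfolding grid_size_def by simp
    moreover have "real (Suc r * Suc r) \<le> 4 * real (r * r)"
    proof -
      have "Suc r * Suc r \<le> (2 * r) * (2 * r)" using r by (intro mult_le_mono) auto
      then have "real (Suc r * Suc r) \<le> real ((2 * r) * (2 * r))" by (simp only: of_nat_le_iff)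
      then show ?thesis by simp
    qed
    then have "real (Suc r * Suc r) * ?e \<le> 4 * real (r * r) * ?e" using e by (intro mult_right_mono) auto
    ultimately show ?thesis unfolding r(1) by simp
  qed
qed

text \<open>By minimality L exceeds the exact binary logarithm by at most 1 when L > 1. The
  assumption that m / \<delta> is at least 2 lets the logarithm absorb this unit, at the price of
  the factor 2.\<close>

lemma conf_bits:
  assumes "0 < \<delta>"
  shows "1 \<le> conf_bits m \<delta>" "real m \<le> 2 ^ conf_bits m \<delta> * \<delta>"
    "2 \<le> real m / \<delta> \<Longrightarrow> real (conf_bits m \<delta>) \<le> 2 * ln (real m / \<delta>) / ln 2"
proof -
  obtain n where n: "real m / \<delta> < 2 ^ n" using real_arch_pow[of 2 "real m / \<delta>"] by auto
  then have "real m \<le> 2 ^ n * \<delta>" using assms by (simp add: pos_divide_less_eq)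
  also have "\<dots> \<le> 2 ^ Suc n * \<delta>" using assms by simp
  finally have ex: "1 \<le> Suc n \<and> real m \<le> 2 ^ Suc n * \<delta>" by simp
  have *: "1 \<le> conf_bits m \<delta> \<and> real m \<le> 2 ^ conf_bits m \<delta> * \<delta>"
    unfolding conf_bits_def by (rule LeastI) (rule ex)
  then show "1 \<le> conf_bits m \<delta>" "real m \<le> 2 ^ conf_bits m \<delta> * \<delta>" by auto
  assume m: "2 \<le> real m / \<delta>"
  have l: "ln 2 \<le> ln (real m / \<delta>)" using m by (subst ln_le_cancel_iff) auto
  show "real (conf_bits m \<delta>) \<le> 2 * ln (real m / \<delta>) / ln 2"
  proof (cases "conf_bits m \<delta> = 1")
    case True
    have "0 < ln (2 :: real)" by simp
    then have "1 * ln 2 \<le> 2 * ln (real m / \<delta>)" using l by linarith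
    then show ?thesis using True by (simp add: pos_le_divide_eq)
  next
    case False
    then obtain L where L: "conf_bits m \<delta> = Suc L" "1 \<le> L" using * by (cases "conf_bits m \<delta>") auto
    have "\<not> (1 \<le> L \<and> real m \<le> 2 ^ L * \<delta>)"
      using not_less_Least[of L "\<lambda>L. 1 \<le> L \<and> real m \<le> 2 ^ L * \<delta>"] L unfolding conf_bits_def by simp
    then have "2 ^ L < real m / \<delta>" using L assms by (simp add: pos_less_divide_eq)
    then have "ln (2 ^ L) \<le> ln (real m / \<delta>)" by (subst ln_le_cancel_iff) (auto intro: less_imp_le order.strict_trans[of 0 "2 ^ L"])
    then have "real L * ln 2 \<le> ln (real m / \<delta>)" by (simp add: ln_realpow)
    then have "(real L + 1) * ln 2 \<le> 2 * ln (real m / \<delta>)" using l by (simp add: algebra_simps)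
    then show ?thesis unfolding L(1) by (simp add: field_simps)
  qed
qed

definition loop_grid :: prog where
  "loop_grid = Loop (RLess 8 6) (block [NArith Plus 5 5 4, NArith Times 16 5 5, OfNat 8 16, RArith RTimes 8 8 7])"

definition loop_conf :: prog where
  "loop_conf = Loop (RLess 10 9) (block [NArith Plus 6 6 4, RArith RPlus 10 10 10])"

lemma runs_loop_grid:
  assumes "0 < \<epsilon>" "nreg \<sigma> 4 = 1" "nreg \<sigma> 5 = 1" "rreg \<sigma> 6 = 24" "rreg \<sigma> 7 = min \<epsilon> 1" "rreg \<sigma> 8 = min \<epsilon> 1"
  shows "runs \<omega> loop_grid \<sigma> (grid_size \<epsilon> * 5) (\<lambda>\<tau>. nreg \<tau> 5 = grid_size \<epsilon>)"
proof -
  define I where "I x \<tau> \<longleftrightarrow> nreg \<tau> 5 = Suc x \<and> rreg \<tau> 8 = real (Suc x * Suc x) * min \<epsilon> 1 \<and>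
    nreg \<tau> 4 = 1 \<and> rreg \<tau> 6 = 24 \<and> rreg \<tau> 7 = min \<epsilon> 1" for x and \<tau> :: state
  let ?n = "grid_size \<epsilon> - 1"
  have n: "Suc ?n = grid_size \<epsilon>" using grid_size(2)[OF assms(1)] by simp
  have "runs \<omega> loop_grid \<sigma> (1 + (?n - 0) * (4 + 1)) (I ?n)"
    unfolding loop_grid_def
  proof (rule runs_Loop)
    show "I 0 \<sigma>" using assms by (simp add: I_def)
    fix x \<tau> assume I: "I x \<tau>"
    show "holds (RLess 8 6) \<tau> \<longleftrightarrow> x < ?n" if "x \<le> ?n"
    proof (cases "x = ?n")
      case True
      then have "Suc x = grid_size \<epsilon>" using n by simp
      then show ?thesis using I grid_size(1)[OF assms(1)] True by (simp only: I_def holds.simps) simp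
    next
      case False
      then have "Suc x < grid_size \<epsilon>" using that n by simp
      then have "\<not> 24 \<le> real (Suc x * Suc x) * min \<epsilon> 1" unfolding grid_size_def by (rule not_less_Least)
      then show ?thesis using I False that by (simp only: I_def holds.simps) simp
    qed
    show "runs \<omega> (block [NArith Plus 5 5 4, NArith Times 16 5 5, OfNat 8 16, RArith RTimes 8 8 7]) \<tau> 4 (I (Suc x))"
      using I by (intro runs_block) (simp_all add: I_def)
  qed simp
  then show ?thesis
    by (rule runs_weaken) (use n in \<open>auto simp: I_def\<close>)
qed

lemma runs_loop_conf:
  assumes "0 < \<delta>" "nreg \<sigma> 4 = 1" "nreg \<sigma> 6 = 1" "rreg \<sigma> 9 = real m" "rreg \<sigma> 10 = \<delta> + \<delta>"
  shows "runs \<omega> loop_conf \<sigma> (conf_bits m \<delta> * 3) (\<lambda>\<tau>. nreg \<tau> 6 = conf_bits m \<delta>)"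
proof -
  define I where "I x \<tau> \<longleftrightarrow> nreg \<tau> 6 = Suc x \<and> rreg \<tau> 10 = 2 ^ Suc x * \<delta> \<and> nreg \<tau> 4 = 1 \<and> rreg \<tau> 9 = real m"
    for x and \<tau> :: state
  let ?n = "conf_bits m \<delta> - 1"
  have n: "Suc ?n = conf_bits m \<delta>" using conf_bits(1)[OF assms(1), of m] by simp
  have "runs \<omega> loop_conf \<sigma> (1 + (?n - 0) * (2 + 1)) (I ?n)"
    unfolding loop_conf_def
  proof (rule runs_Loop)
    show "I 0 \<sigma>" using assms by (simp add: I_def)
    fix x \<tau> assume I: "I x \<tau>"
    show "holds (RLess 10 9) \<tau> \<longleftrightarrow> x < ?n" if "x \<le> ?n"
    proof (cases "x = ?n")
      case True
      then have "Suc x = conf_bits m \<delta>" using n by simp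
      then show ?thesis using I conf_bits(2)[OF assms(1), of m] True by (simp only: I_def holds.simps) simp
    next
      case False
      then have "Suc x < conf_bits m \<delta>" using that n by simp
      then have "\<not> (1 \<le> Suc x \<and> real m \<le> 2 ^ Suc x * \<delta>)" unfolding conf_bits_def by (rule not_less_Least)
      then show ?thesis using I False that by (simp only: I_def holds.simps) simp
    qed
    show "runs \<omega> (block [NArith Plus 6 6 4, RArith RPlus 10 10 10]) \<tau> 2 (I (Suc x))"
      using I by (intro runs_block) (simp_all add: I_def)
  qed simp
  then show ?thesis
    by (rule runs_weaken) (use n in \<open>auto simp: I_def\<close>)
qed

definition power_prog :: prog where
  "power_prog = for_loop 10 7 (block [RArith RTimes 4 4 3])"

lemma runs_power_prog:
  assumes "nreg \<sigma> 4 = 1" "nreg \<sigma> 7 = Q" "rreg \<sigma> 4 = 1" "rreg \<sigma> 3 = F"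
  shows "runs \<omega> power_prog \<sigma> (2 + Q * 3) (\<lambda>\<tau>. rreg \<tau> 4 = F ^ Q)"
proof -
  define I where "I x \<tau> \<longleftrightarrow> rreg \<tau> 4 = F ^ x" for x and \<tau> :: state
  show ?thesis
    unfolding power_prog_def
  proof (rule runs_for_loop[where B = 1 and I = I])
    show "nreg \<sigma> 4 = 1" "nreg \<sigma> 7 = Q" by fact+
    show "I 0 (\<sigma>\<lparr>nreg := (nreg \<sigma>)(10 := 0)\<rparr>)" using assms by (simp add: I_def)
    fix x \<tau> assume x: "I x \<tau>" and frame: "frame (instrs (for_loop 10 7 (block [RArith RTimes 4 4 3]))) \<sigma> \<tau>"
    have "rreg \<tau> 3 = F" by (simp add: frameD[OF frame] assms)
    then show "runs \<omega> (block [RArith RTimes 4 4 3]) \<tau> 1 (\<lambda>\<tau>'. I (Suc x) (\<tau>'\<lparr>nreg := (nreg \<tau>')(10 := Suc x)\<rparr>))"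
      using x by (intro runs_block) (simp_all add: I_def mult.commute)
  qed (auto simp: I_def)
qed

text \<open>\<open>K\<close> is a constant of the program text. It carries the analytic constants of
  the Cauchy law and nothing of the input, so a single program serves all families and all
  parameters.\<close>

definition setup_prog :: "nat \<Rightarrow> prog" where
  "setup_prog K =
     Seq (block [NConst 4 1, OfNat 2 4, NConst 16 24, OfNat 6 16, NConst 5 1, NConst 6 1, NConst 21 K])
    (Seq (Cond (RLess 2 1) (block [RArith RMinus 7 2 23]) (block [RArith RMinus 7 1 23]))
    (Seq (block [NArith Times 16 5 5, OfNat 8 16, RArith RTimes 8 8 7])
    (Seq loop_grid
    (Seq (block [OfNat 9 0, RArith RPlus 10 0 0])
    (Seq loop_conf
    (Seq (block [NArith Times 16 5 5, NArith Times 17 16 5, NArith Times 17 17 6, NArith Times 7 17 21,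
        NArith Times 8 5 7, NArith Plus 22 7 7, OfNat 8 16, RArith RDivide 8 2 8, RArith RPlus 3 2 8, RArith RMinus 4 2 23])
    (Seq power_prog (block [RArith RDivide 5 2 4]))))))))"

definition L1_prog :: "nat \<Rightarrow> prog" where
  "L1_prog K = Seq (setup_prog K) (Seq sketch_prog pairs_prog)"

definition sample_size :: "nat \<Rightarrow> nat \<Rightarrow> real \<Rightarrow> real \<Rightarrow> nat" where
  "sample_size K m \<delta> \<epsilon> = grid_size \<epsilon> * grid_size \<epsilon> * grid_size \<epsilon> * conf_bits m \<delta> * K"

definition ratio :: "real \<Rightarrow> real" where
  "ratio \<epsilon> = 1 + 1 / real (grid_size \<epsilon> * grid_size \<epsilon>)"

lemma runs_setup_prog:
  fixes X :: input_data and K :: nat and \<delta> \<epsilon> :: real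
  assumes "0 < \<delta>" "0 < \<epsilon>"
  defines "R \<equiv> grid_size \<epsilon>" and "L \<equiv> conf_bits (num_dens X) \<delta>" and "Q \<equiv> sample_size K (num_dens X) \<delta> \<epsilon>" and "F \<equiv> ratio \<epsilon>"
  shows "runs \<omega> (setup_prog K) (initial_state 1 X \<delta> \<epsilon>) (27 + R * 5 + L * 3 + Q * 3) (\<lambda>\<tau>. env X R Q F \<tau> \<and> draws \<tau> = 0)"
proof -
  let ?\<sigma> = "initial_state 1 X \<delta> \<epsilon>"
  define m n where "m = num_dens X" and "n = num_pieces X"
  \<comment> \<open>What setup leaves alone: the input, the registers holding 0 and the draw
    counter.\<close>
  define safe :: "state \<Rightarrow> bool" where "safe \<tau> \<longleftrightarrow> nreg \<tau> 0 = m \<and> nreg \<tau> 1 = n \<and> nreg \<tau> 2 = num_ends X \<and> nreg \<tau> 3 = 0 \<and>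
    rreg \<tau> 0 = \<delta> \<and> rreg \<tau> 1 = \<epsilon> \<and> rreg \<tau> 23 = 0 \<and> nmem \<tau> = nmem ?\<sigma> \<and> rmem \<tau> = rmem ?\<sigma> \<and> draws \<tau> = 0" for \<tau>
  have safe0: "safe ?\<sigma>" by (simp add: safe_def initial_state_def Let_def m_def n_def)
  have safeI: "safe \<tau>" if "safe \<sigma>" "frame S \<sigma> \<tau>"
    "\<forall>c\<in>S. \<forall>i\<in>{0, 1, 2, 3}. i \<notin> instr_nregs c" "\<forall>c\<in>S. \<forall>i\<in>{0, 1, 23}. i \<notin> instr_rregs c"
    "\<forall>c\<in>S. instr_narrs c = {} \<and> instr_rarrs c = {} \<and> \<not> instr_draws c" for S \<sigma> \<tau>
  proof -
    note f = frameD[OF that(2)]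
    have "nreg \<tau> i = nreg \<sigma> i" if "i \<in> {0, 1, 2, 3}" for i using f(1)[of i] \<open>\<forall>c\<in>S. \<forall>i\<in>{0, 1, 2, 3}. i \<notin> instr_nregs c\<close> that by blast
    moreover have "rreg \<tau> i = rreg \<sigma> i" if "i \<in> {0, 1, 23}" for i using f(2)[of i] \<open>\<forall>c\<in>S. \<forall>i\<in>{0, 1, 23}. i \<notin> instr_rregs c\<close> that by blast
    moreover have "nmem \<tau> = nmem \<sigma>" "rmem \<tau> = rmem \<sigma>" "draws \<tau> = draws \<sigma>"
      using f(3-5) that(5) by (auto simp: fun_eq_iff)
    ultimately show ?thesis using that(1) by (simp add: safe_def)
  qed
  have envI: "env X R Q F \<tau>" if "safe \<tau>" "nreg \<tau> 4 = 1" "nreg \<tau> 5 = R" "nreg \<tau> 7 = Q" "nreg \<tau> 8 = R * Q" "nreg \<tau> 22 = 2 * Q"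
    "rreg \<tau> 2 = 1" "rreg \<tau> 3 = F" "rreg \<tau> 4 = F ^ Q" "rreg \<tau> 5 = 1 / F ^ Q" for \<tau>
  proof -
    have idx: "j * n + l < m * n" "(j * n + l) div n = j" "(j * n + l) mod n = l" if "j < m" "l < n" for j l
      using cell_bound[OF that] that by simp_all
    have "nmem \<tau> 0 (j * n + l) = left_ix X j l \<and> nmem \<tau> 1 (j * n + l) = right_ix X j l \<and>
      rmem \<tau> 1 ((j * n + l) + (j * n + l)) = coef X j l 0 \<and> rmem \<tau> 1 ((j * n + l) + (j * n + l) + 1) = coef X j l 1"
      if "j < m" "l < n" for j l
    proof -
      let ?i = "j * n + l"
      have "?i + ?i < m * n * (1 + 1)" "?i + ?i + 1 < m * n * (1 + 1)" using idx(1)[OF that] by simp_all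
      moreover have "(?i + ?i) div (1 + 1) = ?i" "(?i + ?i) mod (1 + 1) = 0"
        "(?i + ?i + 1) div (1 + 1) = ?i" "(?i + ?i + 1) mod (1 + 1) = 1" by presburger+
      ultimately show ?thesis
        using \<open>safe \<tau>\<close> idx[OF that] by (simp only: safe_def initial_state_def Let_def m_def[symmetric] n_def[symmetric]) simp
    qed
    moreover have "rmem \<tau> 0 i = endpt0 X i" for i
      using \<open>safe \<tau>\<close> by (simp add: safe_def initial_state_def Let_def endpt0_def)
    ultimately show ?thesis using that by (simp add: env_def safe_def m_def n_def)
  qed
  let ?b7 = "[NArith Times 16 5 5, NArith Times 17 16 5, NArith Times 17 17 6, NArith Times 7 17 21,
        NArith Times 8 5 7, NArith Plus 22 7 7, OfNat 8 16, RArith RDivide 8 2 8, RArith RPlus 3 2 8, RArith RMinus 4 2 23]"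
  let ?post = "\<lambda>\<tau>. env X R Q F \<tau> \<and> draws \<tau> = 0"
  \<comment> \<open>The program is verified from its end backwards; each claim lists the register
    contents at the entry to the remaining text.\<close>
  have p9: "runs \<omega> (block [RArith RDivide 5 2 4]) \<tau> 1 ?post"
    if "safe \<tau>" "nreg \<tau> 4 = 1" "nreg \<tau> 5 = R" "nreg \<tau> 7 = Q" "nreg \<tau> 8 = R * Q" "nreg \<tau> 22 = 2 * Q"
    "rreg \<tau> 2 = 1" "rreg \<tau> 3 = F" "rreg \<tau> 4 = F ^ Q" for \<tau>
    using that by (intro runs_block conjI envI) (auto simp: safe_def)
  have p8: "runs \<omega> (Seq power_prog (block [RArith RDivide 5 2 4])) \<tau> (3 + Q * 3) ?post"
    if t: "safe \<tau>" "nreg \<tau> 4 = 1" "nreg \<tau> 5 = R" "nreg \<tau> 7 = Q" "nreg \<tau> 8 = R * Q" "nreg \<tau> 22 = 2 * Q"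
    "rreg \<tau> 2 = 1" "rreg \<tau> 3 = F" "rreg \<tau> 4 = 1" for \<tau>
  proof (rule runs_SeqI[OF runs_power_prog[OF t(2,4,9,8)]])
    fix \<upsilon> assume u: "rreg \<upsilon> 4 = F ^ Q" and frame: "frame (instrs power_prog) \<tau> \<upsilon>"
    have "safe \<upsilon>" by (rule safeI[OF t(1) frame]) (auto simp: power_prog_def)
    then show "runs \<omega> (block [RArith RDivide 5 2 4]) \<upsilon> 1 ?post"
      by (rule p9) (simp_all add: frameD[OF frame] power_prog_def t u)
  qed simp
  have p7: "runs \<omega> (Seq (block ?b7) (Seq power_prog (block [RArith RDivide 5 2 4]))) \<tau> (13 + Q * 3) ?post"
    if t: "safe \<tau>" "nreg \<tau> 4 = 1" "nreg \<tau> 5 = R" "nreg \<tau> 6 = L" "nreg \<tau> 21 = K" "rreg \<tau> 2 = 1" for \<tau>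
  proof (rule runs_block_SeqI)
    fix \<upsilon> assume u: "\<upsilon> = fold (exec_instr \<omega>) ?b7 \<tau>" and frame: "frame (set ?b7) \<tau> \<upsilon>"
    have "safe \<upsilon>" by (rule safeI[OF t(1) frame]) auto
    then show "runs \<omega> (Seq power_prog (block [RArith RDivide 5 2 4])) \<upsilon> (3 + Q * 3) ?post"
      using t by (intro p8) (simp_all add: u safe_def Q_def sample_size_def F_def ratio_def R_def L_def m_def)
  qed simp
  let ?p7 = "Seq (block ?b7) (Seq power_prog (block [RArith RDivide 5 2 4]))"
  have p6: "runs \<omega> (Seq loop_conf ?p7) \<tau> (13 + Q * 3 + L * 3) ?post"
    if t: "safe \<tau>" "nreg \<tau> 4 = 1" "nreg \<tau> 5 = R" "nreg \<tau> 6 = 1" "nreg \<tau> 21 = K" "rreg \<tau> 2 = 1"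
      "rreg \<tau> 9 = real (num_dens X)" "rreg \<tau> 10 = \<delta> + \<delta>" for \<tau>
  proof (rule runs_SeqI[OF runs_loop_conf[OF assms(1) t(2,4,7,8)]])
    fix \<upsilon> assume u: "nreg \<upsilon> 6 = conf_bits (num_dens X) \<delta>" and frame: "frame (instrs loop_conf) \<tau> \<upsilon>"
    have "safe \<upsilon>" by (rule safeI[OF t(1) frame]) (auto simp: loop_conf_def)
    then show "runs \<omega> ?p7 \<upsilon> (13 + Q * 3) ?post"
      by (rule p7) (simp_all add: frameD[OF frame] loop_conf_def t u L_def)
  qed (simp add: L_def)
  let ?p6 = "Seq loop_conf ?p7"
  have p5: "runs \<omega> (Seq (block [OfNat 9 0, RArith RPlus 10 0 0]) ?p6) \<tau> (15 + Q * 3 + L * 3) ?post"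
    if t: "safe \<tau>" "nreg \<tau> 4 = 1" "nreg \<tau> 5 = R" "nreg \<tau> 6 = 1" "nreg \<tau> 21 = K" "rreg \<tau> 2 = 1" for \<tau>
  proof (rule runs_block_SeqI)
    fix \<upsilon> assume u: "\<upsilon> = fold (exec_instr \<omega>) [OfNat 9 0, RArith RPlus 10 0 0] \<tau>"
      and frame: "frame (set [OfNat 9 0, RArith RPlus 10 0 0]) \<tau> \<upsilon>"
    have "safe \<upsilon>" by (rule safeI[OF t(1) frame]) auto
    then show "runs \<omega> ?p6 \<upsilon> (13 + Q * 3 + L * 3) ?post"
      by (rule p6) (use t in \<open>simp_all add: u safe_def m_def\<close>)
  qed simp
  let ?p5 = "Seq (block [OfNat 9 0, RArith RPlus 10 0 0]) ?p6"
  have p4: "runs \<omega> (Seq loop_grid ?p5) \<tau> (15 + Q * 3 + L * 3 + R * 5) ?post"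
    if t: "safe \<tau>" "nreg \<tau> 4 = 1" "nreg \<tau> 5 = 1" "nreg \<tau> 6 = 1" "nreg \<tau> 21 = K" "rreg \<tau> 2 = 1"
      "rreg \<tau> 6 = 24" "rreg \<tau> 7 = min \<epsilon> 1" "rreg \<tau> 8 = min \<epsilon> 1" for \<tau>
  proof (rule runs_SeqI[OF runs_loop_grid[OF assms(2) t(2,3,7,8,9)]])
    fix \<upsilon> assume u: "nreg \<upsilon> 5 = grid_size \<epsilon>" and frame: "frame (instrs loop_grid) \<tau> \<upsilon>"
    have "safe \<upsilon>" by (rule safeI[OF t(1) frame]) (auto simp: loop_grid_def)
    then show "runs \<omega> ?p5 \<upsilon> (15 + Q * 3 + L * 3) ?post"
      by (rule p5) (simp_all add: frameD[OF frame] loop_grid_def t u R_def)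
  qed (simp add: R_def)
  let ?p4 = "Seq loop_grid ?p5"
  let ?b3 = "[NArith Times 16 5 5, OfNat 8 16, RArith RTimes 8 8 7]"
  have p3: "runs \<omega> (Seq (block ?b3) ?p4) \<tau> (18 + Q * 3 + L * 3 + R * 5) ?post"
    if t: "safe \<tau>" "nreg \<tau> 4 = 1" "nreg \<tau> 5 = 1" "nreg \<tau> 6 = 1" "nreg \<tau> 21 = K" "rreg \<tau> 2 = 1"
      "rreg \<tau> 6 = 24" "rreg \<tau> 7 = min \<epsilon> 1" for \<tau>
  proof (rule runs_block_SeqI)
    fix \<upsilon> assume u: "\<upsilon> = fold (exec_instr \<omega>) ?b3 \<tau>" and frame: "frame (set ?b3) \<tau> \<upsilon>"
    have "safe \<upsilon>" by (rule safeI[OF t(1) frame]) auto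
    then show "runs \<omega> ?p4 \<upsilon> (15 + Q * 3 + L * 3 + R * 5) ?post"
      by (rule p4) (use t in \<open>simp_all add: u\<close>)
  qed simp
  let ?p3 = "Seq (block ?b3) ?p4"
  let ?c2 = "Cond (RLess 2 1) (block [RArith RMinus 7 2 23]) (block [RArith RMinus 7 1 23])"
  have p2: "runs \<omega> (Seq ?c2 ?p3) \<tau> (20 + Q * 3 + L * 3 + R * 5) ?post"
    if t: "safe \<tau>" "nreg \<tau> 4 = 1" "nreg \<tau> 5 = 1" "nreg \<tau> 6 = 1" "nreg \<tau> 21 = K" "rreg \<tau> 2 = 1"
      "rreg \<tau> 6 = 24" for \<tau>
  proof (rule runs_SeqI[where P = "\<lambda>\<upsilon>. rreg \<upsilon> 7 = min \<epsilon> 1" and T = "Suc 1"])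
    show "runs \<omega> ?c2 \<tau> (Suc 1) (\<lambda>\<upsilon>. rreg \<upsilon> 7 = min \<epsilon> 1)"
      using t by (intro runs_Cond runs_block) (auto simp: safe_def)
    fix \<upsilon> assume u: "rreg \<upsilon> 7 = min \<epsilon> 1" and frame: "frame (instrs ?c2) \<tau> \<upsilon>"
    have "safe \<upsilon>" by (rule safeI[OF t(1) frame]) auto
    then show "runs \<omega> ?p3 \<upsilon> (18 + Q * 3 + L * 3 + R * 5) ?post"
      by (rule p3) (simp_all add: frameD[OF frame] t u)
  qed simp
  let ?b1 = "[NConst 4 1, OfNat 2 4, NConst 16 24, OfNat 6 16, NConst 5 1, NConst 6 1, NConst 21 K]"
  show ?thesis
    unfolding setup_prog_def
  proof (rule runs_block_SeqI)
    fix \<upsilon> assume u: "\<upsilon> = fold (exec_instr \<omega>) ?b1 ?\<sigma>" and frame: "frame (set ?b1) ?\<sigma> \<upsilon>"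
    have "safe \<upsilon>" by (rule safeI[OF safe0 frame]) auto
    then show "runs \<omega> (Seq ?c2 ?p3) \<upsilon> (20 + Q * 3 + L * 3 + R * 5) ?post"
      by (rule p2) (simp_all add: u)
  qed simp
qed

definition L1_prog_time :: "nat \<Rightarrow> input_data \<Rightarrow> real \<Rightarrow> real \<Rightarrow> nat" where
  "L1_prog_time K X \<delta> \<epsilon> = (let m = num_dens X; n = num_pieces X; s = num_ends X;
      R = grid_size \<epsilon>; L = conf_bits m \<delta>; Q = sample_size K m \<delta> \<epsilon> in
    (27 + R * 5 + L * 3 + Q * 3) + (2 + R * (10 + Q * (10 + s * 15 + m * (10 + n * 20))))
      + (2 + m * (4 + m * (10 + R * (19 + Q * 21)))))"

lemma runs_L1_prog:
  assumes \<delta>: "0 < \<delta>" and \<epsilon>: "0 < \<epsilon>" and K: "1 \<le> K" and wf: "well_formed X"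
  defines "m \<equiv> num_dens X"
  defines "Q \<equiv> sample_size K m \<delta> \<epsilon>"
  shows "runs \<omega> (L1_prog K) (initial_state 1 X \<delta> \<epsilon>) (L1_prog_time K X \<delta> \<epsilon>)
    (\<lambda>\<tau>. \<forall>j<m. \<forall>k<m. result m \<tau> j k = estimate X (grid_size \<epsilon>) Q (ratio \<epsilon>) \<omega> j k)"
proof -
  let ?R = "grid_size \<epsilon>" and ?F = "ratio \<epsilon>"
  have "1 \<le> Q"
    using K grid_size(2)[OF \<epsilon>] conf_bits(1)[OF \<delta>, of m] by (simp add: Q_def sample_size_def Suc_le_eq)
  let ?T1 = "27 + ?R * 5 + conf_bits m \<delta> * 3 + Q * 3"
  let ?T2 = "2 + ?R * (10 + Q * (10 + num_ends X * 15 + m * (10 + num_pieces X * 20)))"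
  let ?T3 = "2 + m * (4 + m * (10 + ?R * (19 + Q * 21)))"
  have "runs \<omega> (L1_prog K) (initial_state 1 X \<delta> \<epsilon>) (?T1 + (?T2 + ?T3))
    (\<lambda>\<tau>. \<forall>j<m. \<forall>k<m. result m \<tau> j k = estimate X ?R Q ?F \<omega> j k)"
    unfolding L1_prog_def
  proof (rule runs_SeqI[OF _ _ order_refl])
    show "runs \<omega> (setup_prog K) (initial_state 1 X \<delta> \<epsilon>) ?T1 (\<lambda>\<tau>. env X ?R Q ?F \<tau> \<and> draws \<tau> = 0)"
      unfolding Q_def m_def by (rule runs_setup_prog[OF \<delta> \<epsilon>])
    fix \<tau> assume \<tau>: "env X ?R Q ?F \<tau> \<and> draws \<tau> = 0"
    show "runs \<omega> (Seq sketch_prog pairs_prog) \<tau> (?T2 + ?T3)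
      (\<lambda>\<tau>. \<forall>j<m. \<forall>k<m. result m \<tau> j k = estimate X ?R Q ?F \<omega> j k)"
    proof (rule runs_SeqI[OF _ _ order_refl])
      show "runs \<omega> sketch_prog \<tau> ?T2 (\<lambda>\<tau>. \<forall>j<num_dens X. \<forall>\<kappa><?R * Q. rmem \<tau> 5 (j * (?R * Q) + \<kappa>) = sketch X ?R Q \<omega> j \<kappa>)"
        unfolding m_def using \<tau> by (intro runs_sketch_prog wf) auto
      fix \<upsilon> assume \<upsilon>: "\<forall>j<num_dens X. \<forall>\<kappa><?R * Q. rmem \<upsilon> 5 (j * (?R * Q) + \<kappa>) = sketch X ?R Q \<omega> j \<kappa>"
        and frame: "frame (instrs sketch_prog) \<tau> \<upsilon>"
      have "env X ?R Q ?F \<upsilon>"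
        by (rule env_frame[OF \<tau>[THEN conjunct1] frame])
          (simp add: env_safe_def sketch_prog_def sketch_loop_def piece_prog_def prefix_prog_def store_prog_def)
      then show "runs \<omega> pairs_prog \<upsilon> ?T3 (\<lambda>\<tau>. \<forall>j<m. \<forall>k<m. result m \<tau> j k = estimate X ?R Q ?F \<omega> j k)"
        unfolding m_def by (rule runs_pairs_prog) (use \<upsilon> \<open>1 \<le> Q\<close> in auto)
    qed
  qed
  then show ?thesis
    by (rule runs_weaken) (simp_all add: L1_prog_time_def Let_def Q_def m_def)
qed

section \<open>Error analysis of the estimator\<close>

lemma node0_eq_node:
  assumes "Suc i < num_ends X"
  shows "node0 X R r i = node X R r i"
  using assms by (simp add: node0_def node_def endpt0_def)

lemma prefix_diff:
  fixes g :: "nat \<Rightarrow> real"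
  assumes "b \<le> c" "c \<le> s"
  shows "(\<Sum>i<c. g i) - (\<Sum>i<b. g i) = (\<Sum>i<s. if b \<le> i \<and> i < c then g i else 0)"
proof -
  have "(\<Sum>i<s. if b \<le> i \<and> i < c then g i else 0) = (\<Sum>i\<in>{..<s} \<inter> {i. b \<le> i \<and> i < c}. g i)"
    by (simp only: sum.inter_restrict finite_lessThan mem_Collect_eq)
  also have "{..<s} \<inter> {i. b \<le> i \<and> i < c} = {b..<c}" using assms by auto
  also have "(\<Sum>i\<in>{b..<c}. g i) = (\<Sum>i<c. g i) - (\<Sum>i<b. g i)"
    using sum_diff_nat_ivl[of 0 b c g] assms by (simp add: lessThan_atLeast0)
  finally show ?thesis by (rule sym)
qed

text \<open>Each prefix difference is a sum over the elementary intervals of the piece, and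
  interchanging it with the sum over pieces collects the coefficients. All right indices are at most
  \<open>num_ends X - 1\<close>, so the junk increment never enters and every node involved is a
  genuine one.\<close>

lemma sketch_eq:
  assumes wf: "well_formed X" and j: "j < num_dens X"
  shows "sketch X R Q \<omega> j \<kappa> = (\<Sum>i<num_ends X - 1. width X i *
    (elem_coef X j 0 i + elem_coef X j 1 i * node X R (\<kappa> div Q) i) * \<omega> (Std_Cauchy, \<kappa> * num_ends X + i))"
proof -
  let ?s = "num_ends X - 1"
  let ?g = "\<lambda>i. cauchy_incr X \<omega> \<kappa> i" and ?p = "\<lambda>i. node0 X R (\<kappa> div Q) i"
  let ?on = "\<lambda>l i. left_ix X j l \<le> i \<and> i < right_ix X j l"
  have "piece_sketch X R Q \<omega> j \<kappa> l = (\<Sum>i<?s. ?g i * ((if ?on l i then coef X j l 0 else 0) + (if ?on l i then coef X j l 1 else 0) * ?p i))"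
    if "l < num_pieces X" for l
  proof -
    have "left_ix X j l < right_ix X j l" "right_ix X j l < num_ends X"
      using wf j that unfolding well_formed_def by blast+
    then have "left_ix X j l \<le> right_ix X j l" "right_ix X j l \<le> ?s" by auto
    then have "piece_sketch X R Q \<omega> j \<kappa> l = coef X j l 0 * (\<Sum>i<?s. if ?on l i then ?g i else 0) +
      coef X j l 1 * (\<Sum>i<?s. if ?on l i then ?g i * ?p i else 0)"
      unfolding piece_sketch_def prefix0_def prefix1_def by (simp only: prefix_diff)
    also have "\<dots> = (\<Sum>i<?s. ?g i * ((if ?on l i then coef X j l 0 else 0) + (if ?on l i then coef X j l 1 else 0) * ?p i))"
      unfolding sum_distrib_left sum.distrib[symmetric] by (intro sum.cong refl) (simp add: algebra_simps)
    finally show ?thesis .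
  qed
  then have "sketch X R Q \<omega> j \<kappa> = (\<Sum>l<num_pieces X. \<Sum>i<?s. ?g i * ((if ?on l i then coef X j l 0 else 0) + (if ?on l i then coef X j l 1 else 0) * ?p i))"
    by (simp add: sketch_def)
  also have "\<dots> = (\<Sum>i<?s. ?g i * (elem_coef X j 0 i + elem_coef X j 1 i * ?p i))"
    by (subst sum.swap) (simp add: elem_coef_def sum_distrib_left sum.distrib sum_distrib_right distrib_left del: One_nat_def)
  also have "\<dots> = (\<Sum>i<?s. width X i *
    (elem_coef X j 0 i + elem_coef X j 1 i * node X R (\<kappa> div Q) i) * \<omega> (Std_Cauchy, \<kappa> * num_ends X + i))"
  proof (intro sum.cong refl)
    fix i assume "i \<in> {..<?s}"
    then have "Suc i < num_ends X" "i < num_ends X" by auto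
    then show "?g i * (elem_coef X j 0 i + elem_coef X j 1 i * ?p i) = width X i *
        (elem_coef X j 0 i + elem_coef X j 1 i * node X R (\<kappa> div Q) i) * \<omega> (Std_Cauchy, \<kappa> * num_ends X + i)"
      by (simp add: node0_eq_node cauchy_incr_def endpt0_def)
  qed
  finally show ?thesis .
qed

text \<open>The test on \<open>V\<close> is equivalent to ln T < g. So \<open>T\<close> is
  multiplied only while it is below the target, which limits the overshoot to one factor
  \<open>F\<close>; and as long as the target is not reached, every round has multiplied, which
  determines \<open>T\<close> exactly.\<close>

lemma root_step_invariant:
  assumes F: "1 < F" and Q: "1 \<le> Q" and P: "0 < P" and T0: "0 < T0" and g: "real Q * g = ln P" and le: "ln T0 \<le> g"
    and VT: "(V, T) = (root_step Q F ^^ n) (T0 ^ Q / P, T0)"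
  shows "0 < T \<and> V = T ^ Q / P \<and> ln T \<le> g + ln F \<and> (g \<le> ln T \<or> ln T = ln T0 + real n * ln F)"
  using VT
proof (induction n arbitrary: V T)
  case 0
  have "0 \<le> ln F" using F by simp
  then show ?case using 0 T0 le by simp
next
  case (Suc n)
  obtain V' T' where VT': "(V', T') = (root_step Q F ^^ n) (T0 ^ Q / P, T0)" by (metis surj_pair)
  have IH: "0 < T'" "V' = T' ^ Q / P" "ln T' \<le> g + ln F" "g \<le> ln T' \<or> ln T' = ln T0 + real n * ln F"
    using Suc.IH[OF VT'] by auto
  have step: "(V, T) = root_step Q F (V', T')" using Suc.prems VT' by simp
  have "V' < 1 \<longleftrightarrow> T' ^ Q < P" using P IH by (simp add: divide_less_eq)
  also have "\<dots> \<longleftrightarrow> ln (T' ^ Q) < ln P" using P IH by (subst ln_less_cancel_iff) auto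
  also have "\<dots> \<longleftrightarrow> real Q * ln T' < real Q * g" using IH by (simp add: ln_realpow g)
  also have "\<dots> \<longleftrightarrow> ln T' < g" using Q by simp
  finally have lt: "V' < 1 \<longleftrightarrow> ln T' < g" .
  show ?case
  proof (cases "V' < 1")
    case True
    then have "V = V' * F ^ Q" "T = T' * F" using step by (auto simp: root_step_def)
    moreover have "ln (T' * F) = ln T' + ln F" using IH F by (simp add: ln_mult)
    ultimately show ?thesis using IH lt True F by (auto simp: power_mult_distrib algebra_simps)
  next
    case False
    then have "V = V'" "T = T'" using step by (auto simp: root_step_def)
    then show ?thesis using IH lt False by auto
  qed
qed

text \<open>\<open>start\<close> puts the target inside the search window: the initial value is not
  above it, and \<open>2 * Q\<close> multiplications without a stop would end at ln \<bar>x 0\<bar>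
  + Q * ln F, which is not below it.\<close>

lemma geo_mean_bounds:
  assumes F: "1 < F" and Q: "1 \<le> Q" and x: "\<And>q. q < Q \<Longrightarrow> x q \<noteq> 0"
  defines "g \<equiv> (\<Sum>q<Q. ln \<bar>x q\<bar>) / real Q"
  assumes start: "\<bar>ln \<bar>x 0\<bar> - g\<bar> \<le> real Q * ln F"
  shows "0 < geo_mean Q F x" "g \<le> ln (geo_mean Q F x)" "ln (geo_mean Q F x) \<le> g + ln F"
proof -
  define P where "P = (\<Prod>q<Q. \<bar>x q\<bar>)"
  define T0 where "T0 = \<bar>x 0\<bar> * (1 / F ^ Q)"
  have P: "0 < P" unfolding P_def using x by (intro prod_pos) auto
  have T0: "0 < T0" unfolding T0_def using x[of 0] Q F by simp
  have "ln P = (\<Sum>q<Q. ln \<bar>x q\<bar>)" unfolding P_def using x by (intro ln_prod) auto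
  then have g: "real Q * g = ln P" using Q by (simp add: g_def)
  have lnT0: "ln T0 = ln \<bar>x 0\<bar> - real Q * ln F"
    unfolding T0_def using x[of 0] Q F by (simp add: ln_div ln_realpow)
  have V0: "(\<Prod>q<Q. T0 / \<bar>x q\<bar>) = T0 ^ Q / P" by (simp add: prod_dividef P_def)
  obtain V T where VT: "(V, T) = (root_step Q F ^^ (2 * Q)) (T0 ^ Q / P, T0)" by (metis surj_pair)
  have le: "ln T0 \<le> g" using start unfolding lnT0 by linarith
  note inv = root_step_invariant[OF F Q P T0 g le VT]
  have T: "geo_mean Q F x = T" unfolding geo_mean_def Let_def T0_def[symmetric] V0 VT[symmetric] by simp
  have "g \<le> ln T" using inv start unfolding lnT0 by auto
  then show "0 < geo_mean Q F x" "g \<le> ln (geo_mean Q F x)" "ln (geo_mean Q F x) \<le> g + ln F"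
    using inv unfolding T by auto
qed

text \<open>For node positions of scale 0, where all samples vanish and a relative error leaves no
  slack: the initial \<open>T\<close> is 0 and multiplications keep it so, whatever \<open>V\<close>
  is.\<close>

lemma geo_mean_zero:
  assumes "x 0 = 0"
  shows "geo_mean Q F x = 0"
proof -
  have "snd ((root_step Q F ^^ n) (V, 0)) = 0" for n V
    by (induction n) (auto simp: root_step_def split: prod.splits)
  then show ?thesis using assms by (simp add: geo_mean_def Let_def)
qed

text \<open>The result is S * exp \<zeta> with \<zeta> between \<xi> and \<xi> + 1 / R^2, and
  \<bar>\<zeta>\<bar> is at most 2 / R. In the constant 5, one unit is the search error and four
  come from the quadratic remaining term of the exponential.\<close>

lemma geo_mean_first_order:
  fixes S \<xi> :: real and R Q :: nat
  assumes R: "2 \<le> R" and Q: "1 \<le> Q" and S: "0 < S" and c: "\<And>q. q < Q \<Longrightarrow> c q \<noteq> 0"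
  defines "\<xi> \<equiv> (\<Sum>q<Q. ln \<bar>c q\<bar>) / real Q"
  assumes \<xi>: "\<bar>\<xi>\<bar> \<le> 1 / real R"
    and start: "\<bar>ln \<bar>c 0\<bar>\<bar> \<le> real Q / (2 * (real R)\<^sup>2) - 1"
  shows "\<bar>geo_mean Q (1 + 1 / (real R)\<^sup>2) (\<lambda>q. S * c q) - S - S * \<xi>\<bar> \<le> 5 * S / (real R)\<^sup>2"
proof -
  define \<rho> where "\<rho> = 1 / (real R)\<^sup>2"
  have \<rho>: "0 < \<rho>" "\<rho> \<le> 1" using R by (auto simp: \<rho>_def)
  let ?T = "geo_mean Q (1 + \<rho>) (\<lambda>q. S * c q)"
  have "ln \<bar>S * c q\<bar> = ln S + ln \<bar>c q\<bar>" if "q < Q" for q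
    using S c[OF that] by (simp add: abs_mult ln_mult)
  then have g: "(\<Sum>q<Q. ln \<bar>S * c q\<bar>) / real Q = ln S + \<xi>"
    using Q by (simp add: \<xi>_def sum.distrib add_divide_distrib)
  have lnF: "\<rho> / 2 \<le> ln (1 + \<rho>)" "ln (1 + \<rho>) \<le> \<rho>"
  proof -
    show "ln (1 + \<rho>) \<le> \<rho>" using \<rho> by (intro ln_add_one_self_le_self) auto
    have "ln (1 / (1 + \<rho>)) \<le> 1 / (1 + \<rho>) - 1" using \<rho> by (intro ln_le_minus_one) auto
    moreover have "ln (1 / (1 + \<rho>)) = - ln (1 + \<rho>)" using \<rho> by (simp add: ln_div)
    moreover have "\<rho> / 2 \<le> 1 - 1 / (1 + \<rho>)" using \<rho> by (simp add: field_simps)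
    ultimately show "\<rho> / 2 \<le> ln (1 + \<rho>)" by linarith
  qed
  have "1 / real R \<le> 1" using R by simp
  have x0: "ln \<bar>S * c 0\<bar> = ln S + ln \<bar>c 0\<bar>" using S c[of 0] Q by (simp add: abs_mult ln_mult)
  \<comment> \<open>The - 1 in \<open>start\<close> makes room for \<xi>, and halving \<rho> makes
    room for replacing \<rho> by ln (1 + \<rho>).\<close>
  have "\<bar>ln \<bar>S * c 0\<bar> - (ln S + \<xi>)\<bar> \<le> real Q * (\<rho> / 2)"
    unfolding x0 using start \<xi> \<open>1 / real R \<le> 1\<close> by (simp add: \<rho>_def)
  also have "\<dots> \<le> real Q * ln (1 + \<rho>)" using lnF by (intro mult_left_mono) auto
  finally have st: "\<bar>ln \<bar>S * c 0\<bar> - (ln S + \<xi>)\<bar> \<le> real Q * ln (1 + \<rho>)" .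
  have b: "0 < ?T" "ln S + \<xi> \<le> ln ?T" "ln ?T \<le> ln S + \<xi> + ln (1 + \<rho>)"
    using geo_mean_bounds[of "1 + \<rho>" Q "\<lambda>q. S * c q", unfolded g] Q c S \<rho> st by auto
  define \<zeta> where "\<zeta> = ln ?T - ln S"
  have \<zeta>: "\<xi> \<le> \<zeta>" "\<zeta> \<le> \<xi> + \<rho>" using b lnF by (auto simp: \<zeta>_def)
  have "real R * 1 \<le> real R * real R" using R by (intro mult_left_mono) auto
  then have "\<rho> \<le> 1 / real R" using R unfolding \<rho>_def power2_eq_square by (intro frac_le) auto
  then have abs: "\<bar>\<zeta>\<bar> \<le> 2 / real R" using \<zeta> \<xi> by (auto simp: abs_le_iff)
  have "\<bar>\<zeta>\<bar> \<le> 1" using abs R by (auto intro: order_trans)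
  have sq: "\<zeta>\<^sup>2 \<le> 4 * \<rho>" using power_mono[OF abs, of 2] by (simp add: \<rho>_def power_divide)
  have T: "?T = S * exp \<zeta>" using b S by (simp add: \<zeta>_def exp_diff)
  have "1 + \<zeta> \<le> exp \<zeta>" by (rule exp_ge_add_one_self)
  moreover have "exp \<zeta> \<le> 1 + \<zeta> + \<zeta>\<^sup>2"
  proof (cases "0 \<le> \<zeta>")
    case True
    then show ?thesis using \<open>\<bar>\<zeta>\<bar> \<le> 1\<close> by (intro exp_bound) auto
  next
    case False
    \<comment> \<open>For negative arguments the claim amounts to 1 \<le> (1 - y + y^2) * exp y,
      where the quadratic Taylor bound for \<open>exp y\<close> is good enough.\<close>
    define y where "y = - \<zeta>"
    have y: "0 < y" using False by (simp add: y_def)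
    have "1 \<le> 1 + y\<^sup>2 / 2 + y ^ 3 / 2 + y ^ 4 / 2" using y by simp
    also have "\<dots> = (1 - y + y\<^sup>2) * (1 + y + y\<^sup>2 / 2)" by (simp add: power2_eq_square power3_eq_cube power4_eq_xxxx field_simps)
    also have "\<dots> \<le> (1 - y + y\<^sup>2) * exp y"
    proof (rule mult_left_mono)
      show "1 + y + y\<^sup>2 / 2 \<le> exp y" using y by (intro exp_lower_Taylor_quadratic) simp
      have "0 \<le> (1 - y / 2)\<^sup>2 + 3 / 4 * y\<^sup>2" by simp
      then show "0 \<le> 1 - y + y\<^sup>2" by (simp add: power2_eq_square algebra_simps)
    qed
    finally have "exp (- y) \<le> 1 - y + y\<^sup>2" by (simp add: exp_minus field_simps)
    then show ?thesis by (simp add: y_def)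
  qed
  ultimately have "\<bar>exp \<zeta> - 1 - \<xi>\<bar> \<le> 5 * \<rho>" using \<zeta> sq \<rho> by linarith
  then have "S * \<bar>exp \<zeta> - 1 - \<xi>\<bar> \<le> S * (5 * \<rho>)" using S by (intro mult_left_mono) auto
  also have "S * \<bar>exp \<zeta> - 1 - \<xi>\<bar> = \<bar>?T - S - S * \<xi>\<bar>"
    unfolding T using S by (simp add: abs_mult_pos' algebra_simps)
  also have "S * (5 * \<rho>) = 5 * S / (real R)\<^sup>2" by (simp add: \<rho>_def)
  finally show ?thesis unfolding \<rho>_def .
qed

text \<open>In units of D / R^2 the midpoint rule contributes 1, the linear parts contribute 1 after
  division by \<open>R\<close>, and the quadratic parts contribute 5 times the mean of the scales,
  which is at most 2 * D, that is 10. The total is 12.\<close>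

lemma combine_errors:
  fixes S T \<xi> :: "nat \<Rightarrow> real" and D \<epsilon> :: real and R :: nat
  assumes R: "1 \<le> R" and D: "0 \<le> D" and \<epsilon>: "24 \<le> real (R * R) * min \<epsilon> 1"
    and mid: "\<bar>(\<Sum>r<R. S r) / real R - D\<bar> \<le> D / (real R)\<^sup>2"
    and lin: "\<bar>\<Sum>r<R. S r * \<xi> r\<bar> \<le> D / real R"
    and T: "\<And>r. r < R \<Longrightarrow> \<bar>T r - S r - S r * \<xi> r\<bar> \<le> 5 * S r / (real R)\<^sup>2"
  defines "E \<equiv> (\<Sum>r<R. T r) / real R"
  shows "(1 - \<epsilon>) * E \<le> D" "D \<le> (1 + \<epsilon>) * E"
proof -
  define \<rho> where "\<rho> = 1 / (real R)\<^sup>2"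
  have "real 1 * real 1 \<le> real R * real R" using R by (intro mult_mono) (simp_all only: of_nat_le_iff of_nat_0_le_iff)
  then have R1: "1 \<le> (real R)\<^sup>2" by (simp add: power2_eq_square)
  have "24 / (real R)\<^sup>2 \<le> min \<epsilon> 1" using R1 \<epsilon> by (subst pos_divide_le_eq) (simp_all add: power2_eq_square mult.commute)
  then have \<rho>: "0 < \<rho>" "\<rho> \<le> 1" "24 * \<rho> \<le> min \<epsilon> 1" using R1 R by (simp_all add: \<rho>_def)
  have S: "(\<Sum>r<R. S r) \<le> real R * (2 * D)"
  proof -
    have "D * \<rho> \<le> D * 1" using D \<rho> by (intro mult_left_mono) auto
    then have "(\<Sum>r<R. S r) / real R \<le> 2 * D" using mid by (simp add: \<rho>_def abs_le_iff)
    then show ?thesis using R by (simp add: pos_divide_le_eq mult.commute)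
  qed
  have "\<bar>(\<Sum>r<R. T r) - (\<Sum>r<R. S r) - (\<Sum>r<R. S r * \<xi> r)\<bar> = \<bar>\<Sum>r<R. T r - S r - S r * \<xi> r\<bar>"
    by (simp add: sum_subtractf)
  also have "\<dots> \<le> (\<Sum>r<R. 5 * \<rho> * S r)"
    using T by (intro sum_abs[THEN order_trans] sum_mono) (simp add: \<rho>_def)
  also have "\<dots> = 5 * \<rho> * (\<Sum>r<R. S r)" by (simp add: sum_distrib_left)
  also have "\<dots> \<le> 5 * \<rho> * (real R * (2 * D))" using S \<rho> by (intro mult_left_mono) auto
  finally have "\<bar>(\<Sum>r<R. T r) - (\<Sum>r<R. S r) - (\<Sum>r<R. S r * \<xi> r)\<bar> \<le> real R * (10 * \<rho> * D)" by (simp add: mult_ac)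
  moreover have "D / real R = real R * (\<rho> * D)" using R by (simp add: \<rho>_def power2_eq_square)
  ultimately have "\<bar>(\<Sum>r<R. T r) - (\<Sum>r<R. S r)\<bar> \<le> real R * (11 * \<rho> * D)" using lin by (auto simp: abs_le_iff algebra_simps)
  then have "\<bar>(\<Sum>r<R. T r) - (\<Sum>r<R. S r)\<bar> / real R \<le> 11 * \<rho> * D" using R by (simp add: pos_divide_le_eq mult.commute)
  then have "\<bar>E - (\<Sum>r<R. S r) / real R\<bar> \<le> 11 * \<rho> * D" unfolding E_def by (simp add: diff_divide_distrib[symmetric])
  moreover have "\<bar>(\<Sum>r<R. S r) / real R - D\<bar> \<le> \<rho> * D" using mid by (simp add: \<rho>_def)
  moreover have "12 * \<rho> * D = 11 * \<rho> * D + \<rho> * D" by (simp add: algebra_simps)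
  ultimately have "\<bar>E - D\<bar> \<le> 12 * \<rho> * D" by linarith
  also have "\<dots> \<le> (min \<epsilon> 1 / 2) * D" using \<rho> D by (intro mult_right_mono) auto
  finally have *: "\<bar>E - D\<bar> \<le> (min \<epsilon> 1 / 2) * D" .
  define h where "h = (min \<epsilon> 1 / 2) * D"
  have "(1 - min \<epsilon> 1 / 2) * D = D - h" "(1 + min \<epsilon> 1 / 2) * D = D + h" by (simp_all add: algebra_simps h_def)
  moreover have "D - h \<le> E" "E \<le> D + h" using *[folded h_def] by linarith+
  ultimately have ED: "(1 - min \<epsilon> 1 / 2) * D \<le> E" "E \<le> (1 + min \<epsilon> 1 / 2) * D" by simp_all
  have e: "0 < \<epsilon>" using \<rho> by auto
  have "0 \<le> (1 - min \<epsilon> 1 / 2) * D" using D by (intro mult_nonneg_nonneg) auto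
  then have E: "0 \<le> E" using ED by linarith
  \<comment> \<open>The error is known relative to \<open>D\<close> but is wanted relative to
    \<open>E\<close>. For h = min \<epsilon> 1 the conversion rests on (1 - h) * (1 + h / 2) \<le> 1
    \<le> (1 + h) * (1 - h / 2); beyond \<epsilon> = 1 the left side here is not positive.\<close>
  show "(1 - \<epsilon>) * E \<le> D"
  proof (cases "\<epsilon> \<le> 1")
    case True
    have "(1 - \<epsilon>) * E \<le> (1 - \<epsilon>) * ((1 + min \<epsilon> 1 / 2) * D)" using ED True by (intro mult_left_mono) auto
    also have "\<dots> = (1 - \<epsilon> / 2 - \<epsilon> * \<epsilon> / 2) * D" using True by (simp add: field_simps)
    also have "\<dots> \<le> 1 * D"
    proof (rule mult_right_mono[OF _ D])
      have "0 \<le> \<epsilon> * \<epsilon>" by simp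
      then show "1 - \<epsilon> / 2 - \<epsilon> * \<epsilon> / 2 \<le> 1" using e by linarith
    qed
    finally show ?thesis by simp
  next
    case False
    then have "(1 - \<epsilon>) * E \<le> 0" using E by (simp add: mult_le_0_iff)
    then show ?thesis using D by simp
  qed
  let ?e = "min \<epsilon> 1"
  have "1 \<le> (1 + h) * (1 - h / 2)" if "0 \<le> h" "h \<le> 1" for h :: real
  proof -
    have "(1 + h) * (1 - h / 2) = 1 + h * (1 - h) / 2" by (simp add: field_simps)
    then show ?thesis using that by simp
  qed
  then have "1 \<le> (1 + ?e) * (1 - ?e / 2)" using e by auto
  then have "1 * D \<le> (1 + ?e) * (1 - ?e / 2) * D" using D by (intro mult_right_mono) auto
  also have "\<dots> \<le> (1 + ?e) * E" unfolding mult.assoc using ED e by (intro mult_left_mono) auto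
  also have "\<dots> \<le> (1 + \<epsilon>) * E" using E by (intro mult_right_mono) auto
  finally show "D \<le> (1 + \<epsilon>) * E" by simp
qed

section \<open>Distribution of the sketches\<close>

lemma sets_law [measurable_cong]: "sets (law D) = sets borel"
  by (cases D) auto

lemma law_Std_Cauchy: "law Std_Cauchy = density lborel (\<lambda>x. ennreal (cauchy_density 1 x))"
  by (simp add: cauchy_density_def)

lemma prob_space_law: "prob_space (law D)"
proof (cases D)
  case Std_Normal
  then show ?thesis using prob_space_normal_density[of 1 0] by simp
next
  case Chi_Square_1
  interpret N: prob_space "density lborel (\<lambda>x. ennreal (std_normal_density x))"
    using prob_space_normal_density[of 1 0] by simp
  show ?thesis using Chi_Square_1 by (simp add: N.prob_space_distr)
next
  case Std_Cauchy
  then show ?thesis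
    unfolding law_Std_Cauchy
    by (auto intro!: prob_spaceI simp: emeasure_density nn_integral_cauchy_density law_Std_Cauchy simp del: law.simps)
qed

lemma prob_space_tape_measure: "prob_space tape_measure"
  unfolding tape_measure_def by (intro prob_space_PiM) (auto simp: prob_space_law split: prod.split)

lemma sets_tape_measure: "sets tape_measure = sets (PiM UNIV (\<lambda>_. borel))"
  unfolding tape_measure_def by (intro sets_PiM_cong) (auto simp: sets_law split: prod.split)

lemma space_tape_measure: "space tape_measure = UNIV"
  using sets_eq_imp_space_eq[OF sets_tape_measure] by (simp add: space_PiM)

lemma measurable_tape_component [measurable]: "(\<lambda>\<omega>. \<omega> p) \<in> borel_measurable tape_measure"
  unfolding measurable_cong_sets[OF sets_tape_measure refl] by measurable

lemma indep_vars_tape: "prob_space.indep_vars tape_measure (\<lambda>_. borel) (\<lambda>p \<omega>. \<omega> p) UNIV"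
proof -
  interpret prob_space tape_measure by (rule prob_space_tape_measure)
  have "distr tape_measure borel (\<lambda>\<omega>. \<omega> p) = (case p of (D, i) \<Rightarrow> law D)" for p
  proof -
    have "distr tape_measure (case p of (D, i) \<Rightarrow> law D) (\<lambda>\<omega>. \<omega> p) = (case p of (D, i) \<Rightarrow> law D)"
      unfolding tape_measure_def by (intro distr_PiM_component) (auto simp: prob_space_law split: prod.split)
    moreover have "sets (case p of (D, i) \<Rightarrow> law D) = sets borel" by (cases p) (simp add: sets_law)
    ultimately show ?thesis by (simp cong: distr_cong)
  qed
  then have "PiM UNIV (\<lambda>p. distr tape_measure borel (\<lambda>\<omega>. \<omega> p)) = tape_measure"
    by (simp add: tape_measure_def)
  moreover have "distr tape_measure (PiM UNIV (\<lambda>_. borel)) (\<lambda>\<omega>. \<lambda>p\<in>UNIV. \<omega> p) = tape_measure"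
    by (simp add: restrict_UNIV distr_id2 sets_tape_measure)
  ultimately show ?thesis
    by (subst indep_vars_iff_distr_eq_PiM) auto
qed

lemma distributed_tape_Cauchy: "distributed tape_measure lborel (\<lambda>\<omega>. \<omega> (Std_Cauchy, i)) (cauchy_density 1)"
proof -
  have "distr tape_measure (case (Std_Cauchy, i) of (D, i) \<Rightarrow> law D) (\<lambda>\<omega>. \<omega> (Std_Cauchy, i)) = (case (Std_Cauchy, i) of (D, i) \<Rightarrow> law D)"
    unfolding tape_measure_def by (intro distr_PiM_component) (auto simp: prob_space_law split: prod.split)
  then have "distr tape_measure lborel (\<lambda>\<omega>. \<omega> (Std_Cauchy, i)) = density lborel (\<lambda>x. ennreal (cauchy_density 1 x))"
    by (simp add: law_Std_Cauchy sets_law cong: distr_cong del: law.simps)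
  then show ?thesis by (simp add: distributed_def)
qed

definition sketch_diff :: "input_data \<Rightarrow> nat \<Rightarrow> nat \<Rightarrow> nat \<Rightarrow> nat \<Rightarrow> nat \<Rightarrow> tape \<Rightarrow> real" where
  "sketch_diff X R Q j k \<kappa> \<omega> = sketch X R Q \<omega> j \<kappa> - sketch X R Q \<omega> k \<kappa>"

lemma borel_measurable_sketch [measurable]: "(\<lambda>\<omega>. sketch X R Q \<omega> j \<kappa>) \<in> borel_measurable tape_measure"
  unfolding sketch_def piece_sketch_def prefix0_def prefix1_def cauchy_incr_def by measurable

lemma borel_measurable_sketch_diff [measurable]: "sketch_diff X R Q j k \<kappa> \<in> borel_measurable tape_measure"
  unfolding sketch_diff_def by measurable

text \<open>Both components are treated in one induction, since the test on the first decides what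
  happens to the second.\<close>

lemma borel_measurable_root_step:
  assumes [measurable]: "V \<in> borel_measurable M" "T \<in> borel_measurable M"
  shows "(\<lambda>\<omega>. fst ((root_step Q F ^^ n) (V \<omega>, T \<omega>))) \<in> borel_measurable M \<and>
    (\<lambda>\<omega>. snd ((root_step Q F ^^ n) (V \<omega>, T \<omega>))) \<in> borel_measurable M"
proof (induction n)
  case (Suc n)
  then have [measurable]: "(\<lambda>\<omega>. fst ((root_step Q F ^^ n) (V \<omega>, T \<omega>))) \<in> borel_measurable M"
    "(\<lambda>\<omega>. snd ((root_step Q F ^^ n) (V \<omega>, T \<omega>))) \<in> borel_measurable M" by auto
  have fst: "fst (root_step Q F p) = (if fst p < 1 then fst p * F ^ Q else fst p)"
    and snd: "snd (root_step Q F p) = (if fst p < 1 then snd p * F else snd p)" for p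
    by (auto simp: root_step_def split: prod.split)
  show ?case unfolding funpow.simps o_def fst snd by measurable
qed auto

lemma borel_measurable_estimate [measurable]: "(\<lambda>\<omega>. estimate X R Q F \<omega> j k) \<in> borel_measurable tape_measure"
  unfolding estimate_def geo_mean_def Let_def
  by (intro borel_measurable_divide borel_measurable_sum borel_measurable_root_step[THEN conjunct2]) measurable

text \<open>A sketch difference is a linear form in the block \<open>K \<kappa>\<close> of tape
  entries, and the sum of its absolute coefficients is the sketch scale. This gives the Cauchy law
  and the degenerate case. Blocks start at multiples of \<open>num_ends X\<close> and are shorter
  than that, so they are disjoint, which gives independence.\<close>

lemma
  assumes wf: "well_formed X" and jk: "j < num_dens X" "k < num_dens X"
  shows distributed_sketch_diff: "0 < sketch_scale X R j k (\<kappa> div Q) \<Longrightarrow>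
      distributed tape_measure lborel (\<lambda>\<omega>. sketch_diff X R Q j k \<kappa> \<omega> / sketch_scale X R j k (\<kappa> div Q)) (cauchy_density 1)"
    and sketch_diff_zero: "sketch_scale X R j k (\<kappa> div Q) = 0 \<Longrightarrow> sketch_diff X R Q j k \<kappa> \<omega> = 0"
    and indep_sketch_diff: "prob_space.indep_vars tape_measure (\<lambda>_. borel) (sketch_diff X R Q j k) UNIV"
proof -
  interpret prob_space tape_measure by (rule prob_space_tape_measure)
  let ?s = "num_ends X - 1"
  define d where "d \<kappa> i = width X i * ((elem_coef X j 0 i - elem_coef X k 0 i)
      + (elem_coef X j 1 i - elem_coef X k 1 i) * node X R (\<kappa> div Q) i)" for \<kappa> i
  have x: "sketch_diff X R Q j k \<kappa> \<omega> = (\<Sum>i<?s. d \<kappa> i * \<omega> (Std_Cauchy, \<kappa> * num_ends X + i))" for \<kappa> \<omega>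
    unfolding sketch_diff_def sketch_eq[OF wf jk(1)] sketch_eq[OF wf jk(2)] sum_subtractf[symmetric] d_def
    by (intro sum.cong refl) (simp add: algebra_simps)
  have scale: "sketch_scale X R j k (\<kappa> div Q) = (\<Sum>i<?s. \<bar>d \<kappa> i\<bar>)" for \<kappa>
    unfolding sketch_scale_def d_def
  proof (intro sum.cong refl)
    fix i assume "i \<in> {..<?s}"
    then have "0 < width X i" using well_formed_endpt_less(1)[OF wf, of i "Suc i"] by auto
    then show "width X i * \<bar>(elem_coef X j 0 i - elem_coef X k 0 i) + (elem_coef X j 1 i - elem_coef X k 1 i) * node X R (\<kappa> div Q) i\<bar> =
      \<bar>width X i * ((elem_coef X j 0 i - elem_coef X k 0 i) + (elem_coef X j 1 i - elem_coef X k 1 i) * node X R (\<kappa> div Q) i)\<bar>"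
      by (simp add: abs_mult)
  qed
  define K where "K \<kappa> = (\<lambda>i. (Std_Cauchy, \<kappa> * num_ends X + i)) ` {..<?s}" for \<kappa>
  have inj: "inj_on (\<lambda>i. (Std_Cauchy, \<kappa> * num_ends X + i)) {..<?s}" for \<kappa> by (auto simp: inj_on_def)
  define e where "e \<kappa> p = d \<kappa> (snd p - \<kappa> * num_ends X)" for \<kappa> and p :: "std_dist \<times> nat"
  have xK: "sketch_diff X R Q j k \<kappa> \<omega> = (\<Sum>p\<in>K \<kappa>. e \<kappa> p * \<omega> p)" for \<kappa> \<omega>
    unfolding x K_def by (subst sum.reindex[OF inj]) (simp add: e_def)
  have scaleK: "sketch_scale X R j k (\<kappa> div Q) = (\<Sum>p\<in>K \<kappa>. \<bar>e \<kappa> p\<bar>)" for \<kappa>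
    unfolding scale K_def by (subst sum.reindex[OF inj]) (simp add: e_def)
  {
    assume pos: "0 < sketch_scale X R j k (\<kappa> div Q)"
    have "distributed tape_measure lborel (\<lambda>\<omega>. \<Sum>p\<in>K \<kappa>. e \<kappa> p * \<omega> p) (cauchy_density (\<Sum>p\<in>K \<kappa>. \<bar>e \<kappa> p\<bar>))"
    proof (rule linear_comb_indep_cauchy)
      show "finite (K \<kappa>)" by (simp add: K_def)
      show "indep_vars (\<lambda>_. borel) (\<lambda>p \<omega>. \<omega> p) (K \<kappa>)" by (rule indep_vars_subset[OF indep_vars_tape]) auto
      show "distributed tape_measure lborel (\<lambda>\<omega>. \<omega> p) (cauchy_density 1)" if "p \<in> K \<kappa>" for p
        using that distributed_tape_Cauchy by (auto simp: K_def)
      show "0 < (\<Sum>p\<in>K \<kappa>. \<bar>e \<kappa> p\<bar>)" using pos by (simp add: scaleK)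
    qed
    then have "distributed tape_measure lborel (sketch_diff X R Q j k \<kappa>) (cauchy_density (sketch_scale X R j k (\<kappa> div Q)))"
      unfolding xK[abs_def] scaleK .
    from cauchy_scale[OF this pos, of "1 / sketch_scale X R j k (\<kappa> div Q)"] pos
    show "distributed tape_measure lborel (\<lambda>\<omega>. sketch_diff X R Q j k \<kappa> \<omega> / sketch_scale X R j k (\<kappa> div Q)) (cauchy_density 1)"
      by simp
  next
    assume "sketch_scale X R j k (\<kappa> div Q) = 0"
    then have "d \<kappa> i = 0" if "i < ?s" for i
      unfolding scale using that by (simp add: sum_nonneg_eq_0_iff)
    then show "sketch_diff X R Q j k \<kappa> \<omega> = 0" unfolding x by simp
  next
    have disj: "disjoint_family_on K UNIV"
      unfolding disjoint_family_on_def
    proof (intro ballI impI)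
      fix \<kappa> \<kappa>' :: nat assume "\<kappa> \<noteq> \<kappa>'"
      show "K \<kappa> \<inter> K \<kappa>' = {}"
      proof (rule ccontr)
        assume "K \<kappa> \<inter> K \<kappa>' \<noteq> {}"
        then obtain i i' where "i < ?s" "i' < ?s" "\<kappa> * num_ends X + i = \<kappa>' * num_ends X + i'" by (auto simp: K_def)
        then show False using cell_eq_iff[of i "num_ends X" i' \<kappa> \<kappa>'] \<open>\<kappa> \<noteq> \<kappa>'\<close> by auto
      qed
    qed
    \<comment> \<open>Independent coordinates stay independent when grouped into disjoint blocks;
      each sketch difference is then a function of its own block.\<close>
    have "indep_vars (\<lambda>\<kappa>. PiM (K \<kappa>) (\<lambda>_. borel)) (\<lambda>\<kappa> \<omega>. restrict (\<lambda>p. \<omega> p) (K \<kappa>)) UNIV"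
      by (rule indep_vars_restrict[OF indep_vars_tape _ disj]) auto
    then have "indep_vars (\<lambda>_. borel) (\<lambda>\<kappa> \<omega>. \<Sum>p\<in>K \<kappa>. e \<kappa> p * restrict (\<lambda>p. \<omega> p) (K \<kappa>) p) UNIV"
      by (rule indep_vars_compose2[where Y = "\<lambda>\<kappa> \<eta>. \<Sum>p\<in>K \<kappa>. e \<kappa> p * \<eta> p"]) measurable
    moreover have "(\<Sum>p\<in>K \<kappa>. e \<kappa> p * restrict (\<lambda>p. \<omega> p) (K \<kappa>) p) = sketch_diff X R Q j k \<kappa> \<omega>" for \<kappa> \<omega>
      unfolding xK by (intro sum.cong) auto
    ultimately show "indep_vars (\<lambda>_. borel) (sketch_diff X R Q j k) UNIV" by simp
  }
qed

text \<open>The tail events speak about logarithms and do not rule out a vanishing sample, where the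
  logarithm is only a default value. Such samples are removed as a null set.\<close>

lemma AE_nonzero_cauchy:
  assumes "distributed M lborel Y (cauchy_density 1)"
  shows "AE \<omega> in M. Y \<omega> \<noteq> 0"
proof -
  have "AE x in density lborel (\<lambda>x. ennreal (cauchy_density 1 x)). x \<noteq> 0"
    using AE_lborel_singleton[of "0::real"] by (subst AE_density) auto
  then have "AE x in distr M lborel Y. x \<noteq> 0"
    unfolding distributed_distr_eq_density[OF assms] .
  then show ?thesis
    by (rule AE_distrD[OF distributed_measurable[OF assms]])
qed

section \<open>Failure probability\<close>

text \<open>The one-sided bound is applied to the weights and to their negatives, which have the
  same sum of squares; this costs the factor 2.\<close>

lemma (in prob_space) cauchy_log_chernoff_abs:
  assumes c: "0 \<le> c" "\<And>s. \<bar>s\<bar> \<le> 1 / 2 \<Longrightarrow> cauchy_moment s \<le> ennreal (exp (c * s\<^sup>2))"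
  assumes I: "finite I" "indep_vars (\<lambda>_. borel) X I"
  assumes X: "\<And>i. i \<in> I \<Longrightarrow> distributed M lborel (X i) (cauchy_density 1)"
  assumes t: "0 < t" "\<And>i. i \<in> I \<Longrightarrow> \<bar>t * w i\<bar> \<le> 1 / 2"
  assumes e: "c * t\<^sup>2 * (\<Sum>i\<in>I. (w i)\<^sup>2) - t * b \<le> e"
  shows "prob {\<omega>\<in>space M. b \<le> \<bar>\<Sum>i\<in>I. w i * ln \<bar>X i \<omega>\<bar>\<bar>} \<le> 2 * exp e"
proof -
  have [measurable]: "random_variable borel (X i)" if "i \<in> I" for i
    using distributed_measurable[OF X[OF that]] by simp
  let ?U = "\<lambda>w. {\<omega>\<in>space M. b \<le> (\<Sum>i\<in>I. w i * ln \<bar>X i \<omega>\<bar>)}"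
  have U: "prob (?U w') \<le> exp e" if "w' = w \<or> w' = (\<lambda>i. - w i)" for w'
  proof -
    have "prob (?U w') \<le> exp (c * t\<^sup>2 * (\<Sum>i\<in>I. (w' i)\<^sup>2) - t * b)"
      using that t by (intro cauchy_log_chernoff c I X) auto
    also have "\<dots> \<le> exp e" using that e by auto
    finally show ?thesis .
  qed
  have "prob {\<omega>\<in>space M. b \<le> \<bar>\<Sum>i\<in>I. w i * ln \<bar>X i \<omega>\<bar>\<bar>} \<le> prob (?U w \<union> ?U (\<lambda>i. - w i))"
    by (intro finite_measure_mono) (auto simp: sum_negf abs_if)
  also have "\<dots> \<le> prob (?U w) + prob (?U (\<lambda>i. - w i))"
    by (intro measure_Un_le) auto
  also have "\<dots> \<le> exp e + exp e" by (intro add_mono U) auto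
  finally show ?thesis by simp
qed

definition pair_ok :: "real \<Rightarrow> real \<Rightarrow> real \<Rightarrow> bool" where
  "pair_ok \<epsilon> D E \<longleftrightarrow> (1 - \<epsilon>) * E \<le> D \<and> D \<le> (1 + \<epsilon>) * E"

text \<open>The deterministic core, for one fixed tape. Positions of scale 0 are split off because
  normalisation is impossible there; they contribute exactly 0 to both the estimate and the average
  scale.\<close>

lemma pair_okI:
  fixes \<omega> :: tape
  assumes d: "describes 1 X f" and jk: "j < num_dens X" "k < num_dens X"
    and R: "2 \<le> R" "24 \<le> real (R * R) * min \<epsilon> 1" and Q: "1 \<le> Q"
  defines "D \<equiv> L1_dist (f j) (f k)"
  defines "Y \<equiv> \<lambda>r q. sketch_diff X R Q j k (r * Q + q) \<omega> / sketch_scale X R j k r"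
  defines "A \<equiv> {r. r < R \<and> 0 < sketch_scale X R j k r}"
  assumes nz: "\<And>r q. r \<in> A \<Longrightarrow> q < Q \<Longrightarrow> Y r q \<noteq> 0"
    and lin: "\<bar>\<Sum>r\<in>A. \<Sum>q<Q. sketch_scale X R j k r / real Q * ln \<bar>Y r q\<bar>\<bar> \<le> D / real R"
    and dev: "\<And>r. r \<in> A \<Longrightarrow> \<bar>\<Sum>q<Q. 1 / real Q * ln \<bar>Y r q\<bar>\<bar> \<le> 1 / real R"
    and start: "\<And>r. r \<in> A \<Longrightarrow> \<bar>ln \<bar>Y r 0\<bar>\<bar> \<le> real Q / (2 * (real R)\<^sup>2) - 1"
  shows "pair_ok \<epsilon> D (estimate X R Q (1 + 1 / (real R)\<^sup>2) \<omega> j k)"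
proof -
  have wf: "well_formed X" using d by (simp add: describes_def)
  let ?S = "sketch_scale X R j k" and ?F = "1 + 1 / (real R)\<^sup>2"
  define T where "T r = geo_mean Q ?F (\<lambda>q. sketch_diff X R Q j k (r * Q + q) \<omega>)" for r
  define \<xi> where "\<xi> r = (if r \<in> A then (\<Sum>q<Q. ln \<bar>Y r q\<bar>) / real Q else 0)" for r
  have R1: "1 \<le> R" using R by simp
  note S = sketch_scale_approximates_L1[OF d jk R1]
  have notA: "?S r = 0" "sketch_diff X R Q j k (r * Q + q) \<omega> = 0" if "r < R" "r \<notin> A" "q < Q" for r q
  proof -
    show "?S r = 0" using that S(2)[of r] by (auto simp: A_def)
    then show "sketch_diff X R Q j k (r * Q + q) \<omega> = 0"
      using sketch_diff_zero[OF wf jk, of R "r * Q + q" Q \<omega>] that by simp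
  qed
  have Td: "\<bar>T r - ?S r - ?S r * \<xi> r\<bar> \<le> 5 * ?S r / (real R)\<^sup>2" if r: "r < R" for r
  proof (cases "r \<in> A")
    case True
    then have "0 < ?S r" by (simp add: A_def)
    then have T: "T r = geo_mean Q ?F (\<lambda>q. ?S r * Y r q)" by (simp add: T_def Y_def)
    have \<xi>: "\<xi> r = (\<Sum>q<Q. ln \<bar>Y r q\<bar>) / real Q" using True by (simp add: \<xi>_def)
    have "\<bar>(\<Sum>q<Q. ln \<bar>Y r q\<bar>) / real Q\<bar> \<le> 1 / real R"
      using dev[OF True] by (simp add: sum_divide_distrib)
    then show ?thesis
      unfolding T \<xi> using True by (intro geo_mean_first_order R Q nz start \<open>0 < ?S r\<close>)
  next
    case False
    have "T r = 0" unfolding T_def using notA(2)[OF r False, of 0] Q by (intro geo_mean_zero) simp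
    then show ?thesis using notA(1)[OF r False, of 0] Q by simp
  qed
  have "(\<Sum>r<R. ?S r * \<xi> r) = (\<Sum>r\<in>A. ?S r * \<xi> r)"
    by (rule sum.mono_neutral_right) (auto simp: A_def \<xi>_def)
  also have "\<dots> = (\<Sum>r\<in>A. \<Sum>q<Q. ?S r / real Q * ln \<bar>Y r q\<bar>)"
    by (intro sum.cong refl) (simp add: \<xi>_def sum_distrib_left sum_divide_distrib)
  finally have lin': "\<bar>\<Sum>r<R. ?S r * \<xi> r\<bar> \<le> D / real R" using lin by simp
  have "0 \<le> D" by (simp add: D_def L1_dist_def)
  then show ?thesis
    using combine_errors[OF R1 _ R(2) S(1)[folded D_def] lin' Td]
    by (simp add: pair_ok_def estimate_def T_def sketch_diff_def)
qed

text \<open>Absorbs the union bound over the R node positions: their individual failure exponents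
  carry a factor \<open>R\<close>, and what is left after summation is a bound of the same order as
  for the averaged error.\<close>

lemma mult_exp_decreasing:
  fixes y :: real
  assumes "1 \<le> R" "1 \<le> y"
  shows "real R * exp (- (real R * y)) \<le> exp (- y)"
proof -
  have "real R \<le> exp (real R - 1)" using exp_ge_add_one_self[of "real R - 1"] by simp
  then have "real R * exp (- (real R * y)) \<le> exp (real R - 1) * exp (- (real R * y))" by (intro mult_right_mono) auto
  also have "\<dots> = exp ((real R - 1) - real R * y)" by (simp add: mult_exp_exp)
  also have "(real R - 1) - real R * y \<le> - y"
  proof -
    have "0 \<le> (real R - 1) * (y - 1)" using assms by (intro mult_nonneg_nonneg) auto
    then show ?thesis by (simp add: algebra_simps)
  qed
  finally show ?thesis by simp
qed

text \<open>The prefactor of \<open>exp (- y)\<close> in the union bound: 2 from the averaged error,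
  2 from the deviations at all nodes together, and \<open>2 * exp (c / 4 + 1 / 2)\<close> from all
  starting points.\<close>

definition fail_const :: "real \<Rightarrow> real" where
  "fail_const c = 4 + 2 * exp (c / 4 + 1 / 2)"

text \<open>
  Three kinds of bad events, each bounded by the Chernoff inequality: \<open>E1\<close>, the linearised error of
  the average of the geometric means is large; \<open>E2 r\<close>, the relative error at node \<open>r\<close> exceeds
  \<open>1 / R\<close>, so that the quadratic term is not negligible; \<open>E3 r\<close>, the root search starts too far off.
\<close>

lemma pair_failure:
  assumes c: "1 \<le> c" "\<And>s. \<bar>s\<bar> \<le> 1 / 2 \<Longrightarrow> cauchy_moment s \<le> ennreal (exp (c * s\<^sup>2))"
    and K: "64 * c * (ln 4 + ln (fail_const c)) \<le> real K"
    and d: "describes 1 X f" and jk: "j < num_dens X" "k < num_dens X"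
    and R: "2 \<le> R" "24 \<le> real (R * R) * min \<epsilon> 1" and L: "1 \<le> L" and Q: "Q = R * R * R * L * K"
  shows "measure tape_measure {\<omega>\<in>space tape_measure. \<not> pair_ok \<epsilon> (L1_dist (f j) (f k)) (estimate X R Q (1 + 1 / (real R)\<^sup>2) \<omega> j k)} \<le> (1 / 4) ^ L"
proof -
  interpret prob_space tape_measure by (rule prob_space_tape_measure)
  have wf: "well_formed X" using d by (simp add: describes_def)
  define D where "D = L1_dist (f j) (f k)"
  define S where "S = sketch_scale X R j k"
  define Y where "Y \<kappa> \<omega> = sketch_diff X R Q j k \<kappa> \<omega> / S (\<kappa> div Q)" for \<kappa> \<omega>
  define A where "A = {r. r < R \<and> 0 < S r}"
  let ?bad = "{\<omega>\<in>space tape_measure. \<not> pair_ok \<epsilon> D (estimate X R Q (1 + 1 / (real R)\<^sup>2) \<omega> j k)}"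
  have ln4: "1 \<le> ln (4 :: real)"
  proof -
    have "exp (1 :: real) \<le> 4" using exp_le by linarith
    then show ?thesis by (subst ln_ge_iff) auto
  qed
  have B: "4 \<le> fail_const c" by (simp add: fail_const_def)
  then have lnB: "0 < ln (fail_const c)" by simp
  \<comment> \<open>\<open>y\<close> is the common exponent, with Q = 64 * c * y * R^3. The choice
    of \<open>K\<close> makes \<open>y\<close> so large that \<open>fail_const c * exp (- y)\<close>
    drops to (1/4)^L.\<close>
  define y where "y = real K * real L / (64 * c)"
  have y: "real L * ln 4 + ln (fail_const c) \<le> y"
  proof -
    have "ln 4 + ln (fail_const c) \<le> real K / (64 * c)" using K c by (simp add: pos_le_divide_eq mult.commute)
    then have "real L * (ln 4 + ln (fail_const c)) \<le> real L * (real K / (64 * c))" by (intro mult_left_mono) auto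
    moreover have "1 * ln (fail_const c) \<le> real L * ln (fail_const c)" using L lnB by (intro mult_right_mono) auto
    ultimately show ?thesis by (simp add: y_def algebra_simps)
  qed
  have "1 * 1 \<le> real L * ln 4" using L ln4 by (intro mult_mono) auto
  then have y1: "1 \<le> y" using y lnB by linarith
  have Kpos: "0 < K" using y1 c by (cases K) (auto simp: y_def)
  have Q1: "1 \<le> Q" using Kpos R L by (simp add: Q Suc_le_eq)
  have Rr: "2 \<le> real R" using R by simp
  have KL: "real K * real L = 64 * c * y" using c by (simp add: y_def)
  have QR: "real Q = (real R) ^ 3 * (64 * c * y)" by (simp add: Q power3_eq_cube flip: KL)
  note sc = sketch_scale_approximates_L1[OF d jk, of R, folded D_def S_def]
  have S4: "S r \<le> 4 * D" if "r < R" for r using sc(3)[of r] that R by simp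
  have divQ: "(r * Q + q) div Q = r" if "q < Q" for r q using that by simp
  have indep: "indep_vars (\<lambda>_. borel) Y UNIV"
    unfolding Y_def using indep_sketch_diff[OF wf jk, of R Q] by (rule indep_vars_compose2[where Y = "\<lambda>\<kappa> x. x / S (\<kappa> div Q)"]) auto
  have dist: "distributed tape_measure lborel (Y \<kappa>) (cauchy_density 1)" if "0 < S (\<kappa> div Q)" for \<kappa>
    unfolding Y_def[abs_def] S_def using that[unfolded S_def] by (rule distributed_sketch_diff[OF wf jk])
  have fin: "finite A" by (simp add: A_def)
  have meas [measurable]: "random_variable borel (Y \<kappa>)" for \<kappa> unfolding Y_def by measurable
  show ?thesis
  \<comment> \<open>For D = 0 every scale is at most 4 * D = 0, so every tape gives a correct
    estimate. The Chernoff parameter for the averaged error divides by \<open>D\<close>.\<close>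
  proof (cases "D = 0")
    case True
    have "A = {}" using S4 True by (fastforce simp: A_def)
    then have A0: "{r. r < R \<and> 0 < sketch_scale X R j k r} = {}" unfolding A_def S_def .
    have "pair_ok \<epsilon> D (estimate X R Q (1 + 1 / (real R)\<^sup>2) \<omega> j k)" for \<omega>
      unfolding D_def by (rule pair_okI[OF d jk R Q1], unfold A0) (use True in \<open>auto simp: D_def\<close>)
    then have "?bad = {}" by simp
    then show ?thesis unfolding D_def by (simp only: measure_empty) simp
  next
    case False
    have "0 \<le> D" by (simp add: D_def L1_dist_def)
    then have D: "0 < D" using False by simp
    define I where "I = (\<lambda>(r, q). r * Q + q) ` (A \<times> {..<Q})"
    have inj: "inj_on (\<lambda>(r, q). r * Q + q) (A \<times> {..<Q})"
      by (auto simp: inj_on_def cell_eq_iff)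
    have sumI: "(\<Sum>\<kappa>\<in>I. g \<kappa>) = (\<Sum>r\<in>A. \<Sum>q<Q. g (r * Q + q))" for g :: "nat \<Rightarrow> real"
      unfolding I_def sum.reindex[OF inj] by (simp add: sum.cartesian_product o_def case_prod_beta)
    have finI: "finite I" using fin by (simp add: I_def)
    have IS: "0 < S (\<kappa> div Q)" "\<kappa> div Q < R" if "\<kappa> \<in> I" for \<kappa> using that by (auto simp: I_def divQ A_def)
    define w where "w \<kappa> = S (\<kappa> div Q) / real Q" for \<kappa>
    define E1 where "E1 = {\<omega>\<in>space tape_measure. D / real R \<le> \<bar>\<Sum>\<kappa>\<in>I. w \<kappa> * ln \<bar>Y \<kappa> \<omega>\<bar>\<bar>}"
    define E2 where "E2 r = {\<omega>\<in>space tape_measure. 1 / real R \<le> \<bar>\<Sum>\<kappa>\<in>(\<lambda>q. r * Q + q) ` {..<Q}. 1 / real Q * ln \<bar>Y \<kappa> \<omega>\<bar>\<bar>}" for r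
    define E3 where "E3 r = {\<omega>\<in>space tape_measure. real Q / (2 * (real R)\<^sup>2) - 1 \<le> \<bar>\<Sum>\<kappa>\<in>{r * Q}. 1 * ln \<bar>Y \<kappa> \<omega>\<bar>\<bar>}" for r
    have [measurable]: "E1 \<in> events" "E2 r \<in> events" "E3 r \<in> events" for r
      unfolding E1_def E2_def E3_def by measurable
    have P1: "prob E1 \<le> 2 * exp (- y)"
      unfolding E1_def
    \<comment> \<open>This \<open>t\<close> minimises c * t^2 * v - t * D / R for the bound v = 16 *
      R * D^2 / Q on the sum of squared weights. The minimum is - Q / (64 * c * R^3) = - y, which is
      the origin of the 64.\<close>
    proof (rule cauchy_log_chernoff_abs[where c = c and t = "real Q / (32 * c * (real R)\<^sup>2 * D)"])
      show "indep_vars (\<lambda>_. borel) Y I" by (rule indep_vars_subset[OF indep]) auto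
      show "0 < real Q / (32 * c * (real R)\<^sup>2 * D)" using Q1 c D R by simp
      show "\<bar>real Q / (32 * c * (real R)\<^sup>2 * D) * w \<kappa>\<bar> \<le> 1 / 2" if "\<kappa> \<in> I" for \<kappa>
      proof -
        have "real Q / (32 * c * (real R)\<^sup>2 * D) * w \<kappa> = S (\<kappa> div Q) / (32 * c * (real R)\<^sup>2 * D)"
          using Q1 by (simp add: w_def)
        also have "\<dots> \<le> 4 * D / (32 * c * (real R)\<^sup>2 * D)"
          using S4[OF IS(2)[OF that]] c D R by (intro divide_right_mono) auto
        also have "\<dots> = 1 / (8 * (c * (real R)\<^sup>2))" using D by simp
        also have "\<dots> \<le> 1 / (8 * 1)"
        proof -
          have "1 * 1 \<le> c * (real R)\<^sup>2" using c Rr by (intro mult_mono) auto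
          then show ?thesis by (intro divide_left_mono) auto
        qed
        finally have "real Q / (32 * c * (real R)\<^sup>2 * D) * w \<kappa> \<le> 1 / 2" by simp
        moreover have "0 \<le> real Q / (32 * c * (real R)\<^sup>2 * D) * w \<kappa>"
          using IS(1)[OF that] c D by (simp add: w_def)
        ultimately show ?thesis by (simp only: abs_of_nonneg)
      qed
      have "(\<Sum>\<kappa>\<in>I. (w \<kappa>)\<^sup>2) = (\<Sum>r\<in>A. \<Sum>q<Q. (S r / real Q)\<^sup>2)"
        unfolding sumI w_def by (intro sum.cong refl) (simp add: divQ)
      also have "\<dots> = (\<Sum>r\<in>A. (S r)\<^sup>2 / real Q)" using Q1 by (simp add: power2_eq_square)
      also have "\<dots> \<le> (\<Sum>r\<in>A. (4 * D)\<^sup>2 / real Q)"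
        using S4 by (intro sum_mono divide_right_mono power_mono) (auto simp: A_def)
      also have "\<dots> = real (card A) * (16 * D\<^sup>2 / real Q)" by (simp add: power_mult_distrib)
      also have "\<dots> \<le> real R * (16 * D\<^sup>2 / real Q)"
      proof -
        have "card A \<le> card {..<R}" by (intro card_mono) (auto simp: A_def)
        then show ?thesis by (intro mult_right_mono) auto
      qed
      finally have w2: "(\<Sum>\<kappa>\<in>I. (w \<kappa>)\<^sup>2) \<le> real R * (16 * D\<^sup>2 / real Q)" .
      let ?t = "real Q / (32 * c * (real R)\<^sup>2 * D)"
      have "c * ?t\<^sup>2 * (\<Sum>\<kappa>\<in>I. (w \<kappa>)\<^sup>2) \<le> c * ?t\<^sup>2 * (real R * (16 * D\<^sup>2 / real Q))"
        using w2 c by (intro mult_left_mono) auto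
      also have "\<dots> = y"
        unfolding QR using c D Rr y1 by (simp add: power2_eq_square power3_eq_cube)
      finally have "c * ?t\<^sup>2 * (\<Sum>\<kappa>\<in>I. (w \<kappa>)\<^sup>2) \<le> y" .
      moreover have "?t * (D / real R) = 2 * y"
        unfolding QR using c D Rr by (simp add: power2_eq_square power3_eq_cube)
      ultimately show "c * ?t\<^sup>2 * (\<Sum>\<kappa>\<in>I. (w \<kappa>)\<^sup>2) - ?t * (D / real R) \<le> - y" by simp
    qed (use c finI dist IS in auto)
    have P2: "prob (E2 r) \<le> 2 * exp (- (real R * y))" if "r \<in> A" for r
      unfolding E2_def
    \<comment> \<open>Again the minimiser, now of c * t^2 / Q - t / R; the exponent is - 16 * R * y,
      of which - R * y is kept.\<close>
    proof (rule cauchy_log_chernoff_abs[where c = c and t = "real Q / (2 * c * real R)"])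
      show "indep_vars (\<lambda>_. borel) Y ((\<lambda>q. r * Q + q) ` {..<Q})" by (rule indep_vars_subset[OF indep]) auto
      show "distributed tape_measure lborel (Y \<kappa>) (cauchy_density 1)" if "\<kappa> \<in> (\<lambda>q. r * Q + q) ` {..<Q}" for \<kappa>
        using that \<open>r \<in> A\<close> by (intro dist) (auto simp: divQ A_def)
      show "0 < real Q / (2 * c * real R)" using Q1 c R by simp
      have "1 * 1 \<le> c * real R" using c Rr by (intro mult_mono) auto
      then show "\<bar>real Q / (2 * c * real R) * (1 / real Q)\<bar> \<le> 1 / 2" using Q1 c by (simp add: abs_mult field_simps)
      have sq: "(\<Sum>\<kappa>\<in>(\<lambda>q. r * Q + q) ` {..<Q}. (1 / real Q)\<^sup>2) = 1 / real Q"
        by (subst sum.reindex) (auto simp: inj_on_def power2_eq_square)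
      have e1: "c * (real Q / (2 * c * real R))\<^sup>2 * (1 / real Q) = 16 * (real R * y)"
        unfolding QR using c Rr y1 by (simp add: power2_eq_square power3_eq_cube)
      have e2: "real Q / (2 * c * real R) * (1 / real R) = 32 * (real R * y)"
        unfolding QR using c Rr by (simp add: power2_eq_square power3_eq_cube)
      have "0 \<le> real R * y" using y1 by simp
      then show "c * (real Q / (2 * c * real R))\<^sup>2 * (\<Sum>\<kappa>\<in>(\<lambda>q. r * Q + q) ` {..<Q}. (1 / real Q)\<^sup>2)
          - real Q / (2 * c * real R) * (1 / real R) \<le> - (real R * y)"
        unfolding sq e1 e2 by linarith
    qed (use c in auto)
    have P3: "prob (E3 r) \<le> 2 * exp (c / 4 + 1 / 2 - real R * y)" if "r \<in> A" for r
      unfolding E3_def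
    \<comment> \<open>A single logarithm has only an exponential tail, so the largest admissible
      parameter is taken. It suffices because the threshold is about 32 * c * R * y.\<close>
    proof (rule cauchy_log_chernoff_abs[where c = c and t = "1 / 2"])
      show "indep_vars (\<lambda>_. borel) Y {r * Q}" by (rule indep_vars_subset[OF indep]) auto
      show "distributed tape_measure lborel (Y \<kappa>) (cauchy_density 1)" if "\<kappa> \<in> {r * Q}" for \<kappa>
        using that \<open>r \<in> A\<close> divQ[of 0 r] Q1 by (intro dist) (auto simp: A_def)
      have "real Q / (2 * (real R)\<^sup>2) = 32 * (c * (real R * y))"
        unfolding QR using Rr by (simp add: power2_eq_square power3_eq_cube)
      moreover have "1 * (real R * y) \<le> c * (real R * y)" using c y1 by (intro mult_right_mono) auto
      moreover have "0 \<le> real R * y" using y1 by simp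
      ultimately have b3: "2 * (real R * y) \<le> real Q / (2 * (real R)\<^sup>2)" by linarith
      have sq: "c * (1 / 2)\<^sup>2 * (\<Sum>\<kappa>\<in>{r * Q}. 1\<^sup>2) = c / 4" by (simp add: power2_eq_square)
      have aux: "v - 1 / 2 * (b - 1) \<le> v + 1 / 2 - x" if "2 * x \<le> b" for v b x :: real
        using that by (simp add: field_simps)
      show "c * (1 / 2)\<^sup>2 * (\<Sum>\<kappa>\<in>{r * Q}. 1\<^sup>2) - 1 / 2 * (real Q / (2 * (real R)\<^sup>2) - 1) \<le> c / 4 + 1 / 2 - real R * y"
        unfolding sq by (rule aux[OF b3])
    qed (use c in auto)
    let ?E = "E1 \<union> (\<Union>r\<in>A. E2 r \<union> E3 r)"
    have ok: "pair_ok \<epsilon> D (estimate X R Q (1 + 1 / (real R)\<^sup>2) \<omega> j k)"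
      if nz: "\<And>\<kappa>. \<kappa> \<in> I \<Longrightarrow> Y \<kappa> \<omega> \<noteq> 0" and "\<omega> \<notin> ?E" for \<omega>
    proof -
      have \<omega>: "\<omega> \<in> space tape_measure" by (simp add: space_tape_measure)
      have Y': "sketch_diff X R Q j k (r * Q + q) \<omega> / sketch_scale X R j k r = Y (r * Q + q) \<omega>" if "q < Q" for r q
        by (simp add: Y_def S_def divQ[OF that])
      show ?thesis
        unfolding D_def
      proof (rule pair_okI[OF d jk R Q1], goal_cases)
        case (1 r q)
        then have "r * Q + q \<in> I" by (auto simp: I_def A_def S_def)
        then show ?case using nz 1 by (simp add: Y')
      next
        case 2
        have "\<bar>\<Sum>r\<in>A. \<Sum>q<Q. S r / real Q * ln \<bar>Y (r * Q + q) \<omega>\<bar>\<bar> \<le> D / real R"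
          using that(2) \<omega> unfolding E1_def sumI w_def by (simp add: divQ)
        moreover have "(\<Sum>r\<in>A. \<Sum>q<Q. S r / real Q * ln \<bar>Y (r * Q + q) \<omega>\<bar>) =
            (\<Sum>r\<in>A. \<Sum>q<Q. sketch_scale X R j k r / real Q * ln \<bar>sketch_diff X R Q j k (r * Q + q) \<omega> / sketch_scale X R j k r\<bar>)"
          by (intro sum.cong refl) (simp only: Y' lessThan_iff S_def)
        ultimately show ?case by (simp only: A_def S_def D_def)
      next
        case (3 r)
        then have r: "r \<in> A" by (simp add: A_def S_def)
        have "\<bar>\<Sum>q<Q. 1 / real Q * ln \<bar>Y (r * Q + q) \<omega>\<bar>\<bar> \<le> 1 / real R"
          using that(2) \<omega> r unfolding E2_def by (subst (asm) sum.reindex) (auto simp: inj_on_def)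
        then show ?case by (simp add: Y')
      next
        case (4 r)
        then have r: "r \<in> A" by (simp add: A_def S_def)
        then have "\<bar>ln \<bar>Y (r * Q) \<omega>\<bar>\<bar> \<le> real Q / (2 * (real R)\<^sup>2) - 1"
          using that(2) \<omega> unfolding E3_def by auto
        then show ?case using Y'[of 0 r] Q1 by simp
      qed
    qed
    have "AE \<omega> in tape_measure. \<forall>\<kappa>\<in>I. Y \<kappa> \<omega> \<noteq> 0"
      by (intro AE_finite_allI[OF finI] AE_nonzero_cauchy dist IS)
    then have "AE \<omega> in tape_measure. \<omega> \<in> ?bad \<longrightarrow> \<omega> \<in> ?E"
      by eventually_elim (use ok in blast)
    then have "prob ?bad \<le> prob ?E"
      using fin by (intro finite_measure_mono_AE) auto
    also have "\<dots> \<le> prob E1 + prob (\<Union>r\<in>A. E2 r \<union> E3 r)"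
      using fin by (intro measure_Un_le) auto
    also have "prob (\<Union>r\<in>A. E2 r \<union> E3 r) \<le> (\<Sum>r\<in>A. prob (E2 r \<union> E3 r))"
      using fin by (intro finite_measure_subadditive_finite) auto
    also have "\<dots> \<le> (\<Sum>r\<in>A. (2 + 2 * exp (c / 4 + 1 / 2)) * exp (- (real R * y)))"
    proof (rule sum_mono)
      fix r assume r: "r \<in> A"
      have "prob (E2 r \<union> E3 r) \<le> prob (E2 r) + prob (E3 r)" by (intro measure_Un_le) auto
      also have "\<dots> \<le> 2 * exp (- (real R * y)) + 2 * exp (c / 4 + 1 / 2 - real R * y)" by (intro add_mono P2 P3 r)
      also have "exp (c / 4 + 1 / 2 - real R * y) = exp (c / 4 + 1 / 2) * exp (- (real R * y))"
        by (simp only: mult_exp_exp) simp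
      finally show "prob (E2 r \<union> E3 r) \<le> (2 + 2 * exp (c / 4 + 1 / 2)) * exp (- (real R * y))"
        by (simp add: algebra_simps)
    qed
    also have "\<dots> = real (card A) * ((2 + 2 * exp (c / 4 + 1 / 2)) * exp (- (real R * y)))" by simp
    also have "\<dots> \<le> real R * ((2 + 2 * exp (c / 4 + 1 / 2)) * exp (- (real R * y)))"
    proof (rule mult_right_mono)
      have "card A \<le> card {..<R}" by (intro card_mono) (auto simp: A_def)
      then show "real (card A) \<le> real R" by simp
    qed (auto intro: add_nonneg_nonneg)
    also have "\<dots> = (2 + 2 * exp (c / 4 + 1 / 2)) * (real R * exp (- (real R * y)))" by simp
    also have "\<dots> \<le> (2 + 2 * exp (c / 4 + 1 / 2)) * exp (- y)"
      using mult_exp_decreasing[of R y] R y1 by (intro mult_left_mono) (auto intro: add_nonneg_nonneg)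
    finally have "prob ?bad \<le> fail_const c * exp (- y)"
      using P1 by (simp add: fail_const_def algebra_simps)
    also have "\<dots> \<le> fail_const c * exp (- (real L * ln 4 + ln (fail_const c)))"
      using y B by (intro mult_left_mono) auto
    also have "\<dots> = fail_const c * (exp (- (real L * ln 4)) * exp (- ln (fail_const c)))"
      by (simp only: minus_add_distrib exp_add)
    also have "\<dots> = exp (- (real L * ln 4))"
      using B by (simp add: exp_minus[of "ln (fail_const c)"])
    also have "\<dots> = (1 / 4) ^ L"
      by (simp add: exp_minus exp_of_nat_mult power_one_over inverse_eq_divide)
    finally show ?thesis unfolding D_def .
  qed
qed

section \<open>The operation count\<close>

lemma num_ends_le:
  assumes "well_formed X"
  shows "num_ends X \<le> 2 * (num_dens X * num_pieces X)"
proof -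
  let ?P = "{..<num_dens X} \<times> {..<num_pieces X}"
  have "{..<num_ends X} = (\<Union>j<num_dens X. \<Union>l<num_pieces X. {left_ix X j l, right_ix X j l})"
    using assms unfolding well_formed_def by blast
  also have "\<dots> = (\<lambda>(j, l). left_ix X j l) ` ?P \<union> (\<lambda>(j, l). right_ix X j l) ` ?P" by auto
  finally have "card {..<num_ends X} \<le> card ((\<lambda>(j, l). left_ix X j l) ` ?P) + card ((\<lambda>(j, l). right_ix X j l) ` ?P)"
    by (simp only: card_Un_le)
  also have "\<dots> \<le> card ?P + card ?P" by (intro add_mono card_image_le) auto
  finally show ?thesis by simp
qed

text \<open>Without pieces a density would vanish identically and could not have integral 1.
  Lower-order terms of the operation count can therefore be charged to m * n.\<close>

lemma num_pieces_pos:
  assumes "describes 1 X f" "0 < num_dens X" "\<forall>j<num_dens X. prob_density (f j)"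
  shows "0 < num_pieces X"
proof (rule ccontr)
  assume "\<not> 0 < num_pieces X"
  then have "f 0 = (\<lambda>_. 0)" using assms(1,2) by (auto simp: describes_def)
  moreover have "has_bochner_integral lborel (f 0) 1" using assms(2,3) by (simp add: prob_density_def)
  ultimately have "has_bochner_integral lborel (\<lambda>_::real. 0::real) 1" by simp
  then show False using has_bochner_integral_eq[OF _ has_bochner_integral_zero] by fastforce
qed

text \<open>Two quantities dominate: m * n * R * Q for computing the sketches, where the number of
  endpoints is replaced by 2 * m * n, and m^2 * R * Q for combining the pairs. Everything else is
  absorbed because all factors are at least 1.\<close>

lemma L1_prog_time_le:
  assumes m: "1 \<le> num_dens X" and n: "1 \<le> num_pieces X" and s: "num_ends X \<le> 2 * (num_dens X * num_pieces X)"
    and R: "1 \<le> grid_size \<epsilon>" and L: "1 \<le> conf_bits (num_dens X) \<delta>" and K: "1 \<le> K"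
  shows "L1_prog_time K X \<delta> \<epsilon> \<le> 176 * (num_dens X * (num_dens X + num_pieces X) *
    (grid_size \<epsilon> * sample_size K (num_dens X) \<delta> \<epsilon>))"
proof -
  define m n s R L Q where defs: "m = num_dens X" "n = num_pieces X" "s = num_ends X" "R = grid_size \<epsilon>"
    "L = conf_bits m \<delta>" "Q = sample_size K m \<delta> \<epsilon>"
  have pos: "1 \<le> m" "1 \<le> n" "1 \<le> R" "1 \<le> L" using assms by (simp_all add: defs)
  have Q: "Q = R * R * R * L * K" by (simp add: defs sample_size_def)
  define a where "a = R * Q"
  have a: "a = R * R * R * R * L * K" by (simp add: a_def Q)
  have a0: "0 < a" "0 < Q" using pos K by (simp_all add: a Q Suc_le_eq)
  have le_a: "1 \<le> a" "R \<le> a" "L \<le> a" "Q \<le> a"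
    using a0 by (auto intro!: dvd_imp_le simp: a_def Q)
  define u v where "u = m * n * a" and "v = m * m * a"
  have u: "a \<le> u" "m * a \<le> u" using pos a0 by (auto intro!: dvd_imp_le simp: u_def)
  have v: "m \<le> v" "m * m \<le> v" "m * m * R \<le> v" "a \<le> v" using pos a0 by (auto intro!: dvd_imp_le simp: v_def a_def)
  have sa: "s * a \<le> 2 * u" using mult_le_mono1[OF s, of a] by (simp add: defs u_def mult_ac)
  have W: "m * (m + n) * a = u + v" by (simp add: u_def v_def algebra_simps)
  have T: "L1_prog_time K X \<delta> \<epsilon> = 31 + R * 15 + L * 3 + Q * 3 + a * 10 + 15 * (s * a) + 10 * (m * a) + 20 * u
      + 4 * m + 10 * (m * m) + 19 * (m * m * R) + 21 * v"
    unfolding L1_prog_time_def Let_def defs(1-4)[symmetric] defs(5,6)[symmetric]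
    by (simp add: a_def u_def v_def algebra_simps)
  \<comment> \<open>The terms charged to \<open>u\<close> add up to 62 + 40 + 20 = 122, those
    charged to \<open>v\<close> to 33 + 21 = 54; 176 is the sum of both.\<close>
  have sum: "31 + R * 15 + L * 3 + Q * 3 + a * 10 + 15 * p + 10 * q + 20 * u + 4 * m + 10 * w + 19 * z + 21 * v \<le> 176 * (u + v)"
    if "p \<le> 2 * u" "q \<le> u" "w \<le> v" "z \<le> v" for p q w z
  proof -
    have "31 + R * 15 + L * 3 + Q * 3 + a * 10 \<le> 62 * a" using le_a by linarith
    moreover have "15 * p + 10 * q \<le> 40 * u" using that by linarith
    moreover have "4 * m + 10 * w + 19 * z \<le> 33 * v" using v(1) that by linarith
    ultimately have "31 + R * 15 + L * 3 + Q * 3 + a * 10 + 15 * p + 10 * q + 20 * u + 4 * m + 10 * w + 19 * z + 21 * v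
        \<le> 122 * u + 54 * v"
      using u(1) by linarith
    also have "\<dots> \<le> 176 * (u + v)" by simp
    finally show ?thesis .
  qed
  show ?thesis
    unfolding T defs(1,2,4)[symmetric] defs(6)[symmetric] a_def[symmetric] W
    by (intro sum sa u v)
qed

theorem theorem4p1:
  shows "\<exists>(P :: prog) (C :: real).
    \<forall>(X :: input_data) (f :: nat \<Rightarrow> real \<Rightarrow> real) (\<delta> :: real) (\<epsilon> :: real) (m :: nat) (n :: nat).
      m = num_dens X \<longrightarrow> n = num_pieces X \<longrightarrow>
      describes 1 X f \<longrightarrow> (\<forall>j<m. prob_density (f j)) \<longrightarrow> 0 < \<delta> \<longrightarrow> 0 < \<epsilon> \<longrightarrow>
        (\<forall>\<omega>. \<exists>t \<sigma>. exec \<omega> P (initial_state 1 X \<delta> \<epsilon>) t \<sigma> \<and>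
           (\<delta> < 1 \<and> \<epsilon> \<le> 1 \<and> 2 \<le> real m / \<delta> \<longrightarrow>
              real t \<le> C * (real m * (real m + real n) * (1 / \<epsilon>\<^sup>2) * ln (real m / \<delta>)))) \<and>
        measure tape_measure
          {\<omega> \<in> space tape_measure.
             \<exists>t \<sigma>. exec \<omega> P (initial_state 1 X \<delta> \<epsilon>) t \<sigma> \<and>
                   rel_error_approx \<epsilon> m f (result m \<sigma>)} \<ge> 1 - \<delta>"
proof -
  interpret prob_space tape_measure by (rule prob_space_tape_measure)
  obtain c0 :: real where c0: "0 \<le> c0" "\<And>s. \<bar>s\<bar> \<le> 1 / 2 \<Longrightarrow> cauchy_moment s \<le> ennreal (exp (c0 * s\<^sup>2))"
    by (rule cauchy_moment_bound) blast
  \<comment> \<open>Raising the constant to at least 1 only weakens the moment bound; it keeps the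
    Chernoff parameters, which have \<open>c\<close> in their denominators, within the admissible
    range.\<close>
  define c where "c = max c0 1"
  have c: "cauchy_moment s \<le> ennreal (exp (c * s\<^sup>2))" if "\<bar>s\<bar> \<le> 1 / 2" for s
  proof -
    have "c0 * s\<^sup>2 \<le> c * s\<^sup>2" by (intro mult_right_mono) (auto simp: c_def)
    then have "ennreal (exp (c0 * s\<^sup>2)) \<le> ennreal (exp (c * s\<^sup>2))" by (intro ennreal_leI) simp
    then show "cauchy_moment s \<le> ennreal (exp (c * s\<^sup>2))" using c0(2)[OF that] by (rule order_trans[rotated])
  qed
  have c1: "1 \<le> c" by (simp add: c_def)
  define K where "K = Suc (nat \<lceil>64 * c * (ln 4 + ln (fail_const c))\<rceil>)"
  have K: "1 \<le> K" "64 * c * (ln 4 + ln (fail_const c)) \<le> real K"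
    using real_nat_ceiling_ge[of "64 * c * (ln 4 + ln (fail_const c))"] by (simp_all add: K_def)
  \<comment> \<open>176 comes from the operation count, 96 * 96 from R^4 \<le> (96 / \<epsilon>)^2,
    \<open>2 / ln 2\<close> from the rounded binary logarithm, and \<open>K\<close> from the sample
    size.\<close>
  define C where "C = 176 * (96 * 96 * (2 / ln 2) * real K)"
  show ?thesis
  proof (intro exI[of _ "L1_prog K"] exI[of _ C] allI impI)
    fix X :: input_data and f :: "nat \<Rightarrow> real \<Rightarrow> real" and \<delta> \<epsilon> :: real and m n :: nat
    assume m: "m = num_dens X" and n: "n = num_pieces X" and d: "describes 1 X f"
      and dens: "\<forall>j<m. prob_density (f j)" and \<delta>: "0 < \<delta>" and \<epsilon>: "0 < \<epsilon>"
    have wf: "well_formed X" using d by (simp add: describes_def)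
    define R L Q where "R = grid_size \<epsilon>" and "L = conf_bits m \<delta>" and "Q = sample_size K m \<delta> \<epsilon>"
    have Q: "Q = R * R * R * L * K" by (simp add: Q_def R_def L_def sample_size_def)
    have R24: "24 \<le> real (R * R) * min \<epsilon> 1" and R1: "1 \<le> R" and R96: "real (R * R) * min \<epsilon> 1 \<le> 96"
      using grid_size[OF \<epsilon>] by (simp_all add: R_def)
    have R2: "2 \<le> R"
    proof (rule ccontr)
      assume "\<not> 2 \<le> R"
      then have "R = 1" using R1 by simp
      then show False using R24 by simp
    qed
    have L: "1 \<le> L" "real m \<le> 2 ^ L * \<delta>" using conf_bits[OF \<delta>] by (simp_all add: L_def)
    have ratio: "ratio \<epsilon> = 1 + 1 / (real R)\<^sup>2" by (simp add: ratio_def R_def power2_eq_square)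
    let ?E = "\<lambda>\<omega> j k. estimate X R Q (1 + 1 / (real R)\<^sup>2) \<omega> j k"
    have run: "runs \<omega> (L1_prog K) (initial_state 1 X \<delta> \<epsilon>) (L1_prog_time K X \<delta> \<epsilon>)
        (\<lambda>\<tau>. \<forall>j<m. \<forall>k<m. result m \<tau> j k = ?E \<omega> j k)" for \<omega>
      using runs_L1_prog[OF \<delta> \<epsilon> K(1) wf, of \<omega>] unfolding ratio R_def[symmetric] m[symmetric] Q_def[symmetric] .
    have time: "real (L1_prog_time K X \<delta> \<epsilon>) \<le> C * (real m * (real m + real n) * (1 / \<epsilon>\<^sup>2) * ln (real m / \<delta>))"
      if "\<epsilon> \<le> 1" "2 \<le> real m / \<delta>"
    proof -
      have m1: "1 \<le> m" using that(2) by (cases m) auto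
      have n1: "1 \<le> n" using num_pieces_pos[OF d] m1 dens m n by simp
      have "L1_prog_time K X \<delta> \<epsilon> \<le> 176 * (m * (m + n) * (R * Q))"
        using L1_prog_time_le[OF _ _ num_ends_le[OF wf], of \<epsilon> \<delta> K] m1 n1 R1 L(1) K(1)
        by (simp add: m n R_def L_def Q_def)
      then have "real (L1_prog_time K X \<delta> \<epsilon>) \<le> real (176 * (m * (m + n) * (R * Q)))" by (simp only: of_nat_le_iff)
      also have "\<dots> = 176 * (real m * (real m + real n)) * (real (R * R) * real (R * R) * real L * real K)"
        by (simp add: Q)
      also have "\<dots> \<le> 176 * (real m * (real m + real n)) * ((96 / \<epsilon>) * (96 / \<epsilon>) * (2 * ln (real m / \<delta>) / ln 2) * real K)"
      proof (intro mult_left_mono mult_right_mono mult_mono)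
        show "real (R * R) \<le> 96 / \<epsilon>" using R96 that(1) \<epsilon> by (simp add: pos_le_divide_eq)
        then show "real (R * R) \<le> 96 / \<epsilon>" .
        show "real L \<le> 2 * ln (real m / \<delta>) / ln 2" unfolding L_def by (rule conf_bits(3)[OF \<delta> that(2)])
      qed (use \<epsilon> in auto)
      also have "\<dots> = C * (real m * (real m + real n) * (1 / \<epsilon>\<^sup>2) * ln (real m / \<delta>))"
        by (simp add: C_def power2_eq_square mult_ac)
      finally show ?thesis .
    qed
    \<comment> \<open>All runs on a tape end in the same state, so the existential event is one
      about \<open>estimate\<close>, which is known to be measurable.\<close>
    have set_eq: "{\<omega> \<in> space tape_measure. \<exists>t \<sigma>. exec \<omega> (L1_prog K) (initial_state 1 X \<delta> \<epsilon>) t \<sigma> \<and> rel_error_approx \<epsilon> m f (result m \<sigma>)}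
        = {\<omega> \<in> space tape_measure. \<forall>j<m. \<forall>k<m. pair_ok \<epsilon> (L1_dist (f j) (f k)) (?E \<omega> j k)}"
    proof (intro Collect_cong conj_cong refl)
      fix \<omega>
      obtain t \<sigma> where \<sigma>: "exec \<omega> (L1_prog K) (initial_state 1 X \<delta> \<epsilon>) t \<sigma>" "\<forall>j<m. \<forall>k<m. result m \<sigma> j k = ?E \<omega> j k"
        using run[of \<omega>] unfolding runs_def by blast
      have "rel_error_approx \<epsilon> m f (result m \<sigma>) \<longleftrightarrow> (\<forall>j<m. \<forall>k<m. pair_ok \<epsilon> (L1_dist (f j) (f k)) (?E \<omega> j k))"
        using \<sigma>(2) by (auto simp: rel_error_approx_def pair_ok_def)
      then show "(\<exists>t \<sigma>. exec \<omega> (L1_prog K) (initial_state 1 X \<delta> \<epsilon>) t \<sigma> \<and> rel_error_approx \<epsilon> m f (result m \<sigma>)) \<longleftrightarrow>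
          (\<forall>j<m. \<forall>k<m. pair_ok \<epsilon> (L1_dist (f j) (f k)) (?E \<omega> j k))"
        using \<sigma>(1) exec_deterministic by blast
    qed
    let ?good = "{\<omega> \<in> space tape_measure. \<forall>j<m. \<forall>k<m. pair_ok \<epsilon> (L1_dist (f j) (f k)) (?E \<omega> j k)}"
    let ?bad = "\<lambda>p. {\<omega> \<in> space tape_measure. \<not> pair_ok \<epsilon> (L1_dist (f (fst p)) (f (snd p))) (?E \<omega> (fst p) (snd p))}"
    let ?I = "{..<m} \<times> {..<m}"
    have "1 - \<delta> \<le> prob ?good"
    proof (cases "1 \<le> \<delta>")
      case True
      then show ?thesis by (intro order_trans[OF _ measure_nonneg]) simp
    next
      case False
      have bad [measurable]: "?bad p \<in> events" for p unfolding pair_ok_def by measurable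
      have good: "?good = space tape_measure - (\<Union>p\<in>?I. ?bad p)" by auto
      have "prob (\<Union>p\<in>?I. ?bad p) \<le> (\<Sum>p\<in>?I. prob (?bad p))"
      proof (rule finite_measure_subadditive_finite)
        show "?bad ` ?I \<subseteq> events" using bad by blast
      qed simp
      also have "\<dots> \<le> (\<Sum>p\<in>?I. (1 / 4) ^ L)"
        by (intro sum_mono pair_failure[OF c1 c K(2) d _ _ R2 R24 L(1) Q]) (auto simp: m)
      also have "\<dots> = (real m / 2 ^ L)\<^sup>2"
        by (simp add: power_divide power_one_over power2_eq_square flip: power_mult_distrib)
      also have "\<dots> \<le> \<delta>\<^sup>2" using L(2) by (intro power_mono) (auto simp: pos_divide_le_eq mult.commute)
      also have "\<dots> \<le> \<delta>" using False \<delta> by (simp add: power2_eq_square mult_left_le)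
      finally have "prob (\<Union>p\<in>?I. ?bad p) \<le> \<delta>" .
      moreover have "prob ?good = 1 - prob (\<Union>p\<in>?I. ?bad p)"
        unfolding good by (intro prob_compl sets.finite_UN bad) auto
      ultimately show ?thesis by simp
    qed
    moreover have "\<forall>\<omega>. \<exists>t \<sigma>. exec \<omega> (L1_prog K) (initial_state 1 X \<delta> \<epsilon>) t \<sigma> \<and>
           (\<delta> < 1 \<and> \<epsilon> \<le> 1 \<and> 2 \<le> real m / \<delta> \<longrightarrow>
              real t \<le> C * (real m * (real m + real n) * (1 / \<epsilon>\<^sup>2) * ln (real m / \<delta>)))"
    proof
      fix \<omega>
      obtain t \<sigma> where "exec \<omega> (L1_prog K) (initial_state 1 X \<delta> \<epsilon>) t \<sigma>" "t \<le> L1_prog_time K X \<delta> \<epsilon>"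
        using run[of \<omega>] unfolding runs_def by blast
      moreover from this(2) have "real t \<le> real (L1_prog_time K X \<delta> \<epsilon>)" by simp
      ultimately show "\<exists>t \<sigma>. exec \<omega> (L1_prog K) (initial_state 1 X \<delta> \<epsilon>) t \<sigma> \<and>
           (\<delta> < 1 \<and> \<epsilon> \<le> 1 \<and> 2 \<le> real m / \<delta> \<longrightarrow>
              real t \<le> C * (real m * (real m + real n) * (1 / \<epsilon>\<^sup>2) * ln (real m / \<delta>)))"
        using time by (meson order_trans)
    qed
    ultimately show "(\<forall>\<omega>. \<exists>t \<sigma>. exec \<omega> (L1_prog K) (initial_state 1 X \<delta> \<epsilon>) t \<sigma> \<and>
           (\<delta> < 1 \<and> \<epsilon> \<le> 1 \<and> 2 \<le> real m / \<delta> \<longrightarrow>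
              real t \<le> C * (real m * (real m + real n) * (1 / \<epsilon>\<^sup>2) * ln (real m / \<delta>)))) \<and>
        measure tape_measure
          {\<omega> \<in> space tape_measure.
             \<exists>t \<sigma>. exec \<omega> (L1_prog K) (initial_state 1 X \<delta> \<epsilon>) t \<sigma> \<and>
                   rel_error_approx \<epsilon> m f (result m \<sigma>)} \<ge> 1 - \<delta>"
      unfolding set_eq by blast
  qed
qed

end
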